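(* Let $a, b, p, q$ be integers with $a > b \ge 4$, $p \ge 0$ and $q > 0$. If the sequence $(a^p, b^q)$ (that is, $p$ terms equal to $a$ followed by $q$ terms equal to $b$) is graphical, then it admits a triangular realisation.
   Context: All graphs are finite and simple (no loops, no multiple edges); realisations need not be connected. A sequence of non-negative integers is graphical if there is a graph whose degree sequence is that sequence, i.e. whose vertices can be labelled $v_1,\dots,v_n$ so that $\deg(v_i)$ equals the $i$-th term; any such graph is a realisation of the sequence. The notation $x^k$ denotes $k$ repeated terms equal to $x$. A graph is triangular if every edge of it belongs to a $3$-cycle (triangle). *)

theory Defs
  imports Main "Graph_Theory.Pair_Digraph"
begin

text \<open>A finite simple graph is a \<^locale>\<open>pair_graph\<close>: the arc set is a symmetric, irreflexive
  relation on a finite vertex set, so an undirected edge \<open>uv\<close> is the pair of arcs \<open>(u, v)\<close> and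
  \<open>(v, u)\<close>, and the degree of a vertex is its out-degree.\<close>

definition vert_degree :: "'v pair_pre_digraph \<Rightarrow> 'v \<Rightarrow> nat" where
  "vert_degree G v = out_degree (with_proj G) v"

definition realisation :: "'v pair_pre_digraph \<Rightarrow> nat list \<Rightarrow> bool" where
  "realisation G ds \<longleftrightarrow> pair_graph G \<and>
     (\<exists>vs. distinct vs \<and> set vs = pverts G \<and> map (vert_degree G) vs = ds)"

text \<open>Vertices are taken from \<^typ>\<open>nat\<close> because a definition cannot quantify over types; lemma
  \<open>graphicalI\<close> below shows that nothing is lost.\<close>

definition graphical :: "nat list \<Rightarrow> bool" where
  "graphical ds \<longleftrightarrow> (\<exists>G :: nat pair_pre_digraph. realisation G ds)"

definition three_cycle :: "'v pair_pre_digraph \<Rightarrow> 'v \<Rightarrow> 'v \<Rightarrow> 'v \<Rightarrow> bool" where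
  "three_cycle G u v w \<longleftrightarrow> distinct [u, v, w] \<and>
     (u, v) \<in> parcs G \<and> (v, w) \<in> parcs G \<and> (w, u) \<in> parcs G"

definition triangular :: "'v pair_pre_digraph \<Rightarrow> bool" where
  "triangular G \<longleftrightarrow> (\<forall>(u, v) \<in> parcs G. \<exists>w. three_cycle G u v w)"

lemma vert_degree_eq_card:
  assumes "pair_graph G"
  shows "vert_degree G v = card {w. (v, w) \<in> parcs G}"
proof -
  have "out_arcs (with_proj G) v = Pair v ` {w. (v, w) \<in> parcs G}"
    by (auto simp: out_arcs_def)
  then show ?thesis
    by (simp add: vert_degree_def out_degree_def card_image inj_on_def)
qed

lemma graphicalI:
  fixes G :: "'v pair_pre_digraph"
  assumes "realisation G ds"
  shows "graphical ds"
proof -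
  interpret pair_graph G using assms by (simp add: realisation_def)
  obtain vs where vs: "distinct vs" "set vs = pverts G" "map (vert_degree G) vs = ds"
    using assms by (auto simp: realisation_def)
  obtain f :: "'v \<Rightarrow> nat" where f: "inj_on f (pverts G)"
    using finite_imp_inj_to_nat_seg[of "pverts G"] vs(2) by (metis List.finite_set)
  define H where "H = \<lparr> pverts = f ` pverts G, parcs = map_prod f f ` parcs G \<rparr>"
  have sub: "u \<in> pverts G \<and> v \<in> pverts G" if "(u, v) \<in> parcs G" for u v
    using that by (auto dest: arc_fst_in_verts arc_snd_in_verts)
  have ne: "u \<noteq> v" if "(u, v) \<in> parcs G" for u v
    using that by (auto dest: no_loops')
  have sm: "(v, u) \<in> parcs G" if "(u, v) \<in> parcs G" for u v
    using that by (auto intro: arcs_symmetric)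
  have fin: "finite (pverts G)" "finite (parcs G)"
    by auto
  have H: "pair_graph H"
  proof
    show "finite (pverts H)" "finite (parcs H)"
      using fin by (auto simp: H_def)
    show "fst e \<in> pverts H" "snd e \<in> pverts H" if "e \<in> parcs H" for e
      using that sub by (auto simp: H_def)
    show "fst e \<noteq> snd e" if "e \<in> parcs H" for e
      using that sub ne inj_onD[OF f] by (fastforce simp: H_def)
    show "symmetric (with_proj H)"
      unfolding symmetric_conv using sm by (force simp: H_def)
  qed
  have "vert_degree H (f v) = vert_degree G v" if "v \<in> pverts G" for v
  proof -
    have "{w. (f v, w) \<in> parcs H} = f ` {w. (v, w) \<in> parcs G}"
    proof
      show "{w. (f v, w) \<in> parcs H} \<subseteq> f ` {w. (v, w) \<in> parcs G}"
      proof
        fix x assume "x \<in> {w. (f v, w) \<in> parcs H}"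
        then obtain u w where uw: "(u, w) \<in> parcs G" "f u = f v" "x = f w"
          by (auto simp: H_def)
        then have "u = v" using f sub that by (auto simp: inj_on_def)
        then show "x \<in> f ` {w. (v, w) \<in> parcs G}" using uw by auto
      qed
    qed (force simp: H_def)
    moreover have "inj_on f {w. (v, w) \<in> parcs G}"
      using f by (rule inj_on_subset) (use sub in auto)
    ultimately show ?thesis
      by (simp add: vert_degree_eq_card H pair_graph card_image)
  qed
  then have "map (vert_degree H) (map f vs) = ds" "distinct (map f vs)" "set (map f vs) = pverts H"
    using vs f by (auto simp: H_def distinct_map)
  then show ?thesis
    using H unfolding graphical_def realisation_def by blast
qed

end

theory Submission
  imports Defs
begin

text \<open>
  By induction, a complete graph \<open>Q\<close> on \<open>b + 1\<close> vertices of degree \<open>b\<close>, or on \<open>a + 1\<close> vertices of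
  degree \<open>a\<close>, is split off as long as the remaining sequence stays graphical. If it does not, then
  \<open>g\<close> vertices of degree \<open>a\<close> and \<open>h\<close> vertices of degree \<open>b\<close> remain. They are realised as well as
  possible, essentially by a complete graph on the vertices of degree \<open>a\<close> joined to the others, and
  the missing degrees are supplied by links into \<open>Q\<close>. These are compensated by deleting from \<open>Q\<close> a
  graph in which every vertex has as many neighbours as it has links, sparse enough for all edges to
  stay in triangles. This needs the number of links to be at most \<open>d * (d - 2)\<close> when \<open>Q\<close> is a clique
  on \<open>d + 1\<close> vertices. Sequences exceeding this bound, and those with few vertices, are realised
  directly: two neighbourhoods inside a set whose size is below the sum of theirs intersect.
\<close>

section \<open>Graphs with prescribed degrees\<close>

text \<open>Of the given realisation only three numerical consequences are kept: parity of the
  degree sum, enough vertices, and one inequality counting the edges between the two classes. The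
  induction runs on these alone, so whether a remainder stays graphical is a comparison of numbers.
  The bound \<open>d * (d - 2)\<close> has this origin: some vertex of \<open>Q\<close> is kept free
  of links. If the other \<open>d\<close> all carry links, an edge from one of them to the free
  vertex needs a third vertex among the \<open>d\<close>, so at most \<open>d - 2\<close> edges may
  be deleted at each. Too few links are an obstacle as well. The smallest general pattern gives each
  of three vertices of \<open>Q\<close> two links from adjacent vertices and deletes the triangle on
  the three. If only two or four degrees are missing, one or two edges outside \<open>Q\<close> are
  deleted first, so that exactly six links are needed. A vertex that needs most of the links is
  linked to all link vertices instead. A clique of degree \<open>a\<close> never meets the bound.
  For degree \<open>b\<close> the inequality, valid before the split, leaves only a narrow range of
  excess.\<close>

definition gr :: "'v set \<Rightarrow> ('v \<times> 'v) set \<Rightarrow> bool" where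
  "gr V E \<longleftrightarrow> finite V \<and> E \<subseteq> V \<times> V \<and> sym E \<and> irrefl E"

definition deg :: "('v \<times> 'v) set \<Rightarrow> 'v \<Rightarrow> nat" where
  "deg E v = card (E `` {v})"

lemma grI:
  assumes "finite V" "E \<subseteq> V \<times> V" "\<And>x y. (x, y) \<in> E \<Longrightarrow> (y, x) \<in> E" "\<And>x. (x, x) \<notin> E"
  shows "gr V E"
  using assms by (auto simp: gr_def sym_def irrefl_def)

lemma grD:
  assumes "gr V E"
  shows "finite V" "E \<subseteq> V \<times> V" "(x, y) \<in> E \<Longrightarrow> (y, x) \<in> E" "(x, x) \<notin> E"
    "(x, y) \<in> E \<Longrightarrow> x \<in> V" "(x, y) \<in> E \<Longrightarrow> y \<in> V"
  using assms by (auto simp: gr_def sym_def irrefl_def)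

lemma gr_fin_Image: "gr V E \<Longrightarrow> finite (E `` {v})"
  by (rule finite_subset[of _ V]) (auto simp: gr_def)

lemma div_mod_eqI:
  fixes n :: nat
  assumes "n = q * s + r" "r < s"
  shows "n div s = q" "n mod s = r"
  using assms by auto

lemma obtain_subset:
  assumes "n \<le> card A"
  obtains B where "B \<subseteq> A" "card B = n" "finite B"
  using obtain_subset_with_card_n[OF assms] by metis

lemma add_vertex:
  assumes "gr S F" "v \<notin> S" "K \<subseteq> S"
  defines "F' \<equiv> F \<union> {v} \<times> K \<union> K \<times> {v}"
  shows "gr (insert v S) F'" "deg F' v = card K" "\<And>w. w \<in> S \<Longrightarrow> deg F' w = deg F w + of_bool (w \<in> K)"
proof -
  note g = grD[OF assms(1)]
  show "gr (insert v S) F'"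
    by (rule grI) (use g assms(2,3) in \<open>auto simp: F'_def\<close>)
  have "F' `` {v} = K" using g assms(2,3) by (auto simp: F'_def)
  then show "deg F' v = card K" by (simp add: deg_def)
  show "deg F' w = deg F w + of_bool (w \<in> K)" if "w \<in> S" for w
  proof (cases "w \<in> K")
    case True
    then have "F' `` {w} = insert v (F `` {w})" using g assms(2,3) by (auto simp: F'_def)
    moreover have "v \<notin> F `` {w}" using g assms(2) by auto
    ultimately show ?thesis using True gr_fin_Image[OF assms(1)] by (simp add: deg_def)
  next
    case False
    then have "F' `` {w} = F `` {w}" using that g assms(2,3) by (auto simp: F'_def)
    then show ?thesis using False by (simp add: deg_def)
  qed
qed

text \<open>Havel--Hakimi: delete a vertex of maximum degree and join it to vertices of largest remaining
  degree; the degrees that are left again take at most two consecutive values.\<close>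

lemma near_regular_graph:
  assumes "finite S" "T \<subseteq> S" "even (card S * k + card T)" "S \<noteq> {} \<Longrightarrow> k < card S"
    "T \<noteq> {} \<Longrightarrow> Suc k < card S"
  shows "\<exists>F. gr S F \<and> (\<forall>v\<in>S. deg F v = k + of_bool (v \<in> T))"
  using assms
proof (induction "card S" arbitrary: S T k)
  case 0
  then have "S = {}" by simp
  then show ?case by (intro exI[of _ "{}"]) (auto simp: gr_def sym_def irrefl_def)
next
  case (Suc n)
  note fin = \<open>finite S\<close> and cS = \<open>Suc n = card S\<close>[symmetric]
  have ne: "S \<noteq> {}" using cS by auto
  have kn: "k \<le> n" using Suc.prems(4) ne cS by simp
  have par: "even (Suc n * k + card T)" using Suc.prems(3) cS by simp
  show ?case
  proof (cases "T = {}")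
    case True
    show ?thesis
    proof (cases "k = 0")
      case True
      then show ?thesis using \<open>T = {}\<close> fin
        by (intro exI[of _ "{}"]) (auto simp: gr_def sym_def irrefl_def deg_def)
    next
      case False
      obtain v where v: "v \<in> S" using ne by auto
      let ?S = "S - {v}"
      have cn: "card ?S = n" using v cS fin by simp
      \<comment> \<open>The neighbours \<open>K\<close> of \<open>v\<close> drop to
        \<open>k - 1\<close> and the others stay at \<open>k\<close>, so the others are the raised
        set over the new base \<open>k - 1\<close>.\<close>
      obtain K where K: "K \<subseteq> ?S" "card K = k" using obtain_subset[of k ?S] kn cn by metis
      have cT: "card (?S - K) = n - k" using K cn fin by (simp add: card_Diff_subset finite_subset)
      \<comment> \<open>Deleting \<open>v\<close> lowers the degree sum by twice its degree; this
        carries the parity over.\<close>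
      have "n * (k - 1) + (n - k) + 2 * k = Suc n * k"
        using False kn by (cases k) auto
      then have ev: "even (card ?S * (k - 1) + card (?S - K))"
        using par True cn cT by (metis add.right_neutral card.empty dvd_add_left_iff dvd_triv_left)
      have "\<exists>F. gr ?S F \<and> (\<forall>w\<in>?S. deg F w = k - 1 + of_bool (w \<in> ?S - K))"
      proof (rule Suc.hyps(1))
        show "n = card ?S" "finite ?S" "?S - K \<subseteq> ?S" using cn fin by auto
        show "k - 1 < card ?S" using False kn cn by simp
        show "Suc (k - 1) < card ?S" if "?S - K \<noteq> {}"
        proof -
          have "card (?S - K) > 0" using that fin by (simp add: card_gt_0_iff)
          then show ?thesis using cT cn False by simp
        qed
      qed (fact ev)
      then obtain F where F: "gr ?S F" "\<forall>w\<in>?S. deg F w = k - 1 + of_bool (w \<in> ?S - K)" by auto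
      note a = add_vertex[OF F(1) _ K(1), of v]
      have "insert v ?S = S" using v by auto
      moreover have "deg (F \<union> {v} \<times> K \<union> K \<times> {v}) w = k + of_bool (w \<in> T)" if "w \<in> S" for w
      proof (cases "w = v")
        case True
        then show ?thesis using a(2) K(2) \<open>T = {}\<close> by simp
      next
        case wv: False
        then have w: "w \<in> ?S" using that by auto
        show ?thesis using a(3)[OF _ w] F(2) w False \<open>T = {}\<close> by (auto simp: of_bool_def)
      qed
      ultimately show ?thesis using a(1)
        by (intro exI[of _ "F \<union> {v} \<times> K \<union> K \<times> {v}"]) auto
    qed
  next
    case False
    then obtain v where v: "v \<in> T" by auto
    let ?S = "S - {v}" and ?T = "T - {v}"
    have vS: "v \<in> S" using v Suc.prems(2) by auto
    have finT: "finite T" using fin Suc.prems(2) finite_subset by blast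
    have cn: "card ?S = n" using vS cS fin by simp
    have cT: "card T = Suc (card ?T)" using card_Suc_Diff1[OF finT v] by simp
    have sub: "?T \<subseteq> ?S" using Suc.prems(2) by auto
    have tn: "card ?T \<le> n" using card_mono[OF _ sub] cn fin by auto
    have kn': "Suc k \<le> n" using Suc.prems(5) False cS by simp
    have iS: "insert v ?S = S" using vS by auto
    show ?thesis
    proof (cases "Suc k \<le> card ?T")
      case True
      \<comment> \<open>All neighbours of \<open>v\<close> can be taken among the raised vertices,
        so the base stays \<open>k\<close>.\<close>
      obtain K where K: "K \<subseteq> ?T" "card K = Suc k" using obtain_subset[OF True] by metis
      have cTK: "card (?T - K) = card ?T - Suc k" using K finT by (simp add: card_Diff_subset finite_subset)
      have "n * k + (card ?T - Suc k) + 2 * Suc k = Suc n * k + card T" using True cT by simp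
      then have ev: "even (card ?S * k + card (?T - K))"
        using par cn cTK by (metis dvd_add_left_iff dvd_triv_left)
      have "\<exists>F. gr ?S F \<and> (\<forall>w\<in>?S. deg F w = k + of_bool (w \<in> ?T - K))"
      proof (rule Suc.hyps(1))
        show "n = card ?S" "finite ?S" "?T - K \<subseteq> ?S" using cn fin sub by auto
        show "k < card ?S" using kn' cn by simp
        show "Suc k < card ?S" if "?T - K \<noteq> {}"
        proof -
          have "card (?T - K) > 0" using that finT by (simp add: card_gt_0_iff)
          then show ?thesis using cTK cn tn by simp
        qed
      qed (fact ev)
      then obtain F where F: "gr ?S F" "\<forall>w\<in>?S. deg F w = k + of_bool (w \<in> ?T - K)" by auto
      have KS: "K \<subseteq> ?S" using K(1) sub by auto
      note a = add_vertex[OF F(1) _ KS, of v]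
      have "deg (F \<union> {v} \<times> K \<union> K \<times> {v}) w = k + of_bool (w \<in> T)" if "w \<in> S" for w
      proof (cases "w = v")
        case True
        then show ?thesis using a(2) K(2) v by simp
      next
        case False
        then have w: "w \<in> ?S" using that by auto
        show ?thesis using a(3)[OF _ w] F(2) w False K(1) by (auto simp: of_bool_def)
      qed
      then show ?thesis using a(1) iS
        by (intro exI[of _ "F \<union> {v} \<times> K \<union> K \<times> {v}"]) auto
    next
      case nle: False
      \<comment> \<open>For \<open>k = 0\<close> the vertex \<open>v\<close> would be the only
        raised one and the degree sum would be odd. Hence the base \<open>k - 1\<close> below is not
        truncated.\<close>
      have k0: "k \<noteq> 0"
      proof
        assume "k = 0"
        then have "card T = 1" using nle cT by simp
        then show False using par \<open>k = 0\<close> by simp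
      qed
      \<comment> \<open>\<open>?T\<close> is used up and drops to \<open>k\<close>, and
        \<open>?m\<close> further neighbours drop to \<open>k - 1\<close>. Over the base
        \<open>k - 1\<close> everything except \<open>K'\<close> is then raised.\<close>
      let ?m = "Suc k - card ?T"
      have cST: "card (?S - ?T) = n - card ?T" using sub cn finT by (simp add: card_Diff_subset)
      obtain K' where K': "K' \<subseteq> ?S - ?T" "card K' = ?m"
        using obtain_subset[of ?m "?S - ?T"] cST kn' by (metis diff_le_mono)
      have fK': "finite K'" using K' fin finite_subset by blast
      let ?K = "?T \<union> K'"
      have cK: "card ?K = Suc k" using K' finT fK' nle by (subst card_Un_disjoint) auto
      have cTT: "card (?S - K') = n - ?m" using K' fK' cn by (subst card_Diff_subset) auto
      have mn: "?m \<le> n" using kn' by simp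
      have "n * (k - 1) + (n - ?m) + 2 * (Suc k) = Suc n * k + card T"
      proof -
        obtain j where j: "k = Suc j" using k0 by (cases k) auto
        show ?thesis using j cT nle kn' by simp
      qed
      then have ev: "even (card ?S * (k - 1) + card (?S - K'))"
        using par cn cTT by (metis dvd_add_left_iff dvd_triv_left)
      have "\<exists>F. gr ?S F \<and> (\<forall>w\<in>?S. deg F w = k - 1 + of_bool (w \<in> ?S - K'))"
      proof (rule Suc.hyps(1))
        show "n = card ?S" "finite ?S" "?S - K' \<subseteq> ?S" using cn fin by auto
        show "k - 1 < card ?S" using kn' cn by simp
        show "Suc (k - 1) < card ?S" using kn' cn k0 by simp
      qed (fact ev)
      then obtain F where F: "gr ?S F" "\<forall>w\<in>?S. deg F w = k - 1 + of_bool (w \<in> ?S - K')" by auto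
      have KS: "?K \<subseteq> ?S" using K'(1) sub by auto
      note a = add_vertex[OF F(1) _ KS, of v]
      have "deg (F \<union> {v} \<times> ?K \<union> ?K \<times> {v}) w = k + of_bool (w \<in> T)" if "w \<in> S" for w
      proof (cases "w = v")
        case True
        then show ?thesis using a(2) cK v by simp
      next
        case False
        then have w: "w \<in> ?S" using that by auto
        show ?thesis using a(3)[OF _ w] F(2) w k0 K'(1) False by (auto simp: of_bool_def)
      qed
      then show ?thesis using a(1) iS by (intro exI[of _ "F \<union> {v} \<times> ?K \<union> ?K \<times> {v}"]) auto
    qed
  qed
qed

text \<open>The sets are chosen one after the other, each time using the least covered elements first.\<close>

lemma balanced_relation:
  assumes "finite Y" "finite S" "S \<noteq> {}" "\<And>y. y \<in> Y \<Longrightarrow> f y \<le> card S"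
    "T \<subseteq> S" "card T = (\<Sum>y\<in>Y. f y) mod card S"
  shows "\<exists>R. R \<subseteq> Y \<times> S \<and> (\<forall>y\<in>Y. card (R `` {y}) = f y) \<and>
    (\<forall>v\<in>S. card (R\<inverse> `` {v}) = (\<Sum>y\<in>Y. f y) div card S + of_bool (v \<in> T))"
  using assms(1,4-)
proof (induction Y arbitrary: T rule: finite_induct)
  case empty
  then have "T = {}" using assms(2) finite_subset by fastforce
  then show ?case by auto
next
  case (insert y Y)
  let ?s = "card S" and ?N = "\<Sum>y\<in>Y. f y"
  have s0: "?s > 0" using assms(2,3) by (simp add: card_gt_0_iff)
  have finT: "finite T" using insert.prems(2) assms(2) finite_subset by blast
  have sum: "(\<Sum>y\<in>insert y Y. f y) = f y + ?N" using insert.hyps by simp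
  have fy: "f y \<le> ?s" using insert.prems(1) by simp
  have m: "?N mod ?s < ?s" using s0 by simp
  \<comment> \<open>\<open>D\<close> is the set for \<open>y\<close>, and \<open>T0\<close> consists
    of the elements that are one ahead before \<open>y\<close> is treated. Both are chosen backwards
    from the prescribed \<open>T\<close>.\<close>
  have "\<exists>T0 D. T0 \<subseteq> S \<and> D \<subseteq> S \<and> card T0 = ?N mod ?s \<and> card D = f y \<and>
    (\<forall>v\<in>S. ?N div ?s + of_bool (v \<in> T0) + of_bool (v \<in> D) = (f y + ?N) div ?s + of_bool (v \<in> T))"
  proof (cases "?N mod ?s + f y < ?s")
    case True
    then have eq: "(f y + ?N) mod ?s = ?N mod ?s + f y" "(f y + ?N) div ?s = ?N div ?s"
      using mod_add_left_eq[of ?N ?s "f y"] div_add1_eq[of ?N "f y" ?s] fy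
      by (auto simp: add.commute[of "f y"] le_less)
    have cT: "card T = ?N mod ?s + f y" using insert.prems(3) sum eq by simp
    obtain T0 where T0: "T0 \<subseteq> T" "card T0 = ?N mod ?s" using obtain_subset[of "?N mod ?s" T] cT by auto
    have "card (T - T0) = f y" using T0 cT finT by (simp add: card_Diff_subset finite_subset)
    then show ?thesis using T0 insert.prems(2) eq by (intro exI[of _ T0] exI[of _ "T - T0"]) auto
  next
    case False
    have "f y + ?N = (?N div ?s + 1) * ?s + (?N mod ?s + f y - ?s)"
    proof -
      have "f y + ?N = ?N div ?s * ?s + (?N mod ?s + f y)"
        using div_mult_mod_eq[of ?N ?s] by linarith
      then show ?thesis using False by simp
    qed
    moreover have lt: "?N mod ?s + f y - ?s < ?s" using m fy by linarith
    ultimately have eq: "(f y + ?N) mod ?s = ?N mod ?s + f y - ?s" "(f y + ?N) div ?s = ?N div ?s + 1"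
      using div_mod_eqI by blast+
    have cT: "card T = ?N mod ?s + f y - ?s" using insert.prems(3) sum eq by simp
    have cST: "card (S - T) = ?s - card T" using insert.prems(2) finT by (simp add: card_Diff_subset)
    \<comment> \<open>The sum wraps around: \<open>y\<close> covers everything except
      \<open>U\<close>, a part of the elements that were ahead. Afterwards only \<open>T\<close>,
      covered although ahead, is one above the rest.\<close>
    have "?N mod ?s - card T \<le> card (S - T)" using cST m by linarith
    then obtain U where U: "U \<subseteq> S - T" "card U = ?N mod ?s - card T" "finite U"
      using obtain_subset by metis
    have cTU: "card (T \<union> U) = ?N mod ?s" using U finT cT fy by (subst card_Un_disjoint) auto
    have cSU: "card (S - U) = ?s - card U"
      using U by (intro card_Diff_subset) auto
    have "card (S - U) = f y" using cSU U(2) cT False m fy by linarith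
    then show ?thesis using U cTU insert.prems(2) eq
      by (intro exI[of _ "T \<union> U"] exI[of _ "S - U"]) (auto simp: of_bool_def)
  qed
  then obtain T0 D where TD: "T0 \<subseteq> S" "D \<subseteq> S" "card T0 = ?N mod ?s" "card D = f y"
    "\<forall>v\<in>S. ?N div ?s + of_bool (v \<in> T0) + of_bool (v \<in> D) = (f y + ?N) div ?s + of_bool (v \<in> T)" by auto
  obtain R where R: "R \<subseteq> Y \<times> S" "\<forall>z\<in>Y. card (R `` {z}) = f z"
    "\<forall>v\<in>S. card (R\<inverse> `` {v}) = ?N div ?s + of_bool (v \<in> T0)"
    using insert.IH[OF _ TD(1,3)] insert.prems(1) by auto
  let ?R = "R \<union> {y} \<times> D"
  have "?R \<subseteq> insert y Y \<times> S" using R TD by auto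
  moreover have "card (?R `` {z}) = f z" if "z \<in> insert y Y" for z
  proof (cases "z = y")
    case True
    then have "?R `` {z} = D" using R(1) insert.hyps by auto
    then show ?thesis using TD True by simp
  next
    case False
    then have "?R `` {z} = R `` {z}" by auto
    then show ?thesis using R that False by simp
  qed
  moreover have "card (?R\<inverse> `` {v}) = (f y + ?N) div ?s + of_bool (v \<in> T)" if v: "v \<in> S" for v
  proof -
    have fin: "finite (R\<inverse> `` {v})" by (rule finite_subset[OF _ insert.hyps(1)]) (use R(1) in auto)
    have "y \<notin> R\<inverse> `` {v}" using R(1) insert.hyps by auto
    moreover have "?R\<inverse> `` {v} = R\<inverse> `` {v} \<union> (if v \<in> D then {y} else {})" by auto
    ultimately have "card (?R\<inverse> `` {v}) = card (R\<inverse> `` {v}) + of_bool (v \<in> D)" using fin by auto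
    then show ?thesis using R(3) TD(5) v by auto
  qed
  ultimately show ?case using sum by (intro exI[of _ ?R]) auto
qed

section \<open>Linking a graph to a thinned clique\<close>

text \<open>In a symmetric irreflexive relation a common neighbour differs from both ends, which
  gives the distinctness demanded in \<open>three_cycle\<close>.\<close>

definition tri :: "('v \<times> 'v) set \<Rightarrow> bool" where
  "tri E \<longleftrightarrow> (\<forall>x y. (x, y) \<in> E \<longrightarrow> (\<exists>w. (x, w) \<in> E \<and> (y, w) \<in> E))"

lemma triD: "tri E \<Longrightarrow> (x, y) \<in> E \<Longrightarrow> \<exists>w. (x, w) \<in> E \<and> (y, w) \<in> E"
  by (auto simp: tri_def)

text \<open>\<open>R\<close> is the set of links into the clique \<open>Q\<close>, and \<open>F\<close> is deleted from \<open>Q\<close> in exchange.\<close>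

definition linked :: "('v \<times> 'v) set \<Rightarrow> ('v \<times> 'v) set \<Rightarrow> ('v \<times> 'v) set \<Rightarrow> 'v set \<Rightarrow> ('v \<times> 'v) set" where
  "linked EZ R F Q = EZ \<union> R \<union> R\<inverse> \<union> (Q \<times> Q - Id - F)"

lemma linked_deg:
  assumes Z: "gr Z EZ" and Q: "finite Q" "Z \<inter> Q = {}" "Q1 \<subseteq> Q" and F: "gr Q1 F" and R: "R \<subseteq> Z \<times> Q1"
    and dF: "\<And>v. v \<in> Q1 \<Longrightarrow> deg F v = card (R\<inverse> `` {v})"
  shows "gr (Z \<union> Q) (linked EZ R F Q)"
    "z \<in> Z \<Longrightarrow> deg (linked EZ R F Q) z = deg EZ z + card (R `` {z})"
    "v \<in> Q \<Longrightarrow> deg (linked EZ R F Q) v = card Q - 1"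
proof -
  note gZ = grD[OF Z] and gF = grD[OF F]
  show "gr (Z \<union> Q) (linked EZ R F Q)"
  proof (rule grI)
    show "(x, x) \<notin> linked EZ R F Q" for x
      using gZ(4)[of x] Q(2,3) R unfolding linked_def by blast
  qed (use gZ gF Q R in \<open>auto simp: linked_def\<close>)
  show "deg (linked EZ R F Q) z = deg EZ z + card (R `` {z})" if z: "z \<in> Z"
  proof -
    have "linked EZ R F Q `` {z} = EZ `` {z} \<union> R `` {z}" using z Q R by (auto simp: linked_def)
    moreover have "EZ `` {z} \<inter> R `` {z} = {}" using gZ Q R by blast
    moreover have "finite (R `` {z})" by (rule finite_subset[OF _ Q(1)]) (use R Q in auto)
    ultimately show ?thesis using gr_fin_Image[OF Z] by (simp add: deg_def card_Un_disjoint)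
  qed
  show "deg (linked EZ R F Q) v = card Q - 1" if v: "v \<in> Q"
  proof -
    have eq: "linked EZ R F Q `` {v} = R\<inverse> `` {v} \<union> (Q - {v} - F `` {v})"
      using v Q R gZ by (auto simp: linked_def)
    have fR: "finite (R\<inverse> `` {v})" by (rule finite_subset[OF _ gZ(1)]) (use R in auto)
    have sub: "F `` {v} \<subseteq> Q - {v}" using gF Q by auto
    have le: "deg F v \<le> card Q - 1"
      using card_mono[OF _ sub] Q(1) v by (simp add: deg_def)
    have "card (Q - {v} - F `` {v}) = card Q - 1 - deg F v"
      using sub Q(1) v gr_fin_Image[OF F] by (simp add: card_Diff_subset deg_def)
    moreover have "card (R\<inverse> `` {v}) = deg F v"
    proof (cases "v \<in> Q1")
      case False
      then have "R\<inverse> `` {v} = {}" "F `` {v} = {}" using R gF by auto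
      then show ?thesis by (simp add: deg_def)
    qed (use dF in simp)
    moreover have "R\<inverse> `` {v} \<inter> (Q - {v} - F `` {v}) = {}" using R Q by auto
    ultimately show ?thesis using eq fR Q(1) le
      by (simp add: deg_def card_Un_disjoint)
  qed
qed

text \<open>Two vertices of \<open>Q1\<close> have any vertex of \<open>Q - Q1\<close> as common
  neighbour, and two vertices of \<open>Q\<close> outside \<open>Q1\<close> have any vertex of
  \<open>Q1\<close>. The mixed pair is critical: it needs a second vertex outside \<open>Q1\<close>,
  or a vertex of \<open>Q1\<close> that \<open>F\<close> does not separate from the first. This is
  the alternative in \<open>cQ\<close>. Link edges close on the side of \<open>EZ\<close> or inside
  \<open>Q\<close>, as \<open>cR\<close> offers.\<close>

lemma linked_tri:
  assumes Z: "gr Z EZ" and Q: "finite Q" "Z \<inter> Q = {}" "Q1 \<subseteq> Q" and F: "gr Q1 F" and R: "R \<subseteq> Z \<times> Q1"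
    and cZ: "\<And>x y. (x, y) \<in> EZ \<Longrightarrow>
      (\<exists>w. (x, w) \<in> EZ \<and> (y, w) \<in> EZ) \<or> (\<exists>v. (x, v) \<in> R \<and> (y, v) \<in> R)"
    and cR: "\<And>z v. (z, v) \<in> R \<Longrightarrow>
      (\<exists>z'. (z, z') \<in> EZ \<and> (z', v) \<in> R) \<or> (\<exists>v'. (z, v') \<in> R \<and> v' \<noteq> v \<and> (v, v') \<notin> F)"
    and cQ: "Q1 \<noteq> {}" "card (Q - Q1) \<ge> 2 \<or> (Q1 \<noteq> Q \<and> (\<forall>v\<in>Q1. deg F v + 2 \<le> card Q1))"
  shows "tri (linked EZ R F Q)"
proof -
  let ?E = "linked EZ R F Q"
  note gZ = grD[OF Z] and gF = grD[OF F]
  have g: "(y, x) \<in> ?E" if "(x, y) \<in> ?E" for x y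
    using that gZ gF by (auto simp: linked_def)
  have fQ1: "finite Q1" using Q finite_subset by blast
  have tR: "\<exists>w. (z, w) \<in> ?E \<and> (v, w) \<in> ?E" if "(z, v) \<in> R" for z v
    using cR[OF that]
  proof
    assume "\<exists>z'. (z, z') \<in> EZ \<and> (z', v) \<in> R"
    then show ?thesis by (auto simp: linked_def)
  next
    assume "\<exists>v'. (z, v') \<in> R \<and> v' \<noteq> v \<and> (v, v') \<notin> F"
    then show ?thesis using that R Q by (auto simp: linked_def)
  qed
  have half: "\<exists>w\<in>Q. w \<noteq> x \<and> w \<noteq> y \<and> (x, w) \<notin> F \<and> (y, w) \<notin> F" if "x \<in> Q1" "y \<in> Q - Q1" for x y
  proof (cases "card (Q - Q1) \<ge> 2")
    case True
    then have "card (Q - Q1 - {y}) \<noteq> 0" using that Q(1) by (simp add: card_Diff_singleton)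
    then have "Q - Q1 - {y} \<noteq> {}" by (metis card.empty)
    then obtain w where "w \<in> Q - Q1 - {y}" by blast
    moreover have "(x, w) \<notin> F" "(y, w) \<notin> F" using \<open>w \<in> Q - Q1 - {y}\<close> gF(5,6) by blast+
    ultimately show ?thesis using that(1) by (intro bexI[of _ w]) auto
  next
    case False
    then have "deg F x + 2 \<le> card Q1" using cQ that by auto
    moreover have "card (insert x (F `` {x})) \<le> Suc (deg F x)"
      unfolding deg_def by (rule card_insert_le_m1) auto
    ultimately have "\<not> Q1 \<subseteq> insert x (F `` {x})"
      using card_mono[of "insert x (F `` {x})" Q1] gr_fin_Image[OF F] by fastforce
    then obtain w where "w \<in> Q1" "w \<noteq> x" "(x, w) \<notin> F" by auto
    moreover have "(y, w) \<notin> F" using that gF(5) by blast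
    ultimately show ?thesis using that(2) Q(3) by (intro bexI[of _ w]) auto
  qed
  have tQ: "\<exists>w\<in>Q. w \<noteq> x \<and> w \<noteq> y \<and> (x, w) \<notin> F \<and> (y, w) \<notin> F" if "x \<in> Q" "y \<in> Q" "x \<noteq> y" for x y
  proof (cases "x \<in> Q1")
    case True
    show ?thesis
    proof (cases "y \<in> Q1")
      case y: True
      have "Q - Q1 \<noteq> {}" using cQ(2) Q(3) by (metis card.empty not_numeral_le_zero Diff_eq_empty_iff subset_antisym)
      then obtain w where w: "w \<in> Q - Q1" by blast
      then have "(x, w) \<notin> F" "(y, w) \<notin> F" using gF(6) by blast+
      then show ?thesis using True y w by (intro bexI[of _ w]) auto
    next
      case False
      then show ?thesis using half[of x y] True that by auto
    qed
  next
    case x: False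
    show ?thesis
    proof (cases "y \<in> Q1")
      case True
      then show ?thesis using half[of y x] x that by auto
    next
      case False
      obtain w where w: "w \<in> Q1" using cQ(1) by blast
      have "(x, w) \<notin> F" "(y, w) \<notin> F" using gF(5) x False by blast+
      then show ?thesis using w x False Q(3) by (intro bexI[of _ w]) auto
    qed
  qed
  show ?thesis unfolding tri_def
  proof (intro allI impI)
    fix x y assume xy: "(x, y) \<in> ?E"
    then consider "(x, y) \<in> EZ" | "(x, y) \<in> R" | "(y, x) \<in> R" | "x \<in> Q" "y \<in> Q" "x \<noteq> y" "(x, y) \<notin> F"
      by (auto simp: linked_def)
    then show "\<exists>w. (x, w) \<in> ?E \<and> (y, w) \<in> ?E"
    proof cases
      case 1
      then show ?thesis using cZ[OF 1] by (auto simp: linked_def)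
    next
      case 2
      then show ?thesis using tR by blast
    next
      case 3
      then show ?thesis using tR by blast
    next
      case 4
      then show ?thesis using tQ[OF 4(1-3)] by (auto simp: linked_def)
    qed
  qed
qed

definition extends :: "'v set \<Rightarrow> ('v \<Rightarrow> nat) \<Rightarrow> 'v set \<Rightarrow> nat \<Rightarrow> bool" where
  "extends Z D Q d \<longleftrightarrow> (\<exists>E. gr (Z \<union> Q) E \<and> tri E \<and> (\<forall>z\<in>Z. deg E z = D z) \<and> (\<forall>v\<in>Q. deg E v = d))"

lemma extendsI:
  assumes Z: "gr Z EZ" and Q: "finite Q" "Z \<inter> Q = {}" "Q1 \<subseteq> Q" and F: "gr Q1 F" and R: "R \<subseteq> Z \<times> Q1"
    and dF: "\<And>v. v \<in> Q1 \<Longrightarrow> deg F v = card (R\<inverse> `` {v})"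
    and cZ: "\<And>x y. (x, y) \<in> EZ \<Longrightarrow>
      (\<exists>w. (x, w) \<in> EZ \<and> (y, w) \<in> EZ) \<or> (\<exists>v. (x, v) \<in> R \<and> (y, v) \<in> R)"
    and cR: "\<And>z v. (z, v) \<in> R \<Longrightarrow>
      (\<exists>z'. (z, z') \<in> EZ \<and> (z', v) \<in> R) \<or> (\<exists>v'. (z, v') \<in> R \<and> v' \<noteq> v \<and> (v, v') \<notin> F)"
    and cQ: "Q1 \<noteq> {}" "card (Q - Q1) \<ge> 2 \<or> (Q1 \<noteq> Q \<and> (\<forall>v\<in>Q1. deg F v + 2 \<le> card Q1))"
    and D: "\<And>z. z \<in> Z \<Longrightarrow> D z = deg EZ z + card (R `` {z})" and cd: "card Q = Suc d"
  shows "extends Z D Q d"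
  unfolding extends_def using linked_deg[OF Z Q F R dF] linked_tri[OF Z Q F R cZ cR cQ] D cd
  by (intro exI[of _ "linked EZ R F Q"]) auto

section \<open>Spreading prescribed numbers of links evenly over the clique\<close>

text \<open>Balancing makes the link counts on \<open>Q1\<close> differ by at most one, which is the
  kind of degree sequence that \<open>near_regular_graph\<close> realises. The bound on
  \<open>N\<close> says that the deleted graph fits into a complete graph on
  \<open>Q1\<close>.\<close>

lemma balanced_links:
  assumes Z: "gr Z EZ" and Q1: "finite Q1" "Q1 \<noteq> {}"
    and f: "\<And>z. z \<in> Z \<Longrightarrow> f z \<le> card Q1" and N: "N = (\<Sum>z\<in>Z. f z)" "even N" "N \<le> card Q1 * (card Q1 - 1)"
  shows "\<exists>R F. R \<subseteq> Z \<times> Q1 \<and> (\<forall>z\<in>Z. card (R `` {z}) = f z) \<and> gr Q1 F \<and>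
    (\<forall>v\<in>Q1. deg F v = card (R\<inverse> `` {v}) \<and> N div card Q1 \<le> deg F v \<and>
      deg F v \<le> N div card Q1 + of_bool (N mod card Q1 \<noteq> 0))"
proof -
  let ?s = "card Q1"
  have s0: "?s > 0" using Q1 by (simp add: card_gt_0_iff)
  obtain T where T: "T \<subseteq> Q1" "card T = N mod ?s" "finite T"
    using obtain_subset[of "N mod ?s" Q1] s0 by (metis less_imp_le mod_less_divisor)
  obtain R where R: "R \<subseteq> Z \<times> Q1" "\<forall>z\<in>Z. card (R `` {z}) = f z"
    "\<forall>v\<in>Q1. card (R\<inverse> `` {v}) = N div ?s + of_bool (v \<in> T)"
    using balanced_relation[where f = f, OF grD(1)[OF Z] Q1 f T(1)] T(2) N(1) by auto
  have le: "N div ?s * ?s + N mod ?s \<le> (?s - 1) * ?s" using N(3) by (simp add: mult.commute)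
  have "\<exists>F. gr Q1 F \<and> (\<forall>v\<in>Q1. deg F v = N div ?s + of_bool (v \<in> T))"
  proof (rule near_regular_graph[OF Q1(1) T(1)])
    show "even (?s * (N div ?s) + card T)" using N(2) T(2) by simp
    have "N div ?s * ?s \<le> (?s - 1) * ?s" using le by linarith
    then have "N div ?s \<le> ?s - 1" using s0 by (simp only: mult_le_cancel2)
    then show "N div ?s < ?s" using s0 by linarith
    show "Suc (N div ?s) < ?s" if "T \<noteq> {}"
    proof -
      have "N mod ?s > 0" using that T by (metis card_gt_0_iff)
      then have "N div ?s * ?s < (?s - 1) * ?s" using le by linarith
      then have "N div ?s < ?s - 1" by (simp only: mult_less_cancel2)
      then show ?thesis by linarith
    qed
  qed
  then obtain F where F: "gr Q1 F" "\<forall>v\<in>Q1. deg F v = N div ?s + of_bool (v \<in> T)" by auto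
  have "T = {}" if "N mod ?s = 0" using that T by simp
  then show ?thesis using R F by (intro exI[of _ R] exI[of _ F]) (auto simp: of_bool_def)
qed

text \<open>\<open>s\<close> will be the number of link vertices: large enough for the
  \<open>m\<close> links of one vertex and for a simple deleted graph of degree sum
  \<open>N\<close>, yet small enough that every link vertex gets two links. The least
  \<open>s\<close> of sufficient capacity, raised to \<open>m\<close> if necessary, meets all this
  unless all but one vertex of the clique are needed.\<close>

lemma link_size:
  fixes N d :: nat
  assumes "even N" "6 \<le> N" "2 * m \<le> N" "m \<le> d" "N \<le> d * (d - 2)" "4 \<le> d"
  shows "\<exists>s. m \<le> s \<and> 2 \<le> s \<and> 2 * s \<le> N \<and> N \<le> s * (s - 1) \<and> s \<le> d \<and> (s = d \<longrightarrow> N \<le> d * (d - 2))"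
proof (cases "m \<le> d - 1 \<and> N \<le> (d - 1) * (d - 2)")
  case True
  define \<sigma> where "\<sigma> = (LEAST s. N \<le> s * (s - 1))"
  have ex: "N \<le> (d - 1) * (d - 1 - 1)" using True by (simp add: numeral_2_eq_2)
  have a: "N \<le> \<sigma> * (\<sigma> - 1)" "\<sigma> \<le> d - 1"
    unfolding \<sigma>_def using LeastI[of "\<lambda>s. N \<le> s * (s - 1)", OF ex] Least_le[of "\<lambda>s. N \<le> s * (s - 1)", OF ex] by auto
  have s3: "\<sigma> \<ge> 3"
  proof (rule ccontr)
    assume "\<not> \<sigma> \<ge> 3"
    then have "\<sigma> * (\<sigma> - 1) \<le> 2 * (2 - 1)" by (intro mult_le_mono) auto
    then show False using a(1) assms(2) by linarith
  qed
  have "2 * \<sigma> \<le> N"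
  proof (cases "\<sigma> = 3")
    case False
    then have "4 \<le> \<sigma>" using s3 by linarith
    then obtain t where t: "\<sigma> = t + 4" by (metis add.commute le_Suc_ex)
    \<comment> \<open>Minimality gives \<open>N > (\<sigma> - 1) * (\<sigma> - 2)\<close>, and
      parity adds one more; for \<open>\<sigma> = 4\<close> this extra unit is what reaches
      \<open>2 * \<sigma>\<close>.\<close>
    have "\<not> N \<le> (\<sigma> - 1) * (\<sigma> - 1 - 1)"
      using not_less_Least[of "\<sigma> - 1" "\<lambda>s. N \<le> s * (s - 1)"] s3 unfolding \<sigma>_def by auto
    moreover have "\<sigma> - 1 = t + 3" "t + 3 - 1 = t + 2" using t by simp_all
    ultimately have "\<not> N \<le> (t + 3) * (t + 2)" by metis
    then have "(t + 3) * (t + 2) < N" by linarith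
    moreover have "even ((t + 3) * (t + 2))" by simp
    ultimately have "(t + 3) * (t + 2) + 2 \<le> N" using assms(1) by presburger
    moreover have "(t + 3) * (t + 2) + 2 = 2 * \<sigma> + t * t + 3 * t" using t by (simp add: algebra_simps)
    ultimately show ?thesis by linarith
  qed (use assms in simp)
  moreover have "N \<le> max m \<sigma> * (max m \<sigma> - 1)"
    by (rule order_trans[OF a(1)]) (simp add: mult_le_mono)
  ultimately show ?thesis using True a s3 assms
    by (intro exI[of _ "max m \<sigma>"]) (auto simp: le_max_iff_disj)
next
  \<comment> \<open>Either one vertex needs \<open>d\<close> links, or \<open>d - 1\<close> link
    vertices cannot hold \<open>N\<close>.\<close>
  case False
  obtain t where t: "d = t + 4" using assms(6) by (metis add.commute le_Suc_ex)
  have "2 * d \<le> N"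
  proof (cases "m \<le> d - 1")
    case True
    then have "\<not> N \<le> (d - 1) * (d - 2)" using False by simp
    moreover have "d - 1 = t + 3" "d - 2 = t + 2" using t by simp_all
    ultimately have "\<not> N \<le> (t + 3) * (t + 2)" by metis
    then have "(t + 3) * (t + 2) < N" by linarith
    moreover have "even ((t + 3) * (t + 2))" by simp
    ultimately have "(t + 3) * (t + 2) + 2 \<le> N" using assms(1) by presburger
    moreover have "(t + 3) * (t + 2) + 2 = 2 * d + t * t + 3 * t" using t by (simp add: algebra_simps)
    ultimately show ?thesis by linarith
  qed (use assms in auto)
  moreover have "N \<le> d * (d - 1)" using assms(5) by (meson diff_le_mono2 mult_le_mono2 one_le_numeral order_trans)
  ultimately show ?thesis using assms by (intro exI[of _ d]) auto
qed

text \<open>Every link vertex receives at least two links, and these lead to adjacent vertices.\<close>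

lemma extends_by_multiple_links:
  assumes Z: "gr Z EZ" and Q: "finite Q" "Z \<inter> Q = {}" "card Q = Suc d" and d: "4 \<le> d"
    and cl: "\<And>y y'. y \<in> Z \<Longrightarrow> y' \<in> Z \<Longrightarrow> f y > 0 \<Longrightarrow> f y' > 0 \<Longrightarrow> y \<noteq> y' \<Longrightarrow> (y, y') \<in> EZ"
    and cZ: "\<And>x y. (x, y) \<in> EZ \<Longrightarrow> (\<exists>w. (x, w) \<in> EZ \<and> (y, w) \<in> EZ) \<or> {z \<in> Z. f z > 0} = {x, y}"
    and N: "N = (\<Sum>z\<in>Z. f z)" "even N" "6 \<le> N" "N \<le> d * (d - 2)"
    and f: "\<And>z. z \<in> Z \<Longrightarrow> f z \<le> m" "2 * m \<le> N" "m \<le> d"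
    and D: "\<And>z. z \<in> Z \<Longrightarrow> D z = deg EZ z + f z"
  shows "extends Z D Q d"
proof -
  obtain s where s: "m \<le> s" "2 \<le> s" "2 * s \<le> N" "N \<le> s * (s - 1)" "s \<le> d" "s = d \<Longrightarrow> N \<le> d * (d - 2)"
    using link_size[OF N(2,3) f(2,3) N(4) d] by blast
  obtain Q1 where Q1: "Q1 \<subseteq> Q" "card Q1 = s" "finite Q1" using obtain_subset[of s Q] s(5) Q(3) by auto
  have ne: "Q1 \<noteq> {}" using Q1 s(2) by auto
  have fs: "f z \<le> card Q1" if "z \<in> Z" for z using f(1)[OF that] s(1) Q1 by simp
  have NQ: "N \<le> card Q1 * (card Q1 - 1)" using s(4) unfolding Q1(2) .
  obtain R F where R: "R \<subseteq> Z \<times> Q1" "\<And>z. z \<in> Z \<Longrightarrow> card (R `` {z}) = f z" "gr Q1 F"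
    "\<And>v. v \<in> Q1 \<Longrightarrow> deg F v = card (R\<inverse> `` {v})"
    "\<And>v. v \<in> Q1 \<Longrightarrow> N div card Q1 \<le> deg F v \<and> deg F v \<le> N div card Q1 + of_bool (N mod card Q1 \<noteq> 0)"
    using balanced_links[OF Z Q1(3) ne fs N(1,2) NQ] by blast
  have two: "2 \<le> card (R\<inverse> `` {v})" if "v \<in> Q1" for v
  proof -
    have "2 \<le> N div s" using s(2,3) by (simp add: less_eq_div_iff_mult_less_eq)
    then show ?thesis using R(4,5)[OF that] Q1(2) by simp
  qed
  have pos: "f z > 0" if "(z, v) \<in> R" for z v
  proof -
    have "finite (R `` {z})" by (rule finite_subset[OF _ Q1(3)]) (use R(1) in auto)
    then have "card (R `` {z}) > 0" using that by (auto simp: card_gt_0_iff)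
    then show ?thesis using R that by auto
  qed
  have other: "\<exists>z'. z' \<noteq> z \<and> (z', v) \<in> R" if "v \<in> Q1" for z v
  proof (rule ccontr)
    assume "\<not> ?thesis"
    then have "R\<inverse> `` {v} \<subseteq> {z}" by auto
    then have "card (R\<inverse> `` {v}) \<le> card {z}" by (intro card_mono) auto
    then show False using two[OF that] by simp
  qed
  show ?thesis
  proof (rule extendsI[OF Z Q(1,2) Q1(1) R(3,1)])
    show "(\<exists>w. (x, w) \<in> EZ \<and> (y, w) \<in> EZ) \<or> (\<exists>v. (x, v) \<in> R \<and> (y, v) \<in> R)" if xy: "(x, y) \<in> EZ" for x y
      using cZ[OF xy]
    proof
      \<comment> \<open>Only \<open>x\<close> and \<open>y\<close> are linked. A link vertex has at
        least two links, hence is linked to both and closes the edge between them.\<close>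
      assume Y: "{z \<in> Z. f z > 0} = {x, y}"
      obtain v where v: "v \<in> Q1" using ne by auto
      have sub: "R\<inverse> `` {v} \<subseteq> {x, y}"
      proof
        fix z assume "z \<in> R\<inverse> `` {v}"
        then have "z \<in> {z \<in> Z. f z > 0}" using pos R(1) by auto
        then show "z \<in> {x, y}" using Y by simp
      qed
      have "x \<noteq> y" using xy grD[OF Z] by auto
      then have "R\<inverse> `` {v} = {x, y}" using sub two[OF v] by (intro card_seteq) auto
      then show ?thesis by (intro disjI2 exI[of _ v]) auto
    qed auto
    show "(\<exists>z'. (z, z') \<in> EZ \<and> (z', v) \<in> R) \<or> (\<exists>v'. (z, v') \<in> R \<and> v' \<noteq> v \<and> (v, v') \<notin> F)"
      if zv: "(z, v) \<in> R" for z v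
    proof -
      obtain z' where z': "z' \<noteq> z" "(z', v) \<in> R" using other[of v z] zv R(1) by auto
      then have "(z, z') \<in> EZ" using cl[of z z'] pos[OF zv] pos[OF z'(2)] zv R(1) by auto
      then show ?thesis using z' by auto
    qed
    show "card (Q - Q1) \<ge> 2 \<or> (Q1 \<noteq> Q \<and> (\<forall>v\<in>Q1. deg F v + 2 \<le> card Q1))"
    proof (cases "s = d")
      \<comment> \<open>A single vertex of \<open>Q\<close> is free of links here. As
        \<open>N \<le> s * (s - 2)\<close>, even the rounded-up quotient is at most
        \<open>s - 2\<close>.\<close>
      case True
      have le: "N \<le> s * (s - 2)" using s(6) True by simp
      have "deg F v + 2 \<le> s" if "v \<in> Q1" for v
      proof -
        have "s * (N div s) + N mod s \<le> s * (s - 2)" using le by simp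
        have a: "N div s \<le> s - 2" using div_le_mono[OF le, of s] s(2) by simp
        have "N div s + of_bool (N mod s \<noteq> 0) \<le> s - 2"
        proof (cases "N mod s = 0 \<or> N div s < s - 2")
          case False
          then have "N div s = s - 2" using a by auto
          then have "N = s * (s - 2) + N mod s" by (metis mult_div_mod_eq)
          then show ?thesis using le False by linarith
        qed (use a in auto)
        moreover have "deg F v \<le> N div s + of_bool (N mod s \<noteq> 0)"
          using R(5)[OF that] unfolding Q1(2) by blast
        ultimately show ?thesis using s(2) by linarith
      qed
      moreover have "Q1 \<noteq> Q" using Q1 Q True by auto
      ultimately show ?thesis using Q1(2) by auto
    next
      case False
      then have "card (Q - Q1) \<ge> 2" using Q1 Q s(5) by (simp add: card_Diff_subset)
      then show ?thesis by blast
    qed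
    show "D z = deg EZ z + card (R `` {z})" if "z \<in> Z" for z using D R(2) that by simp
  qed (use R(4) ne Q in auto)
qed

text \<open>Here one vertex is linked to all link vertices.\<close>

lemma extends_by_hub:
  assumes Z: "gr Z EZ" and Q: "finite Q" "Z \<inter> Q = {}" "card Q = Suc d"
    and y: "y \<in> Z" "f y = s" "s \<le> d" "s > 0"
    and cl: "\<And>z. z \<in> Z \<Longrightarrow> f z > 0 \<Longrightarrow> z \<noteq> y \<Longrightarrow> (z, y) \<in> EZ"
    and cZ: "\<And>x w. (x, w) \<in> EZ \<Longrightarrow> (\<exists>v. (x, v) \<in> EZ \<and> (w, v) \<in> EZ) \<or> (y \<in> {x, w} \<and> f x > 0 \<and> f w > 0)"
    and N: "N = (\<Sum>z\<in>Z. f z)" "even N" "N \<le> s * (s - 2)"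
    and f: "\<And>z. z \<in> Z \<Longrightarrow> f z \<le> s"
    and D: "\<And>z. z \<in> Z \<Longrightarrow> D z = deg EZ z + f z"
  shows "extends Z D Q d"
proof -
  obtain Q1 where Q1: "Q1 \<subseteq> Q" "card Q1 = s" "finite Q1" using obtain_subset[of s Q] y(3) Q(3) by auto
  have ne: "Q1 \<noteq> {}" using Q1 y(4) by auto
  have fs: "f z \<le> card Q1" if "z \<in> Z" for z using f(1)[OF that] Q1 by simp
  have "s * (s - 2) \<le> s * (s - 1)" by (intro mult_le_mono) auto
  then have NQ: "N \<le> card Q1 * (card Q1 - 1)" using order_trans[OF N(3)] unfolding Q1(2) by blast
  obtain R F where R: "R \<subseteq> Z \<times> Q1" "\<And>z. z \<in> Z \<Longrightarrow> card (R `` {z}) = f z" "gr Q1 F"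
    "\<And>v. v \<in> Q1 \<Longrightarrow> deg F v = card (R\<inverse> `` {v})"
    "\<And>v. v \<in> Q1 \<Longrightarrow> N div card Q1 \<le> deg F v \<and> deg F v \<le> N div card Q1 + of_bool (N mod card Q1 \<noteq> 0)"
    using balanced_links[OF Z Q1(3) ne fs N(1,2) NQ] by blast
  have "R `` {y} = Q1" using R(1,2) y Q1 by (intro card_subset_eq) auto
  then have hub: "(y, v) \<in> R" if "v \<in> Q1" for v using that by auto
  have "s \<le> N" using member_le_sum[of y Z f] y N(1) grD(1)[OF Z] by simp
  \<comment> \<open>The hub alone has \<open>s\<close> links, so
    \<open>s \<le> N \<le> s * (s - 2)\<close>.\<close>
  have s3: "3 \<le> s"
  proof (rule ccontr)
    assume "\<not> 3 \<le> s"
    then have "s * (s - 2) = 0" by simp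
    then show False using N(3) \<open>s \<le> N\<close> y(4) by linarith
  qed
  have dF: "deg F v + 2 \<le> s" if "v \<in> Q1" for v
  proof -
    have a: "N div s \<le> s - 2" using div_le_mono[OF N(3), of s] y(4) by simp
    have "N div s + of_bool (N mod s \<noteq> 0) \<le> s - 2"
    proof (cases "N mod s = 0 \<or> N div s < s - 2")
      case False
      then have "N div s = s - 2" using a by auto
      then have "N = s * (s - 2) + N mod s" by (metis mult_div_mod_eq)
      then show ?thesis using N(3) False by linarith
    qed (use a in auto)
    moreover have "deg F v \<le> N div s + of_bool (N mod s \<noteq> 0)"
      using R(5)[OF that] unfolding Q1(2) by blast
    ultimately show ?thesis using s3 by linarith
  qed
  have pos: "f z > 0" if "(z, v) \<in> R" for z v
  proof -
    have "finite (R `` {z})" by (rule finite_subset[OF _ Q1(3)]) (use R(1) in auto)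
    then have "card (R `` {z}) > 0" using that by (auto simp: card_gt_0_iff)
    then show ?thesis using R that by auto
  qed
  have ex: "\<exists>v\<in>Q1. (x, v) \<in> R" if "x \<in> Z" "f x > 0" for x
  proof -
    have "R `` {x} \<noteq> {}" using R(2)[OF that(1)] that(2) by auto
    then show ?thesis using R(1) by auto
  qed
  show ?thesis
  proof (rule extendsI[OF Z Q(1,2) Q1(1) R(3,1)])
    show "(\<exists>v. (x, v) \<in> EZ \<and> (w, v) \<in> EZ) \<or> (\<exists>v. (x, v) \<in> R \<and> (w, v) \<in> R)" if xw: "(x, w) \<in> EZ" for x w
    proof -
      have xwZ: "x \<in> Z" "w \<in> Z" using xw grD[OF Z] by auto
      show ?thesis using cZ[OF xw] ex[OF xwZ(1)] ex[OF xwZ(2)] hub by blast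
    qed
    show "(\<exists>z'. (z, z') \<in> EZ \<and> (z', v) \<in> R) \<or> (\<exists>v'. (z, v') \<in> R \<and> v' \<noteq> v \<and> (v, v') \<notin> F)"
      if zv: "(z, v) \<in> R" for z v
    proof (cases "z = y")
      \<comment> \<open>The hub sees all of \<open>Q1\<close>, so its edge to \<open>v\<close>
        closes at any vertex of \<open>Q1\<close> that \<open>F\<close> does not separate from
        \<open>v\<close>.\<close>
      case True
      have v: "v \<in> Q1" using zv R(1) by auto
      have "card (insert v (F `` {v})) \<le> Suc (deg F v)"
        unfolding deg_def by (rule card_insert_le_m1) auto
      then have "\<not> Q1 \<subseteq> insert v (F `` {v})"
        using card_mono[of "insert v (F `` {v})" Q1] gr_fin_Image[OF R(3)] dF[OF v] Q1(2) by fastforce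
      then show ?thesis using hub True by auto
    next
      case False
      then show ?thesis using cl[of z] pos[OF zv] zv R(1) hub by auto
    qed
    show "card (Q - Q1) \<ge> 2 \<or> (Q1 \<noteq> Q \<and> (\<forall>v\<in>Q1. deg F v + 2 \<le> card Q1))"
      using dF Q1(2) y(3) Q(3) by auto
    show "D z = deg EZ z + card (R `` {z})" if "z \<in> Z" for z using D R(2) that by simp
  qed (use R(4) ne Q in auto)
qed

section \<open>Links in pairs and edge exchanges\<close>

text \<open>Each link vertex is attached to both ends of one edge of \<open>EZ\<close>, so its two
  link edges close over that edge, whatever the other linked vertices are. The deleted graph is
  2-regular, which takes at least three link vertices.\<close>

lemma extends_by_pairs:
  assumes Z: "gr Z EZ" "tri EZ" and Q: "finite Q" "Z \<inter> Q = {}" "card Q = Suc d"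
    and Q1: "Q1 \<subseteq> Q" "3 \<le> card Q1" "card Q1 + 1 \<le> d \<or> (card Q1 = d \<and> 4 \<le> d)"
    and p: "\<And>v. v \<in> Q1 \<Longrightarrow> (l v, r v) \<in> EZ"
    and D: "\<And>z. z \<in> Z \<Longrightarrow> D z = deg EZ z + card {v \<in> Q1. z = l v \<or> z = r v}"
  shows "extends Z D Q d"
proof -
  note gZ = grD[OF Z(1)]
  have fQ1: "finite Q1" using Q Q1 finite_subset by blast
  obtain F where F: "gr Q1 F" "\<forall>v\<in>Q1. deg F v = 2"
    using near_regular_graph[of Q1 "{}" 2] fQ1 Q1(2) by auto
  define R where "R = {(z, v). v \<in> Q1 \<and> (z = l v \<or> z = r v)}"
  have R: "R \<subseteq> Z \<times> Q1" using p gZ by (auto simp: R_def)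
  have Rv: "R\<inverse> `` {v} = {l v, r v}" "l v \<noteq> r v" if "v \<in> Q1" for v
    using that p[OF that] gZ(4) by (auto simp: R_def)
  have Rz: "R `` {z} = {v \<in> Q1. z = l v \<or> z = r v}" for z by (auto simp: R_def)
  show ?thesis
  proof (rule extendsI[OF Z(1) Q(1,2) Q1(1) F(1) R])
    show "(\<exists>z'. (z, z') \<in> EZ \<and> (z', v) \<in> R) \<or> (\<exists>v'. (z, v') \<in> R \<and> v' \<noteq> v \<and> (v, v') \<notin> F)"
      if "(z, v) \<in> R" for z v
      using that p[of v] gZ(3) by (auto simp: R_def)
    show "card (Q - Q1) \<ge> 2 \<or> (Q1 \<noteq> Q \<and> (\<forall>v\<in>Q1. deg F v + 2 \<le> card Q1))"
      using Q1(3)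
    proof
      assume "card Q1 + 1 \<le> d"
      then have "card (Q - Q1) \<ge> 2" using Q Q1 fQ1 by (simp add: card_Diff_subset)
      then show ?thesis by blast
    next
      assume "card Q1 = d \<and> 4 \<le> d"
      then show ?thesis using F(2) Q(3) by auto
    qed
    show "(\<exists>w. (x, w) \<in> EZ \<and> (y, w) \<in> EZ) \<or> (\<exists>v. (x, v) \<in> R \<and> (y, v) \<in> R)" if "(x, y) \<in> EZ" for x y
      using triD[OF Z(2) that] by blast
  qed (use F Rv Rz D Q1 Q in auto)
qed

lemma card_filter_sum: "finite A \<Longrightarrow> card {x \<in> A. P x} = (\<Sum>x\<in>A. of_bool (P x))"
  by (simp add: Int_def)

text \<open>The smallest instance: three link vertices, six links, and a triangle as deleted graph.
  The three edges may share ends or coincide.\<close>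

lemma extends_by_three_pairs:
  assumes Z: "gr Z EZ" "tri EZ" and Q: "finite Q" "Z \<inter> Q = {}" "card Q = Suc d" "4 \<le> d"
    and p: "(l1, r1) \<in> EZ" "(l2, r2) \<in> EZ" "(l3, r3) \<in> EZ"
    and D: "\<And>z. z \<in> Z \<Longrightarrow> D z = deg EZ z + of_bool (z = l1) + of_bool (z = r1) +
      of_bool (z = l2) + of_bool (z = r2) + of_bool (z = l3) + of_bool (z = r3)"
  shows "extends Z D Q d"
proof -
  obtain Q1 where Q1: "Q1 \<subseteq> Q" "card Q1 = 3" using obtain_subset[of 3 Q] Q(3,4) by auto
  then obtain v1 v2 v3 where v: "Q1 = {v1, v2, v3}" "v1 \<noteq> v2" "v1 \<noteq> v3" "v2 \<noteq> v3"
    by (auto simp: card_3_iff)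
  define l where "l = (\<lambda>v. if v = v1 then l1 else if v = v2 then l2 else l3)"
  define r where "r = (\<lambda>v. if v = v1 then r1 else if v = v2 then r2 else r3)"
  have ne: "l1 \<noteq> r1" "l2 \<noteq> r2" "l3 \<noteq> r3" using p grD(4)[OF Z(1)] by auto
  show ?thesis
  proof (rule extends_by_pairs[OF Z Q(1-3) Q1(1), of l r])
    show "(l v, r v) \<in> EZ" if "v \<in> Q1" for v using that v p by (auto simp: l_def r_def)
    show "D z = deg EZ z + card {v \<in> Q1. z = l v \<or> z = r v}" if "z \<in> Z" for z
    proof -
      have "card {v \<in> Q1. z = l v \<or> z = r v} = (\<Sum>v\<in>Q1. of_bool (z = l v \<or> z = r v))"
        by (rule card_filter_sum) (simp add: v(1))
      also have "\<dots> = of_bool (z = l1 \<or> z = r1) + of_bool (z = l2 \<or> z = r2) + of_bool (z = l3 \<or> z = r3)"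
        using v by (simp add: l_def r_def)
      finally have "card {v \<in> Q1. z = l v \<or> z = r v} =
        of_bool (z = l1 \<or> z = r1) + of_bool (z = l2 \<or> z = r2) + of_bool (z = l3 \<or> z = r3)" .
      moreover have "of_bool (z = x \<or> z = y) = (of_bool (z = x) + of_bool (z = y) :: nat)" if "x \<noteq> y" for x y
        using that by auto
      ultimately show ?thesis using D[OF that] ne by simp
    qed
  qed (use Q1 Q in auto)
qed

lemma remove_edge:
  assumes "gr V E" "(x, y) \<in> E"
  defines "E' \<equiv> E - {(x, y), (y, x)}"
  shows "gr V E'" "deg E z = deg E' z + of_bool (z = x) + of_bool (z = y)"
proof -
  note g = grD[OF assms(1)]
  show "gr V E'" by (rule grI) (use g in \<open>auto simp: E'_def\<close>)
  have ne: "x \<noteq> y" using g(4) assms(2) by auto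
  have fin: "finite (E `` {z})" by (rule gr_fin_Image[OF assms(1)])
  consider "z = x" | "z = y" | "z \<noteq> x" "z \<noteq> y" by auto
  then show "deg E z = deg E' z + of_bool (z = x) + of_bool (z = y)"
  proof cases
    case 1
    have "E `` {x} = insert y (E' `` {x})" "y \<notin> E' `` {x}" using assms(2) ne by (auto simp: E'_def)
    then show ?thesis using 1 ne fin by (simp add: deg_def)
  next
    case 2
    have "E `` {y} = insert x (E' `` {y})" "x \<notin> E' `` {y}" using assms(2) ne g(3) by (auto simp: E'_def)
    then show ?thesis using 2 ne fin by (simp add: deg_def)
  next
    case 3
    then have "E' `` {z} = E `` {z}" by (auto simp: E'_def)
    then show ?thesis using 3 by (simp add: deg_def)
  qed
qed

text \<open>Four missing degrees become six when the edge \<open>x1 x2\<close> is deleted; the six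
  ends are then grouped into three edges that survive the deletion.\<close>

lemma extends_by_exchange:
  assumes Z: "gr Z EZ" and Q: "finite Q" "Z \<inter> Q = {}" "card Q = Suc d" "4 \<le> d"
    and x: "(x1, x2) \<in> EZ"
    and E': "E' = EZ - {(x1, x2), (x2, x1)}" "tri E'"
    and w: "(w1, w2) \<in> E'" "(w3, x1) \<in> E'" "(w4, x2) \<in> E'"
    and D: "\<And>z. z \<in> Z \<Longrightarrow> D z = deg EZ z + of_bool (z = w1) + of_bool (z = w2) +
      of_bool (z = w3) + of_bool (z = w4)"
  shows "extends Z D Q d"
proof (rule extends_by_three_pairs[OF _ E'(2) Q w])
  note r = remove_edge[OF Z x]
  show "gr Z E'" using r(1) E' by simp
  show "D z = deg E' z + of_bool (z = w1) + of_bool (z = w2) + of_bool (z = w3) + of_bool (z = x1) +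
    of_bool (z = w4) + of_bool (z = x2)" if "z \<in> Z" for z
    using D[OF that] r(2)[of z] E'(1) by simp
qed

text \<open>Two missing degrees become six by two deletions. The middle pair joins an end of one
  deleted edge to an end of the other.\<close>

lemma extends_by_two_exchanges:
  assumes Z: "gr Z EZ" and Q: "finite Q" "Z \<inter> Q = {}" "card Q = Suc d" "4 \<le> d"
    and x: "(x1, x2) \<in> EZ" "(x3, x4) \<in> EZ" "{x1, x2} \<noteq> {x3, x4}"
    and E': "E' = EZ - {(x1, x2), (x2, x1)} - {(x3, x4), (x4, x3)}" "tri E'"
    and w: "(w1, x1) \<in> E'" "(x2, x3) \<in> E'" "(x4, w2) \<in> E'"
    and D: "\<And>z. z \<in> Z \<Longrightarrow> D z = deg EZ z + of_bool (z = w1) + of_bool (z = w2)"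
  shows "extends Z D Q d"
proof (rule extends_by_three_pairs[OF _ E'(2) Q w])
  note r = remove_edge[OF Z x(1)]
  have "(x3, x4) \<in> EZ - {(x1, x2), (x2, x1)}" using x by auto
  note r2 = remove_edge[OF r(1) this]
  show "gr Z E'" using r2(1) E' by simp
  show "D z = deg E' z + of_bool (z = w1) + of_bool (z = x1) + of_bool (z = x2) + of_bool (z = x3) +
    of_bool (z = x4) + of_bool (z = w2)" if "z \<in> Z" for z
    using D[OF that] r(2)[of z] r2(2)[of z] E'(1) by simp
qed

text \<open>A clique of at least five vertices stays triangular when a matching of two edges is deleted.\<close>

lemma extends_clique_small:
  assumes Z: "gr Z EZ" and K: "K \<subseteq> Z" "5 \<le> card K" "\<And>x y. x \<in> K \<Longrightarrow> y \<in> K \<Longrightarrow> x \<noteq> y \<Longrightarrow> (x, y) \<in> EZ"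
    and P: "\<And>z. z \<in> Z - K \<Longrightarrow> 4 \<le> card (EZ `` {z}) \<and> EZ `` {z} \<subseteq> K"
    and Q: "finite Q" "Z \<inter> Q = {}" "card Q = Suc d" "4 \<le> d"
    and N: "(\<Sum>z\<in>Z. f z) = 2 \<or> ((\<Sum>z\<in>Z. f z) = 4 \<and> (\<forall>z\<in>Z. f z \<le> 2))"
    and fK: "\<And>z. z \<in> Z - K \<Longrightarrow> f z = 0"
    and D: "\<And>z. z \<in> Z \<Longrightarrow> D z = deg EZ z + f z"
  shows "extends Z D Q d"
proof -
  note g = grD[OF Z]
  have fin: "finite K" using K(1) g(1) finite_subset by blast
  have big: "\<exists>w\<in>K - B. True" if "card B \<le> 4" "finite B" for B
  proof -
    have "\<not> K \<subseteq> B" using card_mono[OF that(2), of K] K(2) that(1) by linarith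
    then show ?thesis by auto
  qed
  \<comment> \<open>\<open>M\<close> is a matching and \<open>m\<close> gives the partner. Two
    clique vertices rule out at most themselves and their partners as common neighbours, so five
    vertices suffice. A vertex outside \<open>K\<close> has four neighbours in \<open>K\<close>, of
    which at most two are ruled out.\<close>
  have tri': "tri E'" if E': "E' = EZ - M" and M: "M \<subseteq> K \<times> K" "sym M"
    "\<And>z. M `` {z} \<subseteq> {m z}" for E' M m
    unfolding tri_def
  proof (intro allI impI)
    fix x y assume xy: "(x, y) \<in> E'"
    then have ne: "x \<noteq> y" and E: "(x, y) \<in> EZ" using g(4) E' by auto
    have sM: "(y, x) \<in> M \<longleftrightarrow> (x, y) \<in> M" for x y using M(2) by (auto simp: sym_def)
    have inK: "(x, w) \<in> E'" if "x \<in> K" "w \<in> K" "w \<noteq> x" "w \<noteq> m x" for x w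
      using that K(3)[of x w] E' M(3)[of x] by auto
    have out: "\<exists>w. (x, w) \<in> E' \<and> (y, w) \<in> E'" if "x \<in> K" "y \<in> Z - K" "(y, x) \<in> EZ" for x y
    proof -
      have "\<not> EZ `` {y} \<subseteq> {x, m x}"
        using P[OF that(2)] card_mono[of "{x, m x}" "EZ `` {y}"] card_insert_le_m1[of 2 "{m x}" x]
        by auto
      then obtain w where w: "(y, w) \<in> EZ" "w \<noteq> x" "w \<noteq> m x" by auto
      then have "(x, w) \<in> E'" using inK[OF that(1), of w] P[OF that(2)] by auto
      moreover have "(y, w) \<in> E'" using w(1) E' M(1) that(2) by auto
      ultimately show ?thesis by blast
    qed
    show "\<exists>w. (x, w) \<in> E' \<and> (y, w) \<in> E'"
    proof (cases "x \<in> K")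
      case xK: True
      show ?thesis
      proof (cases "y \<in> K")
        case True
        have "card {x, y, m x, m y} \<le> 4" using card_length[of "[x, y, m x, m y]"] by simp
        then obtain w where "w \<in> K" "w \<notin> {x, y, m x, m y}" using big[of "{x, y, m x, m y}"] by auto
        then show ?thesis using inK[OF xK] inK[OF True] by blast
      next
        case False
        then show ?thesis using out[of x y] xK g(3,6) E by blast
      qed
    next
      case False
      then have "y \<in> K" using P[of x] E g(5) by auto
      then show ?thesis using out[of y x] False g(5) E by blast
    qed
  qed
  let ?N = "\<Sum>z\<in>Z. f z"
  have NK: "?N = (\<Sum>z\<in>K. f z)" by (rule sum.mono_neutral_right) (use K(1) g(1) fK in auto)
  have rest: "?N = f y + (\<Sum>z\<in>K - {y}. f z)" if "y \<in> K" for y using NK that fin by (simp add: sum.remove)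
  have zero: "f z = 0" if "z \<in> Z" "z \<notin> Y" "Y \<subseteq> K" "?N = (\<Sum>z\<in>Y. f z)" for z Y
  proof (rule ccontr)
    assume "f z \<noteq> 0"
    then have zK: "z \<in> K" using fK[of z] that(1) by (cases "z \<in> K") simp_all
    have "(\<Sum>z\<in>insert z Y. f z) \<le> (\<Sum>z\<in>K. f z)" by (rule sum_mono2) (use fin zK that in auto)
    moreover have "(\<Sum>z\<in>insert z Y. f z) = f z + (\<Sum>z\<in>Y. f z)"
      using that(2,3) fin finite_subset by (subst sum.insert) auto
    ultimately show False using \<open>f z \<noteq> 0\<close> that(4) NK by linarith
  qed
  have pick: "\<exists>z\<in>K - B. f z > 0" if "(\<Sum>z\<in>B. f z) < ?N" "finite B" for B
  proof (rule ccontr)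
    assume "\<not> ?thesis"
    then have "(\<Sum>z\<in>K. f z) = (\<Sum>z\<in>K \<inter> B. f z)" using fin by (intro sum.mono_neutral_right) auto
    also have "\<dots> \<le> (\<Sum>z\<in>B. f z)" using that(2) by (intro sum_mono2) auto
    finally show False using that NK by simp
  qed
  have fresh: "\<exists>z\<in>K. z \<notin> set xs" if "length xs \<le> 4" for xs
    using big[of "set xs"] card_length[of xs] that by fastforce
  from N show ?thesis
  proof
    assume N2: "?N = 2"
    obtain y where y: "y \<in> K" "f y > 0" using pick[of "{}"] N2 by auto
    show ?thesis
    proof (cases "f y = 2")
      case True
      \<comment> \<open>Both missing degrees are at \<open>y\<close>: the deleted edges
        \<open>x1 x2\<close> and \<open>x3 x4\<close> avoid it, and the pairs are
        \<open>y x1\<close>, \<open>x2 x3\<close>, \<open>x4 y\<close>. This uses all of five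
        vertices.\<close>
      obtain x1 where x1: "x1 \<in> K" "x1 \<noteq> y" using fresh[of "[y]"] by auto
      obtain x2 where x2: "x2 \<in> K" "x2 \<noteq> y" "x2 \<noteq> x1" using fresh[of "[y, x1]"] by auto
      obtain x3 where x3: "x3 \<in> K" "x3 \<noteq> y" "x3 \<noteq> x1" "x3 \<noteq> x2" using fresh[of "[y, x1, x2]"] by auto
      obtain x4 where x4: "x4 \<in> K" "x4 \<noteq> y" "x4 \<noteq> x1" "x4 \<noteq> x2" "x4 \<noteq> x3"
        using fresh[of "[y, x1, x2, x3]"] by auto
      note xs = x1 x2 x3 x4
      let ?E = "EZ - {(x1, x2), (x2, x1)} - {(x3, x4), (x4, x3)}"
      show ?thesis
      proof (rule extends_by_two_exchanges[OF Z Q, of x1 x2 x3 x4 ?E y y])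
        show "tri ?E"
          by (rule tri'[of _ "{(x1, x2), (x2, x1), (x3, x4), (x4, x3)}"
            "\<lambda>z. if z = x1 then x2 else if z = x2 then x1 else if z = x3 then x4 else x3"])
            (use xs in \<open>auto simp: sym_def\<close>)
        show "D z = deg EZ z + of_bool (z = y) + of_bool (z = y)" if "z \<in> Z" for z
          using D[OF that] zero[OF that, of "{y}"] y(1) True N2 by (cases "z = y") auto
      qed (use xs y K(3) in auto)
    next
      case False
      then have y1: "f y = 1" using rest[OF y(1)] N2 y(2) by linarith
      obtain y' where y': "y' \<in> K" "y' \<noteq> y" "f y' > 0" using pick[of "{y}"] y1 N2 by auto
      have "f y' \<le> (\<Sum>z\<in>K - {y}. f z)" using y' fin by (intro member_le_sum) auto
      then have y1': "f y' = 1" using rest[OF y(1)] N2 y1 y'(3) by linarith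
      \<comment> \<open>Here \<open>x2 y'\<close> and \<open>y x1\<close> are deleted, and the pairs
        are \<open>y x2\<close>, \<open>y' y\<close>, \<open>x1 y'\<close>.\<close>
      obtain x1 where x1: "x1 \<in> K" "x1 \<noteq> y" "x1 \<noteq> y'" using fresh[of "[y, y']"] by auto
      obtain x2 where x2: "x2 \<in> K" "x2 \<noteq> y" "x2 \<noteq> y'" "x2 \<noteq> x1" using fresh[of "[y, y', x1]"] by auto
      note xs = x1 x2 y(1) y'(1,2)
      let ?E = "EZ - {(x2, y'), (y', x2)} - {(y, x1), (x1, y)}"
      show ?thesis
      proof (rule extends_by_two_exchanges[OF Z Q, of x2 y' y x1 ?E y y'])
        show "tri ?E"
          by (rule tri'[of _ "{(x2, y'), (y', x2), (y, x1), (x1, y)}"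
            "\<lambda>z. if z = x2 then y' else if z = y' then x2 else if z = y then x1 else y"])
            (use xs in \<open>auto simp: sym_def\<close>)
        show "D z = deg EZ z + of_bool (z = y) + of_bool (z = y')" if "z \<in> Z" for z
          using D[OF that] zero[OF that, of "{y, y'}"] xs y1 y1' N2 by (cases "z \<in> {y, y'}") auto
      qed (use xs K(3) in auto)
    qed
  next
    assume N4: "?N = 4 \<and> (\<forall>z\<in>Z. f z \<le> 2)"
    obtain y1 where y1: "y1 \<in> K" "f y1 > 0" using pick[of "{}"] N4 by auto
    have le2: "f z \<le> 2" if "z \<in> K" for z using N4 K(1) that by auto
    obtain y2 where y2: "y2 \<in> K" "y2 \<noteq> y1" "f y2 > 0" using pick[of "{y1}"] le2[OF y1(1)] N4 by auto
    have le4: "(\<Sum>z\<in>Y. f z) \<le> 4" if "Y \<subseteq> K" for Y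
      using sum_mono2[OF fin that, of f] NK N4 by auto
    show ?thesis
    proof (cases "f y1 = 2 \<and> f y2 = 2")
      case True
      \<comment> \<open>After deleting \<open>x1 x2\<close> the pairs are \<open>y1 y2\<close>,
        \<open>y1 x1\<close>, \<open>y2 x2\<close>.\<close>
      obtain x1 where x1: "x1 \<in> K" "x1 \<noteq> y1" "x1 \<noteq> y2" using fresh[of "[y1, y2]"] by auto
      obtain x2 where x2: "x2 \<in> K" "x2 \<noteq> y1" "x2 \<noteq> y2" "x2 \<noteq> x1" using fresh[of "[y1, y2, x1]"] by auto
      note xs = x1 x2 y1(1) y2(1,2)
      let ?E = "EZ - {(x1, x2), (x2, x1)}"
      show ?thesis
      proof (rule extends_by_exchange[OF Z Q, of x1 x2 ?E y1 y2 y1 y2])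
        show "tri ?E"
          by (rule tri'[of _ "{(x1, x2), (x2, x1)}" "\<lambda>z. if z = x1 then x2 else x1"])
            (use xs in \<open>auto simp: sym_def\<close>)
        show "D z = deg EZ z + of_bool (z = y1) + of_bool (z = y2) + of_bool (z = y1) + of_bool (z = y2)"
          if "z \<in> Z" for z
          using D[OF that] zero[OF that, of "{y1, y2}"] xs True N4 by (cases "z \<in> {y1, y2}") auto
      qed (use xs K(3) in auto)
    next
      case F: False
      then have "f y1 + f y2 < 4" using le2[OF y1(1)] le2[OF y2(1)] by linarith
      then obtain y3 where y3: "y3 \<in> K" "y3 \<noteq> y1" "y3 \<noteq> y2" "f y3 > 0"
        using pick[of "{y1, y2}"] y2(2) N4 by auto
      have three: "f y1 + f y2 + f y3 \<le> 4"
        using le4[of "{y1, y2, y3}"] y1 y2 y3 by auto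
      \<comment> \<open>Three different vertices lack a degree; the fourth unit falls on
        \<open>w\<close>, one of the three again or a fourth vertex.\<close>
      have "\<exists>w. w \<in> K \<and> (\<forall>z\<in>K. f z = of_bool (z = y1) + of_bool (z = y2) + of_bool (z = y3) + of_bool (z = w))"
      proof (cases "f y1 + f y2 + f y3 = 4")
        case True
        have z0: "f z = 0" if "z \<in> K" "z \<notin> {y1, y2, y3}" for z
          by (rule zero[of z "{y1, y2, y3}"]) (use K(1) that True y1 y2 y3 N4 in auto)
        have "f y1 = 2 \<and> f y2 = 1 \<and> f y3 = 1 \<or> f y1 = 1 \<and> f y2 = 2 \<and> f y3 = 1 \<or> f y1 = 1 \<and> f y2 = 1 \<and> f y3 = 2"
          using True y1(2) y2(3) y3(4) by linarith
        then have "\<exists>w\<in>{y1, y2, y3}. \<forall>z\<in>{y1, y2, y3}. f z = 1 + of_bool (z = w)"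
          using y2 y3 by (elim disjE) auto
        then obtain w where w: "w \<in> {y1, y2, y3}" "\<forall>z\<in>{y1, y2, y3}. f z = 1 + of_bool (z = w)" by blast
        have "f z = of_bool (z = y1) + of_bool (z = y2) + of_bool (z = y3) + of_bool (z = w)" if "z \<in> K" for z
          using w z0[OF that] y2(2) y3(2,3) by (cases "z \<in> {y1, y2, y3}") auto
        moreover have "w \<in> K" using w(1) y1 y2 y3 by auto
        ultimately show ?thesis by blast
      next
        case False
        then have l: "f y1 + f y2 + f y3 < 4" using three by linarith
        then have o: "f y1 = 1" "f y2 = 1" "f y3 = 1" using y1(2) y2(3) y3(4) by linarith+
        obtain y4 where y4: "y4 \<in> K" "y4 \<notin> {y1, y2, y3}" "f y4 > 0"
          using pick[of "{y1, y2, y3}"] y2(2) y3(2,3) l N4 by auto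
        have "f y4 = 1" using le4[of "{y1, y2, y3, y4}"] y1 y2 y3 y4 o by auto
        have z0: "f z = 0" if "z \<in> K" "z \<notin> {y1, y2, y3, y4}" for z
          by (rule zero[of z "{y1, y2, y3, y4}"]) (use K(1) that o \<open>f y4 = 1\<close> y1 y2 y3 y4 N4 in auto)
        have "f z = of_bool (z = y1) + of_bool (z = y2) + of_bool (z = y3) + of_bool (z = y4)" if "z \<in> K" for z
          using z0[OF that] o \<open>f y4 = 1\<close> y4(2) y2(2) y3(2,3) by (cases "z \<in> {y1, y2, y3, y4}") auto
        then show ?thesis using y4(1) by blast
      qed
      then obtain w where w: "w \<in> K"
        "\<And>z. z \<in> K \<Longrightarrow> f z = of_bool (z = y1) + of_bool (z = y2) + of_bool (z = y3) + of_bool (z = w)" by blast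
      \<comment> \<open>Relabelling puts a possible repetition on \<open>a\<close>. Deleting an edge
        \<open>b x\<close> then leaves \<open>b c\<close>, \<open>a b\<close> and \<open>w x\<close>
        intact as pairs.\<close>
      have perm: "\<exists>a b c. {a, b, c} = {y1, y2, y3} \<and> a \<noteq> b \<and> a \<noteq> c \<and> b \<noteq> c \<and> w \<noteq> b \<and> w \<noteq> c"
      proof -
        consider "w = y2" | "w = y3" | "w \<noteq> y2" "w \<noteq> y3" by auto
        then show ?thesis
        proof cases
          case 1
          then show ?thesis using y2 y3 by (intro exI[of _ y2] exI[of _ y1] exI[of _ y3]) auto
        next
          case 2
          then show ?thesis using y2 y3 by (intro exI[of _ y3] exI[of _ y1] exI[of _ y2]) auto
        next
          case 3
          then show ?thesis using y2 y3 by (intro exI[of _ y1] exI[of _ y2] exI[of _ y3]) auto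
        qed
      qed
      then obtain a b c where abc: "{a, b, c} = {y1, y2, y3}" "a \<noteq> b" "a \<noteq> c" "b \<noteq> c" "w \<noteq> b" "w \<noteq> c"
        by blast
      have abcK: "a \<in> K" "b \<in> K" "c \<in> K" using abc(1) y1 y2 y3 by auto
      have fz: "f z = of_bool (z = a) + of_bool (z = b) + of_bool (z = c) + of_bool (z = w)" if "z \<in> K" for z
      proof -
        have "of_bool (z = y1) + of_bool (z = y2) + of_bool (z = y3) = (of_bool (z \<in> {y1, y2, y3}) :: nat)"
          using y2(2) y3(2,3) by auto
        moreover have "of_bool (z = a) + of_bool (z = b) + of_bool (z = c) = (of_bool (z \<in> {a, b, c}) :: nat)"
          using abc(2-4) by auto
        ultimately show ?thesis using w(2)[OF that] abc(1) by simp
      qed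
      obtain x where x: "x \<in> K" "x \<noteq> a" "x \<noteq> b" "x \<noteq> c" "x \<noteq> w" using fresh[of "[a, b, c, w]"] by auto
      let ?E = "EZ - {(b, x), (x, b)}"
      show ?thesis
      proof (rule extends_by_exchange[OF Z Q, of b x ?E b c a w])
        show "tri ?E"
          by (rule tri'[of _ "{(b, x), (x, b)}" "\<lambda>z. if z = b then x else b"])
            (use abcK x in \<open>auto simp: sym_def\<close>)
        show "D z = deg EZ z + of_bool (z = b) + of_bool (z = c) + of_bool (z = a) + of_bool (z = w)"
          if "z \<in> Z" for z
          using D[OF that] fz[of z] fK[of z] that abcK w(1) by (cases "z \<in> K") auto
      qed (use abc abcK x w(1) K(3) in auto)
    qed
  qed
qed

section \<open>Deficient complete graphs and joins\<close>

definition complete :: "'v set \<Rightarrow> ('v \<times> 'v) set" where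
  "complete S = S \<times> S - Id"

lemma gr_complete: "finite S \<Longrightarrow> gr S (complete S)"
  by (rule grI) (auto simp: complete_def)

lemma deg_complete:
  assumes "finite S" "v \<in> S"
  shows "deg (complete S) v = card S - 1"
proof -
  have "complete S `` {v} = S - {v}" using assms by (auto simp: complete_def)
  then show ?thesis using assms by (simp add: deg_def)
qed

lemma glue:
  assumes A: "gr A EA" and B: "gr B EB" and dis: "A \<inter> B = {}" and R: "R \<subseteq> A \<times> B"
  defines "E \<equiv> EA \<union> EB \<union> R \<union> R\<inverse>"
  shows "gr (A \<union> B) E"
    "x \<in> A \<Longrightarrow> deg E x = deg EA x + card (R `` {x})"
    "y \<in> B \<Longrightarrow> deg E y = deg EB y + card (R\<inverse> `` {y})"
proof -
  note a = grD[OF A] and b = grD[OF B]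
  show "gr (A \<union> B) E"
  proof (rule grI)
    show "(x, x) \<notin> E" for x using a(4) b(4) R dis unfolding E_def by blast
  qed (use a b R in \<open>auto simp: E_def\<close>)
  show "deg E x = deg EA x + card (R `` {x})" if "x \<in> A"
  proof -
    have "E `` {x} = EA `` {x} \<union> R `` {x}" using that dis R b by (auto simp: E_def)
    moreover have "EA `` {x} \<inter> R `` {x} = {}" using a(6) R dis by blast
    moreover have "finite (R `` {x})" by (rule finite_subset[OF _ b(1)]) (use R in auto)
    ultimately show ?thesis using gr_fin_Image[OF A] by (simp add: deg_def card_Un_disjoint)
  qed
  show "deg E y = deg EB y + card (R\<inverse> `` {y})" if "y \<in> B"
  proof -
    have "E `` {y} = EB `` {y} \<union> R\<inverse> `` {y}" using that dis R a by (auto simp: E_def)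
    moreover have "EB `` {y} \<inter> R\<inverse> `` {y} = {}" using b(6) R dis by blast
    moreover have "finite (R\<inverse> `` {y})" by (rule finite_subset[OF _ a(1)]) (use R in auto)
    ultimately show ?thesis using gr_fin_Image[OF B] by (simp add: deg_def card_Un_disjoint)
  qed
qed

text \<open>\<open>G\<close> is a clique of at least five vertices, and every vertex of \<open>H\<close> is joined to
  \<open>b\<close> vertices of it.\<close>

lemma extends_large_clique:
  assumes fin: "finite G" "finite H" "finite Q" and dis: "G \<inter> H = {}" "(G \<union> H) \<inter> Q = {}"
    and g: "5 \<le> card G" "b \<le> card G" "4 \<le> b" and Q: "card Q = Suc d" "4 \<le> d"
    and N: "N + card H * b = card G * \<kappa>" "0 < N" "even N" "N \<le> d * (d - 2)" "N \<le> card G * d"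
  shows "extends (G \<union> H) (\<lambda>z. if z \<in> G then card G - 1 + \<kappa> else b) Q d"
proof -
  let ?g = "card G" and ?k = "card H * b div card G" and ?r = "card H * b mod card G"
  have g0: "?g > 0" using g by linarith
  have Gne: "G \<noteq> {}" using g0 by auto
  obtain T where T: "T \<subseteq> G" "card T = ?r" "finite T"
    using obtain_subset[of ?r G] g0 by (metis less_imp_le mod_less_divisor)
  obtain R where R: "R \<subseteq> H \<times> G" "\<forall>y\<in>H. card (R `` {y}) = b"
    "\<forall>v\<in>G. card (R\<inverse> `` {v}) = ?k + of_bool (v \<in> T)"
    using balanced_relation[where f = "\<lambda>_. b", OF fin(2,1) Gne g(2) T(1)] T(2) by auto
  have R': "R\<inverse> \<subseteq> G \<times> H" using R(1) by auto
  define EZ where "EZ = complete G \<union> {} \<union> R\<inverse> \<union> (R\<inverse>)\<inverse>"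
  have gH: "gr H {}" using fin(2) by (auto simp: gr_def sym_def irrefl_def)
  note gl = glue[OF gr_complete[OF fin(1)] gH dis(1) R', folded EZ_def]
  have Z: "gr (G \<union> H) EZ" by (rule gl(1))
  have dG: "deg EZ z = ?g - 1 + (?k + of_bool (z \<in> T))" if "z \<in> G" for z
    using gl(2)[OF that] deg_complete[OF fin(1) that] R(3) that by simp
  have dH: "deg EZ z = b" if "z \<in> H" for z
    using gl(3)[OF that] R(2) that by (simp add: deg_def)
  have nH: "EZ `` {z} \<subseteq> G" if "z \<in> H" for z
    using that R(1) dis(1) by (auto simp: EZ_def complete_def)
  have cl: "(x, y) \<in> EZ" if "x \<in> G" "y \<in> G" "x \<noteq> y" for x y
    using that by (auto simp: EZ_def complete_def)
  have r: "?r < ?g" using g0 by simp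
  \<comment> \<open>Each vertex of \<open>G\<close> needs \<open>\<kappa>\<close> neighbours beyond
    the clique. \<open>H\<close> supplies \<open>?k\<close> or \<open>?k + 1\<close> of them, so
    \<open>m\<close> or \<open>m - 1\<close> are missing.\<close>
  define m where "m = \<kappa> - ?k"
  have hb: "card H * b = ?k * ?g + ?r" by simp
  have "?k * ?g < ?g * \<kappa>"
    using div_times_less_eq_dividend[of "card H * b" ?g] N(1,2) by linarith
  then have "?k * ?g < \<kappa> * ?g" by (simp only: mult.commute[of \<kappa>])
  then have k: "?k < \<kappa>" using mult_less_cancel2 by blast
  have Nm: "N + ?r = ?g * m"
  proof -
    have "?g * \<kappa> = ?g * m + ?g * ?k" using k by (simp add: m_def flip: distrib_left)
    moreover have "?g * ?k + ?r = card H * b" by simp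
    ultimately show ?thesis using N(1) by linarith
  qed
  define f where "f z = (if z \<in> G then \<kappa> - (?k + of_bool (z \<in> T)) else 0)" for z
  have fm: "f z = (if z \<in> G then m - of_bool (z \<in> T) else 0)" for z by (simp add: f_def m_def)
  have m1: "m \<ge> 1" using k by (simp add: m_def)
  have sum: "(\<Sum>z\<in>G \<union> H. f z) = N"
  proof -
    have "(\<Sum>z\<in>G \<union> H. f z) = (\<Sum>z\<in>G. f z)"
      by (rule sum.mono_neutral_right) (use fin in \<open>auto simp: f_def\<close>)
    moreover have "(\<Sum>z\<in>G. f z) + (\<Sum>z\<in>G. of_bool (z \<in> T)) = (\<Sum>z\<in>G. m)"
      unfolding sum.distrib[symmetric] by (rule sum.cong) (use m1 in \<open>auto simp: fm\<close>)
    moreover have "(\<Sum>z\<in>G. of_bool (z \<in> T)) = ?r"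
      using T fin(1) by (simp add: Int_absorb1)
    ultimately show ?thesis using Nm by simp
  qed
  have D: "(if z \<in> G then ?g - 1 + \<kappa> else b) = deg EZ z + f z" if "z \<in> G \<union> H" for z
    using that dG[of z] dH[of z] k dis(1) by (auto simp: f_def)
  have tri: "tri EZ"
    unfolding tri_def
  proof (intro allI impI)
    fix x y assume xy: "(x, y) \<in> EZ"
    have pend: "\<exists>w. (x, w) \<in> EZ \<and> (y, w) \<in> EZ" if "x \<in> H" "(x, y) \<in> EZ" for x y
    proof -
      have "card (EZ `` {x}) \<ge> 2" using dH[OF that(1)] g(3) by (simp add: deg_def)
      moreover have "card {y} = 1" by simp
      ultimately have "\<not> EZ `` {x} \<subseteq> {y}" using card_mono[of "{y}" "EZ `` {x}"] by fastforce
      then obtain w where "(x, w) \<in> EZ" "w \<noteq> y" by auto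
      then show ?thesis using cl[of y w] nH[OF that(1)] that(2) by auto
    qed
    show "\<exists>w. (x, w) \<in> EZ \<and> (y, w) \<in> EZ"
    proof (cases "x \<in> H \<or> y \<in> H")
      case True
      then show ?thesis using pend[of x y] pend[of y x] xy grD(3)[OF Z] by blast
    next
      case False
      then have G: "x \<in> G" "y \<in> G" using xy grD(5,6)[OF Z] by auto
      have "card {x, y} < card G" using g(1) card_length[of "[x, y]"] by simp
      then have "\<not> G \<subseteq> {x, y}" using card_mono[of "{x, y}" G] by fastforce
      then obtain w where "w \<in> G" "w \<noteq> x" "w \<noteq> y" by auto
      then show ?thesis using cl G by blast
    qed
  qed
  have disQ: "(G \<union> H) \<inter> Q = {}" by (rule dis(2))
  \<comment> \<open>All vertices of \<open>G\<close> lack at least \<open>m - 1\<close>, and some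
    vertex lacks \<open>m\<close>. With five vertices, no single one needs more than half of the
    links once \<open>N \<ge> 6\<close>.\<close>
  have Nge: "5 * (m - 1) + 1 \<le> N"
  proof -
    have "?g * (m - 1) + ?g = ?g * m" using m1 by (metis Suc_diff_1 add.commute less_le_trans mult_Suc_right zero_less_one)
    then have "?g * (m - 1) + 1 \<le> N" using Nm r by linarith
    moreover have "5 * (m - 1) \<le> ?g * (m - 1)" using g(1) by (rule mult_le_mono1)
    ultimately show ?thesis by linarith
  qed
  show ?thesis
  proof (cases "6 \<le> N")
    case True
    have md: "m \<le> d"
    proof (rule ccontr)
      assume "\<not> m \<le> d"
      then have "?g * (d + 1) \<le> ?g * m" by (intro mult_le_mono2) simp
      then show False using Nm N(5) r by simp
    qed
    show ?thesis
    proof (rule extends_by_multiple_links[OF Z fin(3) disQ Q])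
      show "(y, y') \<in> EZ" if "f y > 0" "f y' > 0" "y \<noteq> y'" for y y'
        using cl that by (auto simp: f_def split: if_splits)
      show "(\<exists>w. (x, w) \<in> EZ \<and> (y, w) \<in> EZ) \<or> {z \<in> G \<union> H. f z > 0} = {x, y}" if "(x, y) \<in> EZ" for x y
        using triD[OF tri that] by blast
      show "f z \<le> m" for z by (simp add: fm)
      show "2 * m \<le> N" using Nge True by linarith
    qed (use sum N True md D in auto)
  next
    case False
    then have N24: "N = 2 \<or> N = 4" using N(2,3) by presburger
    have "m \<le> 1" using Nge False by linarith
    then have f1: "f z \<le> 2" for z by (simp add: fm)
    show ?thesis
    proof (rule extends_clique_small[OF Z _ g(1) cl _ fin(3) disQ Q])
      show "4 \<le> card (EZ `` {z}) \<and> EZ `` {z} \<subseteq> G" if "z \<in> G \<union> H - G" for z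
        using that dH[of z] nH[of z] g(3) by (auto simp: deg_def)
      show "(\<Sum>z\<in>G \<union> H. f z) = 2 \<or> (\<Sum>z\<in>G \<union> H. f z) = 4 \<and> (\<forall>z\<in>G \<union> H. f z \<le> 2)"
        using N24 sum f1 by auto
    qed (use D in \<open>auto simp: f_def\<close>)
  qed
qed

text \<open>A complete graph on four vertices of degree 4 lacks only four degrees and is too small
  for \<open>extends_clique_small\<close>. Deleting a perfect matching leaves a 4-cycle with two
  missing degrees at each vertex. Four link vertices, each attached to both ends of one edge of the
  cycle, close these edges as well.\<close>

lemma extends_four_clique:
  assumes "finite Z" "card Z = 4" "finite Q" "Z \<inter> Q = {}" "card Q = Suc d" "4 \<le> d"
  shows "extends Z (\<lambda>_. 4) Q d"
proof -
  obtain xs where xs: "set xs = Z" "distinct xs" using finite_distinct_list[OF assms(1)] by auto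
  then have "length xs = 4" using assms(2) distinct_card by fastforce
  then obtain z1 z2 z3 z4 where "xs = [z1, z2, z3, z4]"
    by (auto simp: numeral_eq_Suc length_Suc_conv)
  then have Z: "Z = {z1, z2, z3, z4}" "distinct [z1, z2, z3, z4]" using xs by auto
  let ?E = "{(z1, z3), (z3, z1), (z3, z2), (z2, z3), (z2, z4), (z4, z2), (z4, z1), (z1, z4)}"
  obtain Q1 where Q1: "Q1 \<subseteq> Q" "card Q1 = 4" "finite Q1"
    using obtain_subset[of 4 Q] assms(5,6) by auto
  obtain ys where "set ys = Q1" "distinct ys" using finite_distinct_list[OF Q1(3)] by auto
  moreover then have "length ys = 4" using Q1(2) distinct_card by fastforce
  then obtain v1 v2 v3 v4 where "ys = [v1, v2, v3, v4]"
    by (auto simp: numeral_eq_Suc length_Suc_conv)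
  ultimately have v: "Q1 = {v1, v2, v3, v4}" "distinct [v1, v2, v3, v4]" by auto
  have grZ: "gr Z ?E" by (rule grI) (use Z in auto)
  obtain F where F: "gr Q1 F" "\<forall>v\<in>Q1. deg F v = 2"
    using near_regular_graph[of Q1 "{}" 2] Q1 by auto
  define R where "R = {(z1, v1), (z3, v1), (z3, v2), (z2, v2), (z2, v3), (z4, v3), (z4, v4), (z1, v4)}"
  have Rz: "R `` {z1} = {v1, v4}" "R `` {z2} = {v2, v3}" "R `` {z3} = {v1, v2}" "R `` {z4} = {v3, v4}"
    "R\<inverse> `` {v1} = {z1, z3}" "R\<inverse> `` {v2} = {z3, z2}" "R\<inverse> `` {v3} = {z2, z4}" "R\<inverse> `` {v4} = {z4, z1}"
    using Z(2) v(2) by (auto simp: R_def)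
  have Ez: "?E `` {z1} = {z3, z4}" "?E `` {z2} = {z3, z4}" "?E `` {z3} = {z1, z2}" "?E `` {z4} = {z1, z2}"
    using Z(2) by auto
  show ?thesis
  proof (rule extendsI[OF grZ assms(3,4) Q1(1) F(1), of R])
    show "R \<subseteq> Z \<times> Q1" using Z v by (auto simp: R_def)
    show "deg F u = card (R\<inverse> `` {u})" if "u \<in> Q1" for u
      using that F(2) v Z(2) Rz by auto
    show "(\<exists>w. (x, w) \<in> ?E \<and> (y, w) \<in> ?E) \<or> (\<exists>u. (x, u) \<in> R \<and> (y, u) \<in> R)" if "(x, y) \<in> ?E" for x y
      using that unfolding R_def by blast
    show "(\<exists>z'. (z, z') \<in> ?E \<and> (z', u) \<in> R) \<or> (\<exists>v'. (z, v') \<in> R \<and> v' \<noteq> u \<and> (u, v') \<notin> F)"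
      if "(z, u) \<in> R" for z u
      using that unfolding R_def by blast
    show "card (Q - Q1) \<ge> 2 \<or> (Q1 \<noteq> Q \<and> (\<forall>v\<in>Q1. deg F v + 2 \<le> card Q1))"
      using F(2) Q1 assms(5,6) by auto
    show "4 = deg ?E z + card (R `` {z})" if "z \<in> Z" for z
      using that Z v(2) Rz Ez by (auto simp: deg_def)
  qed (use v assms in auto)
qed

text \<open>The complete graph on \<open>G \<union> H\<close> with at most \<open>b + 1\<close> vertices, where the vertices of
  \<open>H\<close> are to be raised to degree \<open>b\<close> and those of \<open>G\<close> lack \<open>e\<close> neighbours each.\<close>

lemma extends_complete:
  assumes fin: "finite G" "finite H" "finite Q" and dis: "G \<inter> H = {}" "(G \<union> H) \<inter> Q = {}"
    and u: "card G + card H = u" "u \<le> b + 1" "4 \<le> b" and Q: "card Q = Suc d" "b \<le> d"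
    and h: "G = {} \<Longrightarrow> 0 < card H \<and> card H \<le> b" "card G = 1 \<Longrightarrow> 0 < card H" "2 \<le> card G \<Longrightarrow> 3 \<le> u"
    and e: "G \<noteq> {} \<Longrightarrow> b + 2 \<le> e + u" "e \<le> d"
    and N: "N = card G * e + card H * (b + 1 - u)" "even N" "N \<le> d * (d - 2)"
  shows "extends (G \<union> H) (\<lambda>z. if z \<in> G then u - 1 + e else b) Q d"
proof -
  let ?Z = "G \<union> H" and ?g = "card G" and ?h = "card H"
  let ?EZ = "complete ?Z"
  have finZ: "finite ?Z" using fin by simp
  have cZ: "card ?Z = u" using u(1) fin dis(1) by (simp add: card_Un_disjoint)
  have Z: "gr ?Z ?EZ" by (rule gr_complete[OF finZ])
  have d4: "4 \<le> d" using Q(2) u(3) by linarith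
  have cl: "(x, y) \<in> ?EZ" if "x \<in> ?Z" "y \<in> ?Z" "x \<noteq> y" for x y using that by (auto simp: complete_def)
  define f where "f z = (if z \<in> G then e else b + 1 - u)" for z
  have u0: "u > 0" using h u(1) fin(1) by (cases "G = {}") (auto simp: card_gt_0_iff)
  have D: "(if z \<in> G then u - 1 + e else b) = deg ?EZ z + f z" if "z \<in> ?Z" for z
    using that deg_complete[OF finZ that] cZ u u0 by (auto simp: f_def)
  have sum: "(\<Sum>z\<in>?Z. f z) = N"
  proof -
    have "(\<Sum>z\<in>?Z. f z) = (\<Sum>z\<in>G. f z) + (\<Sum>z\<in>H. f z)" using fin dis by (simp add: sum.union_disjoint)
    moreover have "(\<Sum>z\<in>G. f z) = ?g * e" by (simp add: f_def)
    moreover have "(\<Sum>z\<in>H. f z) = (\<Sum>z\<in>H. b + 1 - u)"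
      by (rule sum.cong) (use dis(1) in \<open>auto simp: f_def\<close>)
    ultimately show ?thesis using N(1) by simp
  qed
  have com: "\<exists>w. (x, w) \<in> ?EZ \<and> (y, w) \<in> ?EZ" if "(x, y) \<in> ?EZ" "3 \<le> u" for x y
  proof -
    have "card {x, y} < card ?Z" using that(2) cZ card_length[of "[x, y]"] by simp
    then have "\<not> ?Z \<subseteq> {x, y}" using card_mono[of "{x, y}" ?Z] by fastforce
    then obtain w where "w \<in> ?Z" "w \<noteq> x" "w \<noteq> y" by auto
    then show ?thesis using that(1) by (auto simp: complete_def)
  qed
  have gen: ?thesis if "6 \<le> N" "2 * m \<le> N" "m \<le> d" "\<And>z. z \<in> ?Z \<Longrightarrow> f z \<le> m"
    "u = 2 \<Longrightarrow> (\<forall>z\<in>?Z. f z > 0)" "2 \<le> u" for m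
  proof (rule extends_by_multiple_links[OF Z fin(3) dis(2) Q(1) d4])
    show "(\<exists>w. (x, w) \<in> ?EZ \<and> (y, w) \<in> ?EZ) \<or> {z \<in> ?Z. f z > 0} = {x, y}" if xy: "(x, y) \<in> ?EZ" for x y
    proof (cases "3 \<le> u")
      case False
      then have u2: "u = 2" using \<open>2 \<le> u\<close> by linarith
      have "{x, y} \<subseteq> ?Z" "x \<noteq> y" using xy by (auto simp: complete_def)
      then have "{x, y} = ?Z" using cZ u2 finZ by (intro card_subset_eq) auto
      then show ?thesis using \<open>u = 2 \<Longrightarrow> (\<forall>z\<in>?Z. f z > 0)\<close> u2 by auto
    qed (use com[OF xy] in blast)
  qed (use sum N that D cl in auto)
  have hub: ?thesis if y: "y \<in> ?Z" "f y = s" "0 < s" "s \<le> d" "N \<le> s * (s - 2)" "\<And>z. z \<in> ?Z \<Longrightarrow> f z \<le> s"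
    "u = 2 \<Longrightarrow> (\<forall>z\<in>?Z. f z > 0)" for y s
  proof (rule extends_by_hub[where f = f, OF Z fin(3) dis(2) Q(1) y(1,2,4,3)])
    show "(\<exists>v. (x, v) \<in> ?EZ \<and> (w, v) \<in> ?EZ) \<or> (y \<in> {x, w} \<and> f x > 0 \<and> f w > 0)"
      if xy: "(x, w) \<in> ?EZ" for x w
    proof (cases "3 \<le> u")
      case False
      have xw: "{x, w} \<subseteq> ?Z" "x \<noteq> w" using xy by (auto simp: complete_def)
      then have "2 \<le> u" using card_mono[OF finZ xw(1)] cZ by simp
      then have u2: "u = 2" using False by linarith
      then have "{x, w} = ?Z" using xw cZ finZ by (intro card_subset_eq) auto
      then show ?thesis using y(1,7) u2 by auto
    qed (use com[OF xy] in blast)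
  qed (use sum N y D cl in auto)
  have small: ?thesis if "u = b + 1" "N = 2 \<or> N = 4 \<and> (\<forall>z\<in>?Z. f z \<le> 2)"
  proof (rule extends_clique_small[OF Z _ _ cl _ fin(3) dis(2) Q(1) d4])
    show "5 \<le> card ?Z" using cZ that(1) u(3) by simp
    show "(\<Sum>z\<in>?Z. f z) = 2 \<or> (\<Sum>z\<in>?Z. f z) = 4 \<and> (\<forall>z\<in>?Z. f z \<le> 2)" using sum that(2) by simp
  qed (use D in auto)
  consider "?g = 0" | "?g = 1" | "2 \<le> ?g" by linarith
  then show ?thesis
  proof cases
    case 1
    then have G: "G = {}" using fin(1) by simp
    have uh: "u = ?h" "1 \<le> ?h" "?h \<le> b" using u(1) 1 h(1)[OF G] by auto
    obtain j where j: "b + 1 = u + j" "1 \<le> j" using uh by (metis Suc_eq_plus1 add_Suc_right le_add1 le_Suc_ex plus_1_eq_Suc)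
    have Nj: "N = u * j" using N(1) G j uh by simp
    have fj: "f z = j" for z using G j by (simp add: f_def)
    \<comment> \<open>Here \<open>u + j = b + 1\<close> and \<open>N = u * j\<close>. A single
      vertex is a hub, \<open>u = b = 4\<close> yields only four links, and in all other cases
      \<open>N\<close> is at least six, by parity if \<open>j = 1\<close>.\<close>
    consider "u = 1" | "u = 4" "b = 4" | "2 \<le> u" "\<not> (u = 4 \<and> b = 4)" using uh by linarith
    then show ?thesis
    proof cases
      case 1
      then have jb: "j = b" using j by simp
      obtain y where "y \<in> ?Z" using cZ 1 by (metis card_1_singletonE insertI1)
      moreover have "N \<le> j * (j - 2)"
      proof -
        have "j * 1 \<le> j * (j - 2)" by (rule mult_le_mono2) (use jb u(3) in linarith)
        then show ?thesis using Nj 1 by simp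
      qed
      ultimately show ?thesis using hub[of y j] fj jb u(3) Q(2) j 1 by auto
    next
      case 2
      have "extends ?Z (\<lambda>_. 4) Q d" using extends_four_clique[OF finZ _ fin(3) dis(2) Q(1) d4] cZ 2 by simp
      then show ?thesis using 2 G by simp
    next
      case 3
      have "6 \<le> N"
      proof (cases "j = 1")
        case True
        then have "N = b" "b \<noteq> 4" using Nj j 3 by auto
        then show ?thesis using u(3) N(2) by presburger
      next
        case False
        then have j2: "2 \<le> j" using j by linarith
        then obtain j' u' where ju: "j = j' + 2" "u = u' + 2" using 3(1) by (metis add.commute le_Suc_ex)
        have "1 \<le> j' + u'" using ju j u(3) by linarith
        then have "6 \<le> u' * j' + 2 * u' + 2 * j' + 4" by linarith
        then show ?thesis using Nj ju by (simp add: algebra_simps)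
      qed
      moreover have "2 * j \<le> N" using Nj 3(1) by simp
      moreover have "j \<le> d" using j 3(1) Q(2) by linarith
      ultimately show ?thesis using gen[of j] fj j(2) 3(1) by auto
    qed
  next
    case 2
    then obtain y where G: "G = {y}" by (metis card_1_singletonE)
    have uh: "u = ?h + 1" "1 \<le> ?h" "?h \<le> b" using u(1,2) 2 h(2) by auto
    obtain j where j: "b = ?h + j" using uh by (metis le_Suc_ex)
    have Nj: "N = e + ?h * j" using N(1) 2 uh j by simp
    have fj: "f z = (if z = y then e else j)" for z using G uh j by (simp add: f_def)
    have ej: "j + 1 \<le> e" using e(1) G uh j by auto
    show ?thesis
    proof (cases "j = 0")
      case True
      \<comment> \<open>Only \<open>y\<close> lacks neighbours. It is a hub if
        \<open>e \<ge> 4\<close>; otherwise parity leaves \<open>e = 2\<close>, and the graph is a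
        clique on \<open>b + 1 \<ge> 5\<close> vertices.\<close>
      then have Ne: "N = e" using Nj by simp
      show ?thesis
      proof (cases "4 \<le> e")
        case True
        then have "e * 1 \<le> e * (e - 2)" by (intro mult_le_mono2) linarith
        then show ?thesis using hub[of y e] True e(2) Ne fj ej G uh u(3) j \<open>j = 0\<close> by auto
      next
        case False
        then have "N = 2" using Ne N(2) ej by presburger
        then show ?thesis using small uh j True by auto
      qed
    next
      case False
      have prod: "?h + j \<le> ?h * j + 1"
      proof -
        obtain h' j' where "?h = h' + 1" "j = j' + 1" using uh(2) False
          by (metis Suc_eq_plus1 add.commute le_Suc_ex not0_implies_Suc plus_1_eq_Suc)
        then show ?thesis by (simp add: algebra_simps)
      qed
      then have p3: "3 \<le> ?h * j" using j u(3) by linarith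
      show ?thesis
      \<comment> \<open>If \<open>y\<close> needs more than half of the links, then
        \<open>N < 2 * e \<le> e * (e - 2)\<close>, which suits a hub.\<close>
      proof (cases "2 * e \<le> N")
        case True
        have "5 \<le> N" using Nj p3 ej False by linarith
        then have "6 \<le> N" using N(2) by presburger
        then show ?thesis using gen[of e] True e(2) fj ej uh False by auto
      next
        case F: False
        then have e4: "4 \<le> e" using Nj p3 by linarith
        then have "e * 2 \<le> e * (e - 2)" by (intro mult_le_mono2) linarith
        then have "N \<le> e * (e - 2)" using F by linarith
        then show ?thesis using hub[of y e] e(2) fj ej G e4 False by auto
      qed
    qed
  next
    case 3
    have Gne: "G \<noteq> {}" using 3 by auto
    have u3: "3 \<le> u" by (rule h(3)[OF 3])
    obtain j where j: "b + 1 = u + j" using u(2) by (metis le_Suc_ex)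
    have Nj: "N = ?g * e + ?h * j" using N(1) j by simp
    have ej: "j + 1 \<le> e" using e(1)[OF Gne] j by linarith
    have fe: "f z \<le> e" for z using ej j by (auto simp: f_def)
    have "2 * e \<le> ?g * e" using 3 by (rule mult_le_mono1)
    then have m2: "2 * e \<le> N" using Nj by linarith
    show ?thesis
    proof (cases "6 \<le> N")
      case True
      then show ?thesis using gen[of e] m2 e(2) fe u3 by auto
    next
      case False
      \<comment> \<open>For \<open>j > 0\<close> every vertex lacks a neighbour and those of
        \<open>G\<close> lack two, which adds up to six. So the graph is a clique on
        \<open>b + 1\<close> vertices, where exchanges apply.\<close>
      have "j = 0"
      proof (rule ccontr)
        assume j0: "j \<noteq> 0"
        have "?g * (j + 1) \<le> ?g * e" using ej by (rule mult_le_mono2)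
        then have "u * j + ?g \<le> N" using Nj u(1) by (auto simp: algebra_simps)
        moreover have "u + 2 \<le> u * j + ?g \<or> 6 \<le> u * j + ?g"
        proof (cases "j = 1")
          case False
          then have "3 * 2 \<le> u * j" using u3 j0 by (intro mult_le_mono) auto
          then show ?thesis by linarith
        qed (use 3 in simp)
        moreover have "j = 1 \<Longrightarrow> 4 \<le> u" using j u(3) by linarith
        moreover have "j \<noteq> 1 \<Longrightarrow> 6 \<le> u * j"
        proof -
          assume "j \<noteq> 1"
          then have "3 * 2 \<le> u * j" using u3 j0 by (intro mult_le_mono) auto
          then show "6 \<le> u * j" by simp
        qed
        ultimately show False using False 3 by (cases "j = 1") auto
      qed
      moreover have "N = 2 \<or> N = 4"
      proof -
        have "0 < N" using m2 ej by linarith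
        then show ?thesis using False N(2) by presburger
      qed
      moreover have "N = 4 \<Longrightarrow> f z \<le> 2" for z using m2 fe[of z] by linarith
      ultimately show ?thesis using small j by auto
    qed
  qed
qed

text \<open>\<open>G\<close> is a clique joined completely to \<open>H\<close>, and \<open>H\<close> carries a graph \<open>T\<close> that
  is regular of degree \<open>b - g\<close>, except that one vertex \<open>x0\<close> lacks one neighbour if parity
  forbids this.\<close>

lemma extends_join:
  assumes fin: "finite G" "finite H" "finite Q" and dis: "G \<inter> H = {}" "(G \<union> H) \<inter> Q = {}"
    and g: "card G = g" "1 \<le> g" "g \<le> b" and h: "card H = h" "b + 2 \<le> g + h" and b: "4 \<le> b"
    and Q: "card Q = Suc d" "4 \<le> d" and e: "1 \<le> e" "e \<le> d"
    and N: "N = g * e + h * (b - g) mod 2" "even N" "N \<le> d * (d - 2)"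
  shows "extends (G \<union> H) (\<lambda>z. if z \<in> G then g + h - 1 + e else b) Q d"
proof -
  define k where "k = h * (b - g) mod 2"
  have k01: "k = 0 \<or> k = 1" unfolding k_def by auto
  have h2: "2 \<le> h" using g(3) h(2) by linarith
  have "\<exists>T x0. x0 \<in> H \<and> gr H T \<and> (\<forall>x\<in>H. deg T x + of_bool (k = 1 \<and> x = x0) = b - g)"
  proof -
    have "H \<noteq> {}" using h2 h(1) by auto
    then obtain x0 where x0: "x0 \<in> H" by auto
    show ?thesis
    proof (cases "k = 0")
      case True
      then have "even (card H * (b - g) + card ({} :: 'a set))" using h(1) unfolding k_def by auto
      then have "\<exists>T. gr H T \<and> (\<forall>x\<in>H. deg T x = b - g + of_bool (x \<in> {}))"
        by (intro near_regular_graph) (use fin h g in auto)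
      then show ?thesis using x0 True by auto
    next
      case False
      then have "odd (h * (b - g))" using k01 unfolding k_def by presburger
      then have odd: "odd h" "odd (b - g)" unfolding even_mult_iff by blast+
      \<comment> \<open>With \<open>h\<close> and \<open>b - g\<close> odd, the base is
        \<open>b - g - 1\<close> and all of \<open>H\<close> except \<open>x0\<close> is
        raised.\<close>
      have c: "card (H - {x0}) = h - 1" using x0 fin(2) h(1) by simp
      have "even (b - g - 1)" "even (h - 1)" using odd by (auto elim!: oddE)
      then have "even (card H * (b - g - 1) + card (H - {x0}))" using c by auto
      then have "\<exists>T. gr H T \<and> (\<forall>x\<in>H. deg T x = b - g - 1 + of_bool (x \<in> H - {x0}))"
        by (intro near_regular_graph) (use fin h g h2 odd in auto)
      then obtain T where T: "gr H T" "\<forall>x\<in>H. deg T x = b - g - 1 + of_bool (x \<in> H - {x0})" by auto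
      have "b - g \<ge> 1" using odd(2) by (cases "b - g") auto
      then have "\<forall>x\<in>H. deg T x + of_bool (k = 1 \<and> x = x0) = b - g" using T(2) False k01 by auto
      then show ?thesis using x0 T(1) by blast
    qed
  qed
  then obtain T x0 where x0: "x0 \<in> H" and T: "gr H T"
    and dT: "\<And>x. x \<in> H \<Longrightarrow> deg T x + of_bool (k = 1 \<and> x = x0) = b - g" by blast
  note gT = grD[OF T]
  define EZ where "EZ = complete G \<union> T \<union> G \<times> H \<union> (G \<times> H)\<inverse>"
  note gl = glue[OF gr_complete[OF fin(1)] T dis(1) order_refl, folded EZ_def]
  have Z: "gr (G \<union> H) EZ" by (rule gl(1))
  note gZ = grD[OF Z]
  have GG: "(y, y') \<in> EZ" if "y \<in> G" "y' \<in> G" "y \<noteq> y'" for y y' using that by (auto simp: EZ_def complete_def)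
  have GH: "(y, x) \<in> EZ" "(x, y) \<in> EZ" if "y \<in> G" "x \<in> H" for x y using that by (auto simp: EZ_def)
  have TT: "(x, x') \<in> EZ" if "(x, x') \<in> T" for x x' using that by (auto simp: EZ_def)
  have HT: "(x, x') \<in> T" if "(x, x') \<in> EZ" "x \<in> H" "x' \<in> H" for x x'
    using that dis(1) by (auto simp: EZ_def complete_def)
  have nGH: "y \<noteq> x" if "y \<in> G" "x \<in> H" for x y using that dis(1) by auto
  have dG: "deg EZ y = g - 1 + h" if "y \<in> G" for y
  proof -
    have "(G \<times> H) `` {y} = H" using that by auto
    then show ?thesis using gl(2)[OF that] deg_complete[OF fin(1) that] g(1) h(1) by simp
  qed
  have dH: "deg EZ x + of_bool (k = 1 \<and> x = x0) = b" if "x \<in> H" for x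
  proof -
    have "(G \<times> H)\<inverse> `` {x} = G" using that by auto
    then show ?thesis using gl(3)[OF that] dT[OF that] g by simp
  qed
  define f where "f z = (if z \<in> G then e else of_bool (k = 1 \<and> z = x0))" for z
  have D: "(if z \<in> G then g + h - 1 + e else b) = deg EZ z + f z" if "z \<in> G \<union> H" for z
    using that dG[of z] dH[of z] g(2) by (auto simp: f_def)
  have sum: "(\<Sum>z\<in>G \<union> H. f z) = N"
  proof -
    have "(\<Sum>z\<in>H. f z) = (\<Sum>z\<in>H. if x0 = z then of_bool (k = 1) else 0)"
      by (rule sum.cong) (use dis(1) in \<open>auto simp: f_def\<close>)
    also have "\<dots> = k" using x0 fin(2) k01 by auto
    finally have "(\<Sum>z\<in>H. f z) = k" .
    moreover have "(\<Sum>z\<in>G. f z) = g * e" using g(1) by (simp add: f_def)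
    ultimately show ?thesis using fin dis(1) N(1) by (simp add: sum.union_disjoint k_def)
  qed
  have Nk: "N = g * e + k" using N(1) by (simp add: k_def)
  have triI: "tri E'" if sub: "E' \<subseteq> EZ" "\<And>x y. (x, y) \<in> E' \<Longrightarrow> (y, x) \<in> E'"
    and gg: "\<And>y y'. y \<in> G \<Longrightarrow> y' \<in> G \<Longrightarrow> \<exists>w. (y, w) \<in> E' \<and> (y', w) \<in> E'"
    and gh: "\<And>y x. y \<in> G \<Longrightarrow> x \<in> H \<Longrightarrow> (y, x) \<in> E' \<Longrightarrow> \<exists>w. (y, w) \<in> E' \<and> (x, w) \<in> E'"
    and hh: "\<And>x x'. x \<in> H \<Longrightarrow> x' \<in> H \<Longrightarrow> \<exists>w. (x, w) \<in> E' \<and> (x', w) \<in> E'" for E'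
    unfolding tri_def
  proof (intro allI impI)
    fix x y assume xy: "(x, y) \<in> E'"
    then have "x \<in> G \<union> H" "y \<in> G \<union> H" using sub(1) gZ(5,6) by blast+
    then show "\<exists>w. (x, w) \<in> E' \<and> (y, w) \<in> E'" using gg[of x y] gh[of x y] gh[of y x] hh[of x y] sub(2)[OF xy] xy by blast
  qed
  obtain y where y: "y \<in> G" using g by fastforce
  have G1: "G = {y}" if "g = 1" using that g(1) y by (metis card_1_singletonE singletonD)
  have other: "\<exists>y'\<in>G. y' \<noteq> y" if "2 \<le> g" for y
  proof -
    have "\<not> G \<subseteq> {y}" using card_mono[of "{y}" G] g(1) that by fastforce
    then show ?thesis by auto
  qed
  \<comment> \<open>\<open>M\<close> is a matching inside \<open>H\<close>, so all edges between
    \<open>G\<close> and \<open>H\<close> survive: \<open>x0\<close> serves any two vertices of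
    \<open>G\<close>, and \<open>y\<close> any two of \<open>H\<close>. A cross edge uses a second
    vertex of \<open>G\<close>. If there is none, its end in \<open>H\<close> has at least two
    neighbours in \<open>T\<close>, one of which is not its partner.\<close>
  have triM: "tri (EZ - M)" if M: "M \<subseteq> H \<times> H" "sym M" "\<And>x. M `` {x} \<subseteq> {m x}" for M m
  proof (rule triI)
    have nM: "(y, x) \<in> EZ - M" "(x, y) \<in> EZ - M" if "y \<in> G" "x \<in> H" for x y
      using GH[OF that] nGH[OF that] M(1) that dis(1) by auto
    show "(y, x) \<in> EZ - M" if "(x, y) \<in> EZ - M" for x y
      using that gZ(3) M(2) by (auto simp: sym_def)
    show "\<exists>w. (y, w) \<in> EZ - M \<and> (y', w) \<in> EZ - M" if "y \<in> G" "y' \<in> G" for y y'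
      using nM[OF that(1) x0] nM[OF that(2) x0] by blast
    show "\<exists>w. (x, w) \<in> EZ - M \<and> (x', w) \<in> EZ - M" if "x \<in> H" "x' \<in> H" for x x'
      using nM[OF y that(1)] nM[OF y that(2)] by blast
    show "\<exists>w. (y, w) \<in> EZ - M \<and> (x, w) \<in> EZ - M" if yx: "y \<in> G" "x \<in> H" for y x
    proof (cases "2 \<le> g")
      case True
      then obtain y' where y': "y' \<in> G" "y' \<noteq> y" using other by blast
      have "(y, y') \<in> EZ - M" using GG[of y y'] y' yx(1) M(1) dis(1) by blast
      then show ?thesis using nM(2)[OF y'(1) yx(2)] by blast
    next
      case False
      then have "g = 1" using g(2) by linarith
      then have "2 \<le> deg T x" using dT[OF yx(2)] b by (cases "k = 1 \<and> x = x0") auto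
      then have "\<not> T `` {x} \<subseteq> {m x}" using card_mono[of "{m x}" "T `` {x}"] by (auto simp: deg_def)
      then obtain w where w: "(x, w) \<in> T" "w \<noteq> m x" by auto
      then have "(x, w) \<in> EZ - M" using TT M(3)[of x] by auto
      then show ?thesis using nM(1)[OF yx(1), of w] gT(6)[OF w(1)] by blast
    qed
  qed auto
  have triZ: "tri EZ" using triM[of "{}"] by (auto simp: sym_def)
  have clique: "(z, z') \<in> EZ" if "f z > 0" "f z' > 0" "z \<noteq> z'" for z z'
    using that GG GH x0 by (auto simp: f_def split: if_splits)
  have edge: "\<exists>x1 x2. (x1, x2) \<in> T" if "2 \<le> b - g"
  proof -
    have "deg T x0 \<noteq> 0" using dT[OF x0] that by (cases "k = 1") auto
    then have "T `` {x0} \<noteq> {}" by (auto simp: deg_def)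
    then show ?thesis by blast
  qed
  show ?thesis
  proof (cases "g = 1")
    case True
    note Gy = G1[OF True]
    have Nek: "N = e + k" using Nk True by simp
    have b1: "3 \<le> b - g" using b True by simp
    have fy: "f y = e" using y by (simp add: f_def)
    \<comment> \<open>\<open>y\<close> lacks \<open>e\<close> and \<open>x0\<close> lacks
      \<open>k\<close>, with \<open>e + k\<close> even. Unless \<open>y\<close> can be a hub, only
      three cases with two or four links remain.\<close>
    consider "N \<le> e * (e - 2)" | "e = 3" "k = 1" | "e = 2" "k = 0" | "e = 1" "k = 1"
    proof -
      have "e \<ge> 5 \<Longrightarrow> N \<le> e * (e - 2)"
      proof -
        assume "5 \<le> e"
        then have "e * 3 \<le> e * (e - 2)" by (intro mult_le_mono2) linarith
        then show ?thesis using Nek k01 \<open>5 \<le> e\<close> by linarith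
      qed
      moreover have "e = 4 \<Longrightarrow> N \<le> e * (e - 2)" using Nek k01 by auto
      moreover have "e \<in> {1, 2, 3} \<or> e = 4 \<or> 5 \<le> e" using e(1) by auto
      ultimately show ?thesis using that Nek k01 N(2) by auto
    qed
    then show ?thesis
    proof cases
      case 1
      show ?thesis
      proof (rule extends_by_hub[where f = f, OF Z fin(3) dis(2) Q(1) _ fy e(2)])
        show "(\<exists>v. (x, v) \<in> EZ \<and> (w, v) \<in> EZ) \<or> y \<in> {x, w} \<and> f x > 0 \<and> f w > 0"
          if "(x, w) \<in> EZ" for x w using triD[OF triZ that] by blast
        show "f z \<le> e" for z using e(1) by (simp add: f_def)
        show "(z, y) \<in> EZ" if "z \<in> G \<union> H" "f z > 0" "z \<noteq> y" for z
          using clique[OF that(2) _ that(3)] fy e(1) by simp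
      qed (use y e 1 N(2) sum D in auto)
    next
      case 2
      \<comment> \<open>\<open>y\<close> lacks three and \<open>x0\<close> one: the pairs are
        \<open>y x0\<close>, \<open>y x1\<close>, \<open>y x2\<close>.\<close>
      obtain x1 x2 where x: "(x1, x2) \<in> T" using edge b1 by auto
      have xH: "x1 \<in> H" "x2 \<in> H" "x1 \<noteq> x2" using gT(4-6) x by auto
      let ?M = "{(x1, x2), (x2, x1)}"
      have nM: "(u, v) \<in> EZ - ?M" "(v, u) \<in> EZ - ?M" if "u \<in> G" "v \<in> H" for u v
        using GH[OF that] nGH[OF that(1)] xH that by auto
      show ?thesis
      proof (rule extends_by_exchange[OF Z fin(3) dis(2) Q TT[OF x], of "EZ - ?M" y x0 y y])
        show "tri (EZ - ?M)"
          by (rule triM[of _ "\<lambda>z. if z = x1 then x2 else x1"]) (use xH in \<open>auto simp: sym_def\<close>)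
        show "(if z \<in> G then g + h - 1 + e else b) =
          deg EZ z + of_bool (z = y) + of_bool (z = x0) + of_bool (z = y) + of_bool (z = y)"
          if "z \<in> G \<union> H" for z
          using D[OF that] Gy 2 nGH[OF y x0] by (auto simp: f_def)
        show "(y, x0) \<in> EZ - ?M" "(y, x1) \<in> EZ - ?M" "(y, x2) \<in> EZ - ?M"
          using nM(1)[OF y] x0 xH by blast+
      qed simp
    next
      case 3
      \<comment> \<open>In a path \<open>x1 x2 x3 x4\<close> of \<open>T\<close> the end edges are
        deleted and the middle edge becomes a pair, beside \<open>y x1\<close> and
        \<open>x4 y\<close>.\<close>
      have dT3: "3 \<le> deg T x" if "x \<in> H" for x using dT[OF that] b1 3 by simp
      obtain x2 x3 where x23: "(x2, x3) \<in> T" using edge b1 by auto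
      have H23: "x2 \<in> H" "x3 \<in> H" "x2 \<noteq> x3" using gT(4-6) x23 by auto
      have "\<not> T `` {x2} \<subseteq> {x3}" using card_mono[of "{x3}" "T `` {x2}"] dT3[OF H23(1)] by (auto simp: deg_def)
      then obtain x1 where x1: "(x2, x1) \<in> T" "x1 \<noteq> x3" by auto
      have "\<not> T `` {x3} \<subseteq> {x1, x2}"
        using card_mono[of "{x1, x2}" "T `` {x3}"] dT3[OF H23(2)] card_length[of "[x1, x2]"] by (auto simp: deg_def)
      then obtain x4 where x4: "(x3, x4) \<in> T" "x4 \<noteq> x1" "x4 \<noteq> x2" by auto
      have H14: "x1 \<in> H" "x4 \<in> H" "x1 \<noteq> x2" "x4 \<noteq> x3" using gT(4-6) x1 x4 by auto
      note ne = x1(2) x4(2,3) H14(3,4) H23(3)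
      let ?M = "{(x1, x2), (x2, x1), (x3, x4), (x4, x3)}"
      let ?E = "EZ - {(x1, x2), (x2, x1)} - {(x3, x4), (x4, x3)}"
      have nM: "(u, v) \<in> ?E" "(v, u) \<in> ?E" if "u \<in> G" "v \<in> H" for u v
        using GH[OF that] nGH[OF that(1)] H14 H23 that by auto
      show ?thesis
      proof (rule extends_by_two_exchanges[OF Z fin(3) dis(2) Q, of x1 x2 x3 x4 ?E y y])
        have "tri (EZ - ?M)"
          by (rule triM[of _ "\<lambda>z. if z = x1 then x2 else if z = x2 then x1 else if z = x3 then x4 else x3"])
            (use H14 H23 ne in \<open>auto simp: sym_def\<close>)
        moreover have "EZ - ?M = ?E" by auto
        ultimately show "tri ?E" by simp
        show "(x2, x3) \<in> ?E" using TT[OF x23] ne by auto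
        show "(x1, x2) \<in> EZ" "(x3, x4) \<in> EZ" using TT gT(3) x1 x4 by auto
        show "(if z \<in> G then g + h - 1 + e else b) = deg EZ z + of_bool (z = y) + of_bool (z = y)"
          if "z \<in> G \<union> H" for z
          using D[OF that] Gy 3 by (auto simp: f_def)
        show "{x1, x2} \<noteq> {x3, x4}" using ne by (simp add: doubleton_eq_iff)
        show "(y, x1) \<in> ?E" "(x4, y) \<in> ?E" using nM(1)[OF y H14(1)] nM(2)[OF y H14(2)] by blast+
      qed (rule refl)
    next
      case 4
      \<comment> \<open>The same pattern, with the path continuing from \<open>x4\<close> to
        \<open>x0\<close>, so that \<open>x4 x0\<close> is the last pair. It is built backwards from
        \<open>x0\<close>, and \<open>x1\<close> may be \<open>x0\<close> again.\<close>
      have dT3: "3 \<le> deg T x" if "x \<in> H" "x \<noteq> x0" for x using dT[OF that(1)] that(2) b1 by simp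
      have "2 \<le> deg T x0" using dT[OF x0] b1 by (cases "k = 1") auto
      then have "T `` {x0} \<noteq> {}" by (auto simp: deg_def)
      then obtain x4 where x4: "(x0, x4) \<in> T" by blast
      have H4: "x4 \<in> H" "x4 \<noteq> x0" using gT(4,6) x4 by auto
      have "\<not> T `` {x4} \<subseteq> {x0}" using card_mono[of "{x0}" "T `` {x4}"] dT3[OF H4] by (auto simp: deg_def)
      then obtain x3 where x3: "(x4, x3) \<in> T" "x3 \<noteq> x0" by auto
      have H3: "x3 \<in> H" "x3 \<noteq> x4" using gT(4,6) x3 by auto
      have "\<not> T `` {x3} \<subseteq> {x0, x4}"
        using card_mono[of "{x0, x4}" "T `` {x3}"] dT3[OF H3(1) x3(2)] card_length[of "[x0, x4]"] by (auto simp: deg_def)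
      then obtain x2 where x2: "(x3, x2) \<in> T" "x2 \<noteq> x0" "x2 \<noteq> x4" by auto
      have H2: "x2 \<in> H" "x2 \<noteq> x3" using gT(4,6) x2 by auto
      have "\<not> T `` {x2} \<subseteq> {x3, x4}"
        using card_mono[of "{x3, x4}" "T `` {x2}"] dT3[OF H2(1) x2(2)] card_length[of "[x3, x4]"] by (auto simp: deg_def)
      then obtain x1 where x1: "(x2, x1) \<in> T" "x1 \<noteq> x3" "x1 \<noteq> x4" by auto
      have H1: "x1 \<in> H" "x1 \<noteq> x2" using gT(4,6) x1 by auto
      note ne = H4(2) x3(2) H3(2) x2(2,3) H2(2) x1(2,3) H1(2)
      note Hs = H1(1) H2(1) H3(1) H4(1) x0
      let ?M = "{(x1, x2), (x2, x1), (x3, x4), (x4, x3)}"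
      let ?E = "EZ - {(x1, x2), (x2, x1)} - {(x3, x4), (x4, x3)}"
      have nM: "(u, v) \<in> ?E" "(v, u) \<in> ?E" if "u \<in> G" "v \<in> H" for u v
        using GH[OF that] nGH[OF that(1)] Hs that by auto
      show ?thesis
      proof (rule extends_by_two_exchanges[OF Z fin(3) dis(2) Q, of x1 x2 x3 x4 ?E y x0])
        have "tri (EZ - ?M)"
          by (rule triM[of _ "\<lambda>z. if z = x1 then x2 else if z = x2 then x1 else if z = x3 then x4 else x3"])
            (use Hs ne in \<open>auto simp: sym_def\<close>)
        moreover have "EZ - ?M = ?E" by auto
        ultimately show "tri ?E" by simp
        show "(x2, x3) \<in> ?E" using TT gT(3)[OF x2(1)] ne by auto
        show "(x4, x0) \<in> ?E" using TT gT(3)[OF x4] ne by auto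
        show "(x1, x2) \<in> EZ" "(x3, x4) \<in> EZ" using TT gT(3) x1 x3 by auto
        show "(if z \<in> G then g + h - 1 + e else b) = deg EZ z + of_bool (z = y) + of_bool (z = x0)"
          if "z \<in> G \<union> H" for z
          using D[OF that] Gy 4 nGH[OF y x0] by (auto simp: f_def)
        show "{x1, x2} \<noteq> {x3, x4}" using ne by (simp add: doubleton_eq_iff)
        show "(y, x1) \<in> ?E" using nM(1)[OF y H1(1)] by blast
      qed (rule refl)
    qed
  next
    case False
    then have g2: "2 \<le> g" using g(2) by linarith
    have "2 * e \<le> g * e" using g2 by (rule mult_le_mono1)
    then have m2: "2 * e \<le> N" using Nk by linarith
    show ?thesis
    proof (cases "6 \<le> N")
      case True
      show ?thesis
      proof (rule extends_by_multiple_links[where f = f, OF Z fin(3) dis(2) Q])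
        show "(\<exists>w. (x, w) \<in> EZ \<and> (y, w) \<in> EZ) \<or> {z \<in> G \<union> H. f z > 0} = {x, y}" if "(x, y) \<in> EZ" for x y
          using triD[OF triZ that] by blast
        show "f z \<le> e" for z using e(1) by (simp add: f_def)
      qed (use sum N True m2 e D clique in auto)
    next
      case F: False
      obtain y' where y': "y' \<in> G" "y' \<noteq> y" using other[OF g2] by auto
      have ge: "g \<le> g * e" using e(1) by simp
      consider "g = 2" "e = 2" "k = 0" | "g = 2" "e = 1" "k = 0" | "3 \<le> g" "e = 1" "g + k = 4"
      proof -
        have "N \<le> 5" using F by linarith
        then have N4: "N = 2 \<or> N = 4" using N(2) m2 e(1) by presburger
        then have "e \<le> 2" using m2 by linarith
        then have "e = 1 \<or> e = 2" using e(1) by linarith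
        then show ?thesis
        proof
          assume "e = 1"
          then have "g + k = 2 \<or> g + k = 4" using N4 Nk by simp
          then show ?thesis using that g2 k01 \<open>e = 1\<close> by auto
        next
          assume "e = 2"
          then have "g * 2 + k = 2 \<or> g * 2 + k = 4" using N4 Nk by simp
          then show ?thesis using that g2 \<open>e = 2\<close> by auto
        qed
      qed
      then show ?thesis
      proof cases
        case 1
        \<comment> \<open>\<open>y\<close> and \<open>y'\<close> lack two each: the pairs are
          \<open>y y'\<close>, \<open>y x1\<close>, \<open>y' x2\<close>.\<close>
        have Gyy: "G = {y, y'}" using y y' g(1) 1(1) fin(1) by (intro card_seteq[symmetric]) auto
        have "2 \<le> b - g" using b 1(1) by linarith
        then obtain x1 x2 where x: "(x1, x2) \<in> T" using edge by blast
        have xH: "x1 \<in> H" "x2 \<in> H" "x1 \<noteq> x2" using gT(4-6) x by auto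
        let ?M = "{(x1, x2), (x2, x1)}"
        have nM: "(u, v) \<in> EZ - ?M" "(v, u) \<in> EZ - ?M" if "u \<in> G" "v \<in> H" for u v
          using GH[OF that] nGH[OF that(1)] xH that by auto
        show ?thesis
        proof (rule extends_by_exchange[OF Z fin(3) dis(2) Q TT[OF x], of "EZ - ?M" y y' y y'])
          show "tri (EZ - ?M)"
            by (rule triM[of _ "\<lambda>z. if z = x1 then x2 else x1"]) (use xH in \<open>auto simp: sym_def\<close>)
          show "(y, y') \<in> EZ - ?M" using GG[OF y y'(1)] y'(2) nGH[OF y xH(1)] nGH[OF y xH(2)] by auto
          show "(if z \<in> G then g + h - 1 + e else b) =
            deg EZ z + of_bool (z = y) + of_bool (z = y') + of_bool (z = y) + of_bool (z = y')"
            if "z \<in> G \<union> H" for z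
            using D[OF that] Gyy 1 y'(2) by (auto simp: f_def)
          show "(y, x1) \<in> EZ - ?M" "(y', x2) \<in> EZ - ?M"
            using nM(1)[OF y xH(1)] nM(1)[OF y'(1) xH(2)] by blast+
        qed simp
      next
        case 2
        have Gyy: "G = {y, y'}" using y y' g(1) 2(1) fin(1) by (intro card_seteq[symmetric]) auto
        have "2 \<le> b - g" using b 2(1) by linarith
        then obtain x1 x2 where x: "(x1, x2) \<in> T" using edge by blast
        have xH: "x1 \<in> H" "x2 \<in> H" "x1 \<noteq> x2" using gT(4-6) x by auto
        have "3 \<le> h" using h(2) b 2(1) by linarith
        then have "\<not> H \<subseteq> {x1, x2}" using card_mono[of "{x1, x2}" H] h(1) card_length[of "[x1, x2]"] by fastforce
        then obtain x3 where x3: "x3 \<in> H" "x3 \<noteq> x1" "x3 \<noteq> x2" by auto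
        \<comment> \<open>\<open>y\<close> and \<open>y'\<close> lack one each. Deleting the cross
          edge \<open>y x3\<close> beside \<open>x1 x2\<close> gives the pairs \<open>y x1\<close>,
          \<open>x2 y\<close>, \<open>x3 y'\<close>. As \<open>triM\<close> only treats deletions
          inside \<open>H\<close>, the triangles are checked anew.\<close>
        define E' where "E' = EZ - {(x1, x2), (x2, x1)} - {(y, x3), (x3, y)}"
        have nG: "y \<noteq> x1" "y \<noteq> x2" "y \<noteq> x3" "y' \<noteq> x1" "y' \<noteq> x2" "y' \<noteq> x3"
          using nGH[OF y] nGH[OF y'(1)] xH x3 by auto
        have E1: "(y', v) \<in> E'" "(v, y') \<in> E'" if "v \<in> H" for v
          using GH[OF y'(1) that] nG y'(2) by (auto simp: E'_def)
        have E2: "(y, v) \<in> E'" "(v, y) \<in> E'" if "v \<in> H" "v \<noteq> x3" for v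
          using GH[OF y that(1)] nG that by (auto simp: E'_def)
        have E3: "(y, y') \<in> E'" "(y', y) \<in> E'" using GG[OF y y'(1)] GG[OF y'(1) y] y'(2) nG by (auto simp: E'_def)
        show ?thesis
        proof (rule extends_by_two_exchanges[OF Z fin(3) dis(2) Q, of x1 x2 y x3 E' y y'])
          show "tri E'"
          proof (rule triI)
            show "(v, u) \<in> E'" if "(u, v) \<in> E'" for u v using that gZ(3) by (auto simp: E'_def)
            show "\<exists>w. (u, w) \<in> E' \<and> (v, w) \<in> E'" if "u \<in> G" "v \<in> G" for u v
            proof -
              have "(w, x1) \<in> E'" if "w \<in> G" for w
                using that E1(1)[OF xH(1)] E2(1)[OF xH(1)] x3(2) unfolding Gyy by auto
              then show ?thesis using that by blast
            qed
            show "\<exists>w. (u, w) \<in> E' \<and> (v, w) \<in> E'" if "u \<in> H" "v \<in> H" for u v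
              using E1(2)[OF that(1)] E1(2)[OF that(2)] by blast
            show "\<exists>w. (u, w) \<in> E' \<and> (v, w) \<in> E'" if "u \<in> G" "v \<in> H" "(u, v) \<in> E'" for u v
            proof (cases "v = x3")
              case True
              have "deg T x3 \<noteq> 0" using dT[OF x3(1)] b 2 by simp
              then have "T `` {x3} \<noteq> {}" by (auto simp: deg_def)
              then obtain w where w: "(x3, w) \<in> T" by blast
              have wH: "w \<in> H" using gT(6)[OF w] .
              have "(x3, w) \<in> E'" using TT[OF w] x3 nGH[OF y wH] nG(3) by (auto simp: E'_def)
              moreover have "(y, x3) \<notin> E'" by (simp add: E'_def)
              then have "u = y'" using that True Gyy by auto
              ultimately show ?thesis using True E1(1)[OF wH] by blast
            next
              case F: False
              show ?thesis
              proof (cases "u = y")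
                case True
                then show ?thesis using E3(1) E1(2)[OF that(2)] by blast
              next
                case False
                then have "u = y'" using that(1) Gyy by auto
                then show ?thesis using E3(2) E2(2)[OF that(2) F] by blast
              qed
            qed
          qed (auto simp: E'_def)
          show "(x1, x2) \<in> EZ" "(y, x3) \<in> EZ" using TT[OF x] GH[OF y x3(1)] by auto
          show "(if z \<in> G then g + h - 1 + e else b) = deg EZ z + of_bool (z = y) + of_bool (z = y')"
            if "z \<in> G \<union> H" for z
            using D[OF that] Gyy 2 y'(2) by (auto simp: f_def)
          show "{x1, x2} \<noteq> {y, x3}" using nG x3 by (auto simp: doubleton_eq_iff)
          show "(y, x1) \<in> E'" "(x2, y) \<in> E'" "(x3, y') \<in> E'"
            using E2(1)[OF xH(1)] E2(2)[OF xH(2)] E1(2)[OF x3(1)] x3 by blast+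
        qed (rule E'_def)
      next
        case 3
        have "\<not> G \<subseteq> {y, y'}" using card_mono[of "{y, y'}" G] g(1) 3(1) card_length[of "[y, y']"] by fastforce
        then obtain y3 where y3: "y3 \<in> G" "y3 \<noteq> y" "y3 \<noteq> y'" by auto
        \<comment> \<open>Four vertices lack one neighbour each; the fourth is \<open>x0\<close> if
          \<open>k = 1\<close> and lies in \<open>G\<close> otherwise. Deleting a cross edge
          \<open>y x\<close> below gives the pairs \<open>y z\<close>, \<open>y3 y\<close>,
          \<open>y' x\<close>.\<close>
        have "\<exists>z\<in>G \<union> H. z \<notin> {y, y', y3} \<and> (\<forall>v\<in>G \<union> H. f v = of_bool (v = y) + of_bool (v = y') + of_bool (v = y3) + of_bool (v = z))"
        proof (cases "k = 1")
          case True
          then have "{y, y', y3} = G" using y y' y3 g(1) 3 fin(1) by (intro card_seteq) auto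
          then have "f v = of_bool (v = y) + of_bool (v = y') + of_bool (v = y3) + of_bool (v = x0)" for v
            using y'(2) y3(2,3) 3(2) True nGH[of _ x0] x0 by (auto simp: f_def)
          moreover have "x0 \<notin> {y, y', y3}" using nGH[of _ x0] x0 y y' y3 by auto
          ultimately show ?thesis using x0 by blast
        next
          case False
          then have g4: "g = 4" "k = 0" using 3 k01 by auto
          have "\<not> G \<subseteq> {y, y', y3}"
            using card_mono[of "{y, y', y3}" G] g(1) g4 card_length[of "[y, y', y3]"] by fastforce
          then obtain y4 where y4: "y4 \<in> G" "y4 \<notin> {y, y', y3}" by auto
          have "{y, y', y3, y4} = G" using y y' y3 y4 g(1) g4 fin(1) by (intro card_seteq) auto
          then have "f v = of_bool (v = y) + of_bool (v = y') + of_bool (v = y3) + of_bool (v = y4)" for v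
            using y'(2) y3(2,3) y4(2) 3(2) g4(2) by (auto simp: f_def)
          then show ?thesis using y4 by blast
        qed
        then obtain z where z: "z \<in> G \<union> H" "z \<notin> {y, y', y3}"
          "\<And>v. v \<in> G \<union> H \<Longrightarrow> f v = of_bool (v = y) + of_bool (v = y') + of_bool (v = y3) + of_bool (v = z)" by blast
        have nsing: "\<exists>x\<in>H. x \<noteq> c" for c
        proof -
          have "\<not> H \<subseteq> {c}" using card_mono[of "{c}" H] h(1) h2 by fastforce
          then show ?thesis by auto
        qed
        obtain x where x: "x \<in> H" "x \<noteq> z" using nsing by auto
        define E' where "E' = EZ - {(y, x), (x, y)}"
        have nyx: "y \<noteq> x" using nGH[OF y x(1)] .
        have E1: "(u, v) \<in> E'" "(v, u) \<in> E'" if "u \<in> G" "v \<in> H" "u \<noteq> y \<or> v \<noteq> x" for u v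
          using GH[OF that(1,2)] nGH[OF that(1,2)] nGH[OF that(1) x(1)] nGH[OF y that(2)] that(3) by (auto simp: E'_def)
        have E2: "(u, v) \<in> E'" if "u \<in> G" "v \<in> G" "u \<noteq> v" for u v
          using GG[OF that] nGH[OF that(1) x(1)] nGH[OF that(2) x(1)] by (auto simp: E'_def)
        show ?thesis
        proof (rule extends_by_exchange[OF Z fin(3) dis(2) Q, of y x E' y z y3 y'])
          show "tri E'"
          proof (rule triI)
            show "(v, u) \<in> E'" if "(u, v) \<in> E'" for u v using that gZ(3) by (auto simp: E'_def)
            show "\<exists>w. (u, w) \<in> E' \<and> (v, w) \<in> E'" if "u \<in> G" "v \<in> G" for u v
            proof -
              obtain x' where "x' \<in> H" "x' \<noteq> x" using nsing by auto
              then show ?thesis using E1(1)[OF that(1)] E1(1)[OF that(2)] by blast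
            qed
            show "\<exists>w. (u, w) \<in> E' \<and> (v, w) \<in> E'" if "u \<in> H" "v \<in> H" for u v
              using E1(2)[OF y'(1) that(1)] E1(2)[OF y'(1) that(2)] y'(2) by blast
            show "\<exists>w. (u, w) \<in> E' \<and> (v, w) \<in> E'" if "u \<in> G" "v \<in> H" "(u, v) \<in> E'" for u v
            proof -
              obtain w where w: "w \<in> G" "w \<noteq> u" "w \<noteq> y" using y'(1,2) y3 by metis
              then show ?thesis using E2[OF that(1) w(1)] E1(2)[OF w(1) that(2)] by blast
            qed
          qed (auto simp: E'_def)
          show "(y, x) \<in> EZ" using GH[OF y x(1)] by auto
          show "(y, z) \<in> E'"
            using z(1,2) E2[OF y, of z] E1(1)[OF y, of z] x(2) by blast
          show "(y3, y) \<in> E'" using E2[OF y3(1) y] y3(2) by blast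
          show "(y', x) \<in> E'" using E1(1)[OF y'(1) x(1)] y'(2) by blast
          show "(if v \<in> G then g + h - 1 + e else b) =
            deg EZ v + of_bool (v = y) + of_bool (v = z) + of_bool (v = y3) + of_bool (v = y')"
            if "v \<in> G \<union> H" for v
            using D[OF that] z(3)[OF that] by simp
        qed (rule E'_def)
      qed
    qed
  qed
qed

section \<open>Direct constructions\<close>

definition tri_real :: "nat \<Rightarrow> nat \<Rightarrow> 'v set \<Rightarrow> 'v set \<Rightarrow> bool" where
  "tri_real a b A B \<longleftrightarrow>
    (\<exists>E. gr (A \<union> B) E \<and> tri E \<and> (\<forall>v\<in>A. deg E v = a) \<and> (\<forall>v\<in>B. deg E v = b))"

lemma common_neighbour:
  assumes "finite U" "X \<subseteq> U" "Y \<subseteq> U" "card U < card X + card Y"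
  shows "\<exists>w. w \<in> X \<and> w \<in> Y"
proof (rule ccontr)
  assume "\<not> ?thesis"
  then have "X \<inter> Y = {}" by auto
  then have "card X + card Y = card (X \<union> Y)"
    using assms by (metis card_Un_disjoint finite_subset)
  also have "\<dots> \<le> card U" using assms by (intro card_mono) auto
  finally show False using assms by simp
qed

lemma common_neighbour_deg:
  assumes "gr V E" "card V < deg E u + deg E v"
  shows "\<exists>w. (u, w) \<in> E \<and> (v, w) \<in> E"
proof -
  note g = grD[OF assms(1)]
  have "\<exists>w. w \<in> E `` {u} \<and> w \<in> E `` {v}"
    by (rule common_neighbour[OF g(1)]) (use g(6) assms(2) in \<open>auto simp: deg_def\<close>)
  then show ?thesis by auto
qed

lemma common_neighbour_in:
  assumes "finite U" "card U < card (E `` {u} \<inter> U) + card (E `` {v} \<inter> U)"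
  shows "\<exists>w. (u, w) \<in> E \<and> (v, w) \<in> E"
proof -
  have "\<exists>w. w \<in> E `` {u} \<inter> U \<and> w \<in> E `` {v} \<inter> U"
    by (rule common_neighbour[OF assms(1)]) (use assms(2) in auto)
  then show ?thesis by auto
qed

lemma tri_real_union:
  assumes "tri_real a b A B" "tri_real a b A' B'" "(A \<union> B) \<inter> (A' \<union> B') = {}"
  shows "tri_real a b (A \<union> A') (B \<union> B')"
proof -
  obtain E E' where E: "gr (A \<union> B) E" "tri E" "\<forall>v\<in>A. deg E v = a" "\<forall>v\<in>B. deg E v = b"
    and E': "gr (A' \<union> B') E'" "tri E'" "\<forall>v\<in>A'. deg E' v = a" "\<forall>v\<in>B'. deg E' v = b"
    using assms(1,2) unfolding tri_real_def by blast
  have R: "{} \<subseteq> (A \<union> B) \<times> (A' \<union> B')" by simp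
  note gl = glue[OF E(1) E'(1) assms(3) R]
  have eq: "E \<union> E' \<union> {} \<union> {}\<inverse> = E \<union> E'" by auto
  have "tri (E \<union> E')" using E(2) E'(2) unfolding tri_def by blast
  moreover have "(A \<union> A') \<union> (B \<union> B') = (A \<union> B) \<union> (A' \<union> B')" by auto
  ultimately show ?thesis unfolding tri_real_def
    using gl E(3,4) E'(3,4) unfolding eq by (intro exI[of _ "E \<union> E'"]) auto
qed

section \<open>Balanced completions and pigeonhole triangles\<close>

text \<open>The \<open>f\<close> edges from each vertex of \<open>Y\<close> are spread evenly over
  \<open>S\<close>, so the degrees still missing in \<open>S\<close> differ by at most one and
  \<open>near_regular_graph\<close> supplies them. The bounds on \<open>s * t\<close> say that their
  sum lies between 0 and that of a complete graph on \<open>S\<close>. The rounded-down shares feed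
  pigeonhole arguments inside \<open>Y\<close> or \<open>S\<close>.\<close>

lemma balanced_completion:
  assumes Y: "gr Y EY" and S: "finite S" "S \<noteq> {}" "S \<inter> Y = {}" and c: "card S = s" "card Y = m"
    and f: "f \<le> s" "m * f \<le> s * t" "s * t \<le> m * f + s * (s - 1)" and ev: "even (s * t + m * f)"
  shows "\<exists>E. gr (S \<union> Y) E \<and>
    (\<forall>v\<in>S. deg E v = t \<and> m * f div s \<le> card (E `` {v} \<inter> Y) \<and>
      (s * t - m * f) div s \<le> card (E `` {v} \<inter> S)) \<and>
    (\<forall>y\<in>Y. deg E y = deg EY y + f \<and> E `` {y} \<inter> Y = EY `` {y})"
proof -
  note f = f[folded c] and ev = ev[folded c]
  let ?s = "card S" and ?N = "card Y * f"
  let ?k = "?N div ?s" and ?r = "?N mod ?s"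
  note gY = grD[OF Y]
  have s0: "?s > 0" using S by (simp add: card_gt_0_iff)
  obtain T where T: "T \<subseteq> S" "card T = ?r" "finite T"
    using obtain_subset[of ?r S] s0 by (metis less_imp_le mod_less_divisor)
  obtain R where R: "R \<subseteq> Y \<times> S" "\<forall>y\<in>Y. card (R `` {y}) = f"
    "\<forall>v\<in>S. card (R\<inverse> `` {v}) = ?k + of_bool (v \<in> T)"
    using balanced_relation[where f = "\<lambda>_. f", OF gY(1) S(1,2) f(1) T(1)] T(2) by auto
  have N: "?s * ?k + ?r = ?N" by simp
  have r: "?r < ?s" using s0 by simp
  have "\<exists>F. gr S F \<and> (\<forall>v\<in>S. deg F v + (?k + of_bool (v \<in> T)) = t \<and> (?s * t - ?N) div ?s \<le> deg F v)"
  proof (cases "T = {}")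
    case True
    then have r0: "?r = 0" using T by simp
    then have Ns: "?N = ?s * ?k" using N by simp
    have "?s * ?k \<le> ?s * t" using f(2) Ns by simp
    then have kt: "?k \<le> t" using s0 by (simp only: mult_le_cancel1)
    then obtain j where j: "t = ?k + j" using le_Suc_ex by blast
    have st: "?s * t = ?s * ?k + ?s * j" by (subst j) (simp add: distrib_left)
    have "?s * j \<le> ?s * (?s - 1)" using f(3) st Ns by linarith
    then have "j \<le> ?s - 1" using s0 by (simp only: mult_le_cancel1)
    moreover have "even (?s * j + card ({} :: 'a set))"
    proof -
      have "?s * t + ?N = ?s * j + 2 * ?N" using st Ns by linarith
      then show ?thesis using ev by (metis add.right_neutral card.empty dvd_add_left_iff dvd_triv_left)
    qed
    ultimately have "\<exists>F. gr S F \<and> (\<forall>v\<in>S. deg F v = j + of_bool (v \<in> {}))"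
      by (intro near_regular_graph) (use S s0 in auto)
    moreover have "(?s * t - ?N) div ?s = j" using st Ns s0 by simp
    ultimately show ?thesis using True j by auto
  next
    case False
    then have r0: "?r > 0" using T by (metis card_gt_0_iff)
    have "?s * ?k < ?s * t" using f(2) N r0 by linarith
    then have kt: "?k < t" by (simp only: mult_less_cancel1)
    then obtain j where j: "t = Suc ?k + j" using less_iff_Suc_add by auto
    have st: "?s * t = ?s * ?k + ?s + ?s * j" by (subst j) (simp add: distrib_left)
    have cST: "card (S - T) = ?s - ?r" using T by (simp add: card_Diff_subset)
    have sr: "?s - ?r + ?r = ?s" using r by simp
    have "?s * t = ?N + (?s * j + (?s - ?r))" using st N sr by linarith
    then have M: "?s * t - ?N = j * ?s + (?s - ?r)" by (simp add: mult.commute)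
    have "?s * j < ?s * (?s - 1)" using f(3) st N r by linarith
    then have js: "j < ?s - 1" by (simp only: mult_less_cancel1)
    moreover have "even (?s * j + card (S - T))"
    proof -
      have "?s * t + ?N = (?s * j + (?s - ?r)) + 2 * ?N" using st N sr by linarith
      then show ?thesis using ev cST by (metis dvd_add_left_iff dvd_triv_left)
    qed
    ultimately have "\<exists>F. gr S F \<and> (\<forall>v\<in>S. deg F v = j + of_bool (v \<in> S - T))"
      by (intro near_regular_graph) (use S in auto)
    moreover have "(?s * t - ?N) div ?s = j"
      using div_mod_eqI(1)[OF M] r0 r by linarith
    ultimately show ?thesis using j by fastforce
  qed
  then obtain F where F: "gr S F"
    "\<And>v. v \<in> S \<Longrightarrow> deg F v + (?k + of_bool (v \<in> T)) = t"
    "\<And>v. v \<in> S \<Longrightarrow> (?s * t - ?N) div ?s \<le> deg F v" by blast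
  note gF = grD[OF F(1)]
  have R': "R\<inverse> \<subseteq> S \<times> Y" using R(1) by auto
  define E where "E = F \<union> EY \<union> R\<inverse> \<union> (R\<inverse>)\<inverse>"
  note gl = glue[OF F(1) Y S(3) R', folded E_def]
  show ?thesis
    unfolding c[symmetric]
  proof (intro exI[of _ E] conjI ballI)
    show "gr (S \<union> Y) E" by (rule gl(1))
    show "deg E v = t" if "v \<in> S" for v using gl(2)[OF that] F(2)[OF that] R(3) that by simp
    show "?k \<le> card (E `` {v} \<inter> Y)" if "v \<in> S" for v
    proof -
      have "E `` {v} \<inter> Y = R\<inverse> `` {v}" using that S(3) gF gY R(1) by (auto simp: E_def)
      then show ?thesis using R(3) that by simp
    qed
    show "(?s * t - ?N) div ?s \<le> card (E `` {v} \<inter> S)" if "v \<in> S" for v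
    proof -
      have "E `` {v} \<inter> S = F `` {v}" using that S(3) gF gY R(1) by (auto simp: E_def)
      then show ?thesis using F(3)[OF that] by (simp add: deg_def)
    qed
    show "deg E y = deg EY y + f" if "y \<in> Y" for y using gl(3)[OF that] R(2) that by simp
    show "E `` {y} \<inter> Y = EY `` {y}" if "y \<in> Y" for y using that S(3) gF gY R(1) by (auto simp: E_def)
  qed
qed

lemma deg_empty [simp]: "deg {} v = 0"
  by (simp add: deg_def)

lemma gr_empty: "finite V \<Longrightarrow> gr V {}"
  by (auto simp: gr_def sym_def irrefl_def)

text \<open>Fewer than \<open>2 * b\<close> vertices: any realisation will do.\<close>

lemma tri_real_few_vertices:
  assumes fin: "finite A" "finite B" and dis: "A \<inter> B = {}" and p: "card A = p" "1 \<le> p" "p < b"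
    and q: "card B = q" "1 \<le> q" and ab: "b < a" and n: "a < p + q" "p + q < 2 * b"
    and ev: "even (p * a + q * b)"
  shows "tri_real a b A B"
proof -
  obtain c where c: "a + 1 = p + c" using p(3) ab by (metis le_Suc_ex less_SucI less_imp_le Suc_eq_plus1 order_less_trans)
  have cq: "c \<le> q" using c n(1) by linarith
  have pq: "p * c \<le> q * b" using mult_le_mono[of p b c q] p(3) cq by (simp add: mult.commute)
  have pa: "p * a = p * (p - 1) + p * c"
  proof -
    obtain p' where "p = Suc p'" using p(2) by (cases p) auto
    moreover then have "a = p' + c" using c by simp
    ultimately show ?thesis by (simp add: algebra_simps)
  qed
  have evp: "even (p * (p - 1))" by (cases p) auto
  have evq: "even (q * (q - 1))" by (cases q) auto
  have "\<exists>E. gr (A \<union> B) E \<and> (\<forall>v\<in>A. deg E v = a) \<and> (\<forall>v\<in>B. deg E v = b)"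
  \<comment> \<open>\<open>A\<close> is made a clique whose vertices send \<open>c\<close> edges
    each to \<open>B\<close>. If a complete graph on \<open>B\<close> could not absorb the rest,
    then \<open>q \<le> b\<close>, and \<open>B\<close> is made the clique instead.\<close>
  proof (cases "q * b \<le> p * c + q * (q - 1)")
    case True
    have e: "even (q * b + p * c)" using ev pa evp by simp
    have ne: "B \<noteq> {}" using q by auto
    have dis': "B \<inter> A = {}" using dis by auto
    obtain E where E: "gr (B \<union> A) E" "\<forall>v\<in>B. deg E v = b" "\<forall>y\<in>A. deg E y = deg (complete A) y + c"
      using balanced_completion[OF gr_complete[OF fin(1)] fin(2) ne dis' q(1) p(1) cq pq True e] by blast
    have "deg E y = a" if "y \<in> A" for y using E(3) that deg_complete[OF fin(1) that] p c by simp
    then show ?thesis using E by (intro exI[of _ E]) (auto simp: Un_commute)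
  next
    case False
    then have "q * (q - 1) < q * b" by linarith
    then have "q - 1 < b" by simp
    then have "q \<le> b + 1" by linarith
    then obtain f where f: "b + 1 = q + f" using le_Suc_ex by blast
    have qb: "q * b = q * (q - 1) + q * f"
    proof -
      obtain q' where "q = Suc q'" using q(2) by (cases q) auto
      moreover then have "b = q' + f" using f by simp
      ultimately show ?thesis by (simp add: algebra_simps)
    qed
    have fp: "f \<le> p" using f n(1) ab by linarith
    have e: "even (p * a + q * f)" using ev qb evq by simp
    have "q \<le> a" using f ab n fp by linarith
    then have l1: "q * f \<le> p * a" using fp mult_le_mono[of q a f p] by (simp add: mult.commute)
    have l2: "p * a \<le> q * f + p * (p - 1)" using False pa qb by linarith
    have ne: "A \<noteq> {}" using p by auto
    obtain E where E: "gr (A \<union> B) E" "\<forall>v\<in>A. deg E v = a" "\<forall>y\<in>B. deg E y = deg (complete B) y + f"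
      using balanced_completion[OF gr_complete[OF fin(2)] fin(1) ne dis p(1) q(1) fp l1 l2 e] by blast
    have "deg E y = b" if "y \<in> B" for y using E(3) that deg_complete[OF fin(2) that] q f by simp
    then show ?thesis using E by (intro exI[of _ E]) auto
  qed
  then obtain E where E: "gr (A \<union> B) E" "\<forall>v\<in>A. deg E v = a" "\<forall>v\<in>B. deg E v = b" by blast
  have "tri E" unfolding tri_def
  proof (intro allI impI)
    fix x y assume "(x, y) \<in> E"
    then have "x \<in> A \<union> B" "y \<in> A \<union> B" using grD(5,6)[OF E(1)] by blast+
    then have "b \<le> deg E x" "b \<le> deg E y" using E(2,3) ab by auto
    moreover have "card (A \<union> B) < 2 * b" using fin dis p q n(2) by (simp add: card_Un_disjoint)
    ultimately show "\<exists>w. (x, w) \<in> E \<and> (y, w) \<in> E" by (intro common_neighbour_deg[OF E(1)]) linarith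
  qed
  then show ?thesis unfolding tri_real_def using E by blast
qed

lemma independent_completion:
  assumes fin: "finite A" "finite B" and dis: "A \<inter> B = {}" and p: "card A = p" "b \<le> p" "1 \<le> b"
    and q: "card B = q" and le: "q * b \<le> p * a" "p * a \<le> q * b + p * (p - 1)" and ev: "even (p * a + q * b)"
  shows "\<exists>E. gr (A \<union> B) E \<and> (\<forall>v\<in>A. deg E v = a \<and> (p * a - q * b) div p \<le> card (E `` {v} \<inter> A)) \<and>
    (\<forall>v\<in>B. deg E v = b \<and> E `` {v} \<subseteq> A)"
proof -
  have ne: "A \<noteq> {}" using p by auto
  obtain E where E: "gr (A \<union> B) E"
    "\<forall>v\<in>A. deg E v = a \<and> (p * a - q * b) div p \<le> card (E `` {v} \<inter> A)"
    "\<forall>y\<in>B. deg E y = deg {} y + b \<and> E `` {y} \<inter> B = {} `` {y}"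
    using balanced_completion[OF gr_empty[OF fin(2)] fin(1) ne dis p(1) q(1) p(2) le ev] by blast
  have "E `` {y} \<subseteq> A" if "y \<in> B" for y
    using E(3) that grD(6)[OF E(1)] by blast
  moreover have "\<forall>y\<in>B. deg E y = b" using E(3) by simp
  ultimately show ?thesis using E(1,2) by blast
qed

text \<open>\<open>B\<close> is independent, and \<open>t\<close> bounds the degrees inside
  \<open>A\<close> from below. Both kinds of edges close by pigeonhole, either among all
  \<open>p + q\<close> vertices or inside \<open>A\<close>, where a vertex of \<open>B\<close> has
  all its \<open>b\<close> neighbours.\<close>

lemma tri_real_independent:
  assumes fin: "finite A" "finite B" and dis: "A \<inter> B = {}" and p: "card A = p" "b \<le> p" "1 \<le> b"
    and q: "card B = q" and le: "q * b \<le> p * a" "p * a \<le> q * b + p * (p - 1)" and ev: "even (p * a + q * b)"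
    and t: "p * t + q * b \<le> p * a"
    and AA: "p + q < 2 * a \<or> p < 2 * t" and AB: "p + q < a + b \<or> p < t + b"
  shows "tri_real a b A B"
proof -
  obtain E where E: "gr (A \<union> B) E" "\<forall>v\<in>A. deg E v = a \<and> (p * a - q * b) div p \<le> card (E `` {v} \<inter> A)"
    "\<forall>v\<in>B. deg E v = b \<and> E `` {v} \<subseteq> A"
    using independent_completion[OF fin dis p q le ev] by blast
  note g = grD[OF E(1)]
  have "p > 0" using p by linarith
  have "t \<le> (p * a - q * b) div p"
    using div_le_mono[of "p * t" "p * a - q * b" p] t \<open>p > 0\<close> by simp
  then have tA: "t \<le> card (E `` {v} \<inter> A)" if "v \<in> A" for v using E(2) that order_trans by blast
  have cV: "card (A \<union> B) = p + q" using fin dis p q by (simp add: card_Un_disjoint)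
  have mixed: "\<exists>w. (x, w) \<in> E \<and> (y, w) \<in> E" if "x \<in> A" "y \<in> B" for x y
    using AB
  proof
    assume "p + q < a + b"
    then show ?thesis using E(2,3) that cV by (intro common_neighbour_deg[OF E(1)]) simp
  next
    assume a: "p < t + b"
    have "E `` {y} \<inter> A = E `` {y}" using E(3) that by auto
    then have "card (E `` {y} \<inter> A) = b" using E(3) that by (simp add: deg_def)
    then show ?thesis using a tA[OF that(1)] p by (intro common_neighbour_in[OF fin(1)]) simp
  qed
  have "tri E" unfolding tri_def
  proof (intro allI impI)
    fix x y assume xy: "(x, y) \<in> E"
    then have V: "x \<in> A \<union> B" "y \<in> A \<union> B" using g(5,6) by blast+
    consider "x \<in> A" "y \<in> A" | "x \<in> A" "y \<in> B" | "x \<in> B" "y \<in> A"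
      using V xy E(3) dis by blast
    then show "\<exists>w. (x, w) \<in> E \<and> (y, w) \<in> E"
    proof cases
      case 1
      show ?thesis using AA
      proof
        assume "p + q < 2 * a"
        then show ?thesis using E(2) 1 cV by (intro common_neighbour_deg[OF E(1)]) simp
      next
        assume "p < 2 * t"
        then show ?thesis using tA[OF 1(1)] tA[OF 1(2)] p by (intro common_neighbour_in[OF fin(1)]) linarith
      qed
    next
      case 3
      then show ?thesis using mixed[of y x] by blast
    qed (use mixed in blast)
  qed
  then show ?thesis unfolding tri_real_def using E by blast
qed

text \<open>Pigeonhole among all vertices works as soon as \<open>p + q < a + b\<close>. Only
  \<open>p = a\<close>, \<open>q = b\<close> misses this, and there the degrees inside
  \<open>A\<close> decide.\<close>

lemma tri_real_small_both:
  assumes fin: "finite A" "finite B" and dis: "A \<inter> B = {}" and p: "card A = p" "b \<le> p" "p \<le> a"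
    and q: "card B = q" "q \<le> b" and ab: "b < a" "4 \<le> b"
    and le: "p * (a + 1 - p) \<le> q * b" and ev: "even (p * a + q * b)"
  shows "tri_real a b A B"
proof -
  have qa: "q * b \<le> p * a" using mult_le_mono[of q p b a] q p ab by linarith
  have pa: "p * a = p * (a + 1 - p) + p * (p - 1)"
  proof -
    obtain j where "a = p + j" using p(3) le_Suc_ex by blast
    moreover obtain p' where "p = Suc p'" using p(2) ab(2) by (cases p) auto
    ultimately show ?thesis by (simp add: algebra_simps)
  qed
  have b1: "1 \<le> b" using ab by linarith
  show ?thesis
  proof (cases "p = a \<and> q = b")
    case False
    then have "p + q < a + b" using p q by linarith
    then show ?thesis
      using tri_real_independent[OF fin dis p(1,2) b1 q(1) qa _ ev, of 0] pa le qa ab p q by simp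
  next
    case True
    obtain \<delta> where \<delta>: "a = b + \<delta>" "\<delta> \<ge> 1" using ab by (metis le_Suc_ex less_imp_le less_add_same_cancel1 less_eq_Suc_le One_nat_def)
    \<comment> \<open>For \<open>a = b + 1\<close> the sum \<open>a * a + b * b\<close> is odd. For
      \<open>\<delta> \<ge> 2\<close> and \<open>b \<ge> 4\<close> one has
      \<open>b + \<delta> \<le> b * \<delta>\<close>, which is what \<open>t\<close> amounts
      to.\<close>
    have "\<delta> \<noteq> 1" using ev True \<delta> by auto
    then obtain \<epsilon> where \<epsilon>: "\<delta> = \<epsilon> + 2" using \<delta>(2) by (metis add.commute le_Suc_ex le_neq_implies_less Suc_leI one_add_one plus_1_eq_Suc)
    obtain b' where b': "b = b' + 4" using ab(2) by (metis add.commute le_Suc_ex)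
    have t: "p * (a - b + 1) + q * b \<le> p * a"
      unfolding conjunct1[OF True] conjunct2[OF True] \<delta>(1) \<epsilon> b' by (simp add: algebra_simps)
    show ?thesis
      by (rule tri_real_independent[OF fin dis p(1,2) b1 q(1) qa _ ev t]) (use True pa le ab in auto)
  qed
qed

text \<open>\<open>B\<close> can be made independent if only few more edges would make \<open>A\<close> complete.\<close>

lemma tri_real_nearly_complete:
  assumes fin: "finite A" "finite B" and dis: "A \<inter> B = {}" and p: "card A = p" "b < p"
    and q: "card B = q" and b: "4 \<le> b" and c: "a + 1 = p + c"
    and D: "q * b = p * c + D" "D < 3 * b" "even D" and ev: "even (p * a + q * b)"
  shows "tri_real a b A B"
proof -
  obtain p' where p': "p = Suc p'" using p(2) by (cases p) auto
  have a: "a = p' + c" using c p' by simp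
  have pa: "p * a = p * p' + p * c" using a by (simp add: distrib_left)
  have Dp: "D \<le> p * (b - 2)"
  proof (cases "b = 4")
    case True
    then have "D \<le> 10" using D(2,3) by presburger
    moreover have "5 * 2 \<le> p * (b - 2)" using p(2) True by (intro mult_le_mono) auto
    ultimately show ?thesis by linarith
  next
    case False
    then have "b * 3 \<le> p * (b - 2)" using p(2) b by (intro mult_le_mono) auto
    then show ?thesis using D(2) by linarith
  qed
  have pp: "p * (b - 2) \<le> p * p'" using p(2) p' by (intro mult_le_mono2) linarith
  have le: "q * b \<le> p * a" "p * a \<le> q * b + p * (p - 1)" using D(1) pa Dp pp p' by simp_all
  have bp: "b \<le> p" "1 \<le> b" using p b by simp_all
  \<comment> \<open>\<open>D\<close> is the degree sum of what \<open>A\<close> lacks to be a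
    clique. It costs at most \<open>b - 2\<close> per vertex, which leaves \<open>p - b + 1\<close>,
    just enough to exceed \<open>p\<close> together with \<open>b\<close>.\<close>
  define t where "t = p - b + 1"
  have t: "p * t + q * b \<le> p * a"
  proof -
    have "t + (b - 2) = p'" using p(2) p' b by (simp add: t_def)
    then have "p * t + p * (b - 2) = p * p'" by (metis distrib_left)
    then show ?thesis using D(1) pa Dp by linarith
  qed
  have AB: "p < t + b" using p(2) by (simp add: t_def)
  show ?thesis
  proof (cases "p \<le> 2 * b")
    case True
    have "p + q < 2 * a"
    proof -
      obtain r where r: "2 * b = p + r" using True le_Suc_ex by blast
      have "2 \<le> p" using p(2) b by linarith
      then obtain p'' where p'': "p = p'' + 2" by (metis add.commute le_Suc_ex)
      have "b * 3 \<le> b * p''" using p(2) p'' b by (intro mult_le_mono2) linarith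
      moreover have "b * (p'' + 2 * c) = b * p'' + p * c + r * c"
      proof -
        have "b * (p'' + 2 * c) = b * p'' + (2 * b) * c" by (simp add: algebra_simps)
        then show ?thesis unfolding r by (simp add: algebra_simps)
      qed
      ultimately have "q * b < b * (p'' + 2 * c)" using D(1,2) by linarith
      then have "q < p'' + 2 * c" by (simp add: mult.commute)
      then show ?thesis using a p' p'' by simp
    qed
    then show ?thesis
      by (intro tri_real_independent[OF fin dis p(1) bp q le ev t]) (use AB in auto)
  next
    case False
    \<comment> \<open>Now \<open>D < 3 * b < 2 * p\<close>, so at most two per vertex are missing
      from the clique.\<close>
    define s where "s = p - 3"
    have s: "p * s + q * b \<le> p * a"
    proof -
      have "s + 2 = p'" using False b p' by (simp add: s_def)
      then have "p * s + p * 2 = p * p'" by (metis distrib_left)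
      moreover have "D \<le> p * 2" using D(2) False b by linarith
      ultimately show ?thesis using D(1) pa by linarith
    qed
    show ?thesis
      by (rule tri_real_independent[OF fin dis p(1) bp q le ev s]) (use False b in \<open>auto simp: s_def\<close>)
  qed
qed

lemma clique_completion:
  assumes fin: "finite A" "finite B" and dis: "A \<inter> B = {}" and p: "card A = p" "1 \<le> p" "p \<le> b"
    and q: "card B = q" "b < q" and c: "a + 1 = p + c" "c \<le> q" and ev: "even (p * a + q * b)"
  shows "\<exists>E. gr (A \<union> B) E \<and> (\<forall>v\<in>A. deg E v = a) \<and> complete A \<subseteq> E \<and>
    (\<forall>v\<in>B. deg E v = b \<and> p * c div q \<le> card (E `` {v} \<inter> A))"
proof -
  have ne: "B \<noteq> {}" using q by auto
  have l1: "p * c \<le> q * b" using mult_le_mono[of p b c q] p c by (simp add: mult.commute)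
  have "q * b \<le> q * (q - 1)" using q(2) by (intro mult_le_mono2) linarith
  then have l2: "q * b \<le> p * c + q * (q - 1)" by linarith
  have dis': "B \<inter> A = {}" using dis by auto
  have e: "even (q * b + p * c)"
  proof -
    obtain p' where p': "p = Suc p'" using p(2) by (cases p) auto
    then have "p * a = p * p' + p * c" using c(1) by (simp flip: distrib_left)
    moreover have "even (p * p')" using p' by simp
    ultimately show ?thesis using ev by simp
  qed
  obtain E where E: "gr (B \<union> A) E"
    "\<forall>v\<in>B. deg E v = b \<and> p * c div q \<le> card (E `` {v} \<inter> A)"
    "\<forall>y\<in>A. deg E y = deg (complete A) y + c \<and> E `` {y} \<inter> A = complete A `` {y}"
    using balanced_completion[OF gr_complete[OF fin(1)] fin(2) ne dis' q(1) p(1) c(2) l1 l2 e] by blast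
  have "deg E y = a" if "y \<in> A" for y using E(3) that deg_complete[OF fin(1) that] p c by simp
  moreover have "complete A \<subseteq> E"
  proof
    fix e assume e: "e \<in> complete A"
    obtain x y where xy: "e = (x, y)" by (cases e)
    then have "x \<in> A" "y \<in> complete A `` {x}" using e by (auto simp: complete_def)
    then show "e \<in> E" using E(3) xy by blast
  qed
  ultimately show ?thesis using E p q by (intro exI[of _ E]) (auto simp: Un_commute)
qed

text \<open>\<open>A\<close> is a clique, and each vertex of \<open>B\<close> is adjacent to at
  least \<open>w\<close> of its vertices, more than half. So two vertices of \<open>B\<close> meet
  inside \<open>A\<close>, and an edge between the classes closes at a second neighbour in
  \<open>A\<close>.\<close>

lemma tri_real_shared:
  assumes fin: "finite A" "finite B" and dis: "A \<inter> B = {}" and p: "card A = p" "3 \<le> p" "p \<le> b"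
    and q: "card B = q" "b < q" and c: "a + 1 = p + c" "c \<le> q" and ev: "even (p * a + q * b)"
    and w: "q * w \<le> p * c" "p < 2 * w"
  shows "tri_real a b A B"
proof -
  have p1: "1 \<le> p" using p by linarith
  obtain E where E: "gr (A \<union> B) E" "\<forall>v\<in>A. deg E v = a" "complete A \<subseteq> E"
    "\<forall>v\<in>B. deg E v = b \<and> p * c div q \<le> card (E `` {v} \<inter> A)"
    using clique_completion[OF fin dis p(1) p1 p(3) q c ev] by blast
  note g = grD[OF E(1)]
  have "w \<le> p * c div q" using div_le_mono[OF w(1), of q] q by simp
  then have wB: "w \<le> card (E `` {v} \<inter> A)" if "v \<in> B" for v using E(4) that order_trans by blast
  have cl: "(x, y) \<in> E" if "x \<in> A" "y \<in> A" "x \<noteq> y" for x y using that E(3) by (auto simp: complete_def)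
  have mixed: "\<exists>v. (x, v) \<in> E \<and> (y, v) \<in> E" if "x \<in> A" "y \<in> B" for x y
  proof -
    have "2 \<le> card (E `` {y} \<inter> A)" using wB[OF that(2)] w(2) p(2) by linarith
    then have "\<not> E `` {y} \<inter> A \<subseteq> {x}" using card_mono[of "{x}" "E `` {y} \<inter> A"] by fastforce
    then obtain v where "(y, v) \<in> E" "v \<in> A" "v \<noteq> x" by auto
    then show ?thesis using cl[OF that(1), of v] by auto
  qed
  have "tri E" unfolding tri_def
  proof (intro allI impI)
    fix x y assume xy: "(x, y) \<in> E"
    then have V: "x \<in> A \<union> B" "y \<in> A \<union> B" using g(5,6) by blast+
    then consider "x \<in> A" "y \<in> A" | "x \<in> A" "y \<in> B" | "x \<in> B" "y \<in> A" | "x \<in> B" "y \<in> B" by blast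
    then show "\<exists>v. (x, v) \<in> E \<and> (y, v) \<in> E"
    proof cases
      case 1
      have "card {x, y} < card A" using card_length[of "[x, y]"] p by simp
      then have "\<not> A \<subseteq> {x, y}" using card_mono[of "{x, y}" A] by fastforce
      then obtain v where "v \<in> A" "v \<noteq> x" "v \<noteq> y" by auto
      then show ?thesis using cl 1 by blast
    next
      case 3
      then show ?thesis using mixed[of y x] by blast
    next
      case 4
      then show ?thesis using wB[OF 4(1)] wB[OF 4(2)] w(2) p(1) by (intro common_neighbour_in[OF fin(1)]) linarith
    qed (use mixed in blast)
  qed
  then show ?thesis unfolding tri_real_def using E by blast
qed

text \<open>A vertex of degree \<open>p + q - 1\<close> closes every edge not containing it; the
  edges at it close because all degrees are at least two.\<close>

lemma tri_real_universal:
  assumes fin: "finite A" "finite B" and dis: "A \<inter> B = {}" and p: "card A = p" "1 \<le> p" "p \<le> b" "2 \<le> b" "b \<le> a"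
    and q: "card B = q" "b < q" and c: "a + 1 = p + q" and ev: "even (p * a + q * b)"
  shows "tri_real a b A B"
proof -
  obtain E where E: "gr (A \<union> B) E" "\<forall>v\<in>A. deg E v = a"
    "\<forall>v\<in>B. deg E v = b \<and> p * q div q \<le> card (E `` {v} \<inter> A)"
    using clique_completion[OF fin dis p(1-3) q c order_refl ev] by blast
  note g = grD[OF E(1)]
  obtain \<alpha> where \<alpha>: "\<alpha> \<in> A" using p by fastforce
  have cV: "card (A \<union> B) = p + q" using fin dis p q by (simp add: card_Un_disjoint)
  have "E `` {\<alpha>} = A \<union> B - {\<alpha>}"
  proof (rule card_subset_eq)
    show "E `` {\<alpha>} \<subseteq> A \<union> B - {\<alpha>}" using g(4,6) by auto
    have "card (A \<union> B - {\<alpha>}) = p + q - 1" using \<alpha> cV fin by simp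
    then show "card (E `` {\<alpha>}) = card (A \<union> B - {\<alpha>})" using E(2) \<alpha> c by (simp add: deg_def)
  qed (use fin in simp)
  then have univ: "(\<alpha>, v) \<in> E" if "v \<in> A \<union> B" "v \<noteq> \<alpha>" for v using that by auto
  have hub: "\<exists>w. (\<alpha>, w) \<in> E \<and> (y, w) \<in> E" if "(\<alpha>, y) \<in> E" for y
  proof -
    have "y \<in> A \<union> B" using g(6) that by blast
    then have "2 \<le> card (E `` {y})" using E(2,3) p by (auto simp: deg_def)
    then have "\<not> E `` {y} \<subseteq> {\<alpha>}" using card_mono[of "{\<alpha>}" "E `` {y}"] by fastforce
    then obtain w where "(y, w) \<in> E" "w \<noteq> \<alpha>" by auto
    then show ?thesis using univ[of w] g(6) by blast
  qed
  have "tri E" unfolding tri_def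
  proof (intro allI impI)
    fix x y assume xy: "(x, y) \<in> E"
    show "\<exists>w. (x, w) \<in> E \<and> (y, w) \<in> E"
    proof (cases "x = \<alpha> \<or> y = \<alpha>")
      case True
      then show ?thesis using hub[of x] hub[of y] xy g(3) by blast
    next
      case False
      then show ?thesis using univ[of x] univ[of y] xy g(3,5,6) by blast
    qed
  qed
  then show ?thesis unfolding tri_real_def using E by blast
qed

section \<open>Explicit small graphs\<close>

text \<open>\<open>nb ! i\<close> is the adjacency list of vertex \<open>i\<close>, with the
  vertices of degree \<open>a\<close> first. Quantifiers bounded by lists let evaluation decide the
  condition.\<close>

definition neighbour_table :: "nat \<Rightarrow> nat \<Rightarrow> nat \<Rightarrow> nat list list \<Rightarrow> bool" where
  "neighbour_table a b p nb \<longleftrightarrow>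
    list_all (\<lambda>i. distinct (nb ! i) \<and> length (nb ! i) = (if i < p then a else b) \<and>
      list_all (\<lambda>j. j < length nb \<and> j \<noteq> i \<and> i \<in> set (nb ! j) \<and> list_ex (\<lambda>k. k \<in> set (nb ! j)) (nb ! i))
        (nb ! i)) [0..<length nb]"

lemma tri_real_table:
  assumes fin: "finite A" "finite B" and dis: "A \<inter> B = {}" and c: "card A = p" "p + card B = length nb"
    and nb: "neighbour_table a b p nb"
  shows "tri_real a b A B"
proof -
  obtain xs where xs: "set xs = A" "distinct xs" using finite_distinct_list[OF fin(1)] by blast
  obtain ys where ys: "set ys = B" "distinct ys" using finite_distinct_list[OF fin(2)] by blast
  define vs where "vs = xs @ ys"
  define n where "n = length nb"
  have lx: "length xs = p" using xs c by (metis distinct_card)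
  have "length ys = card B" using ys by (metis distinct_card)
  then have lv: "length vs = n" using c(2) lx by (simp add: vs_def n_def)
  have dv: "distinct vs" using xs ys dis by (auto simp: vs_def)
  have sv: "set vs = A \<union> B" using xs ys by (simp add: vs_def)
  have inj: "vs ! i = vs ! j \<longleftrightarrow> i = j" if "i < n" "j < n" for i j
    using nth_eq_iff_index_eq[OF dv] that lv by simp
  have row: "distinct (nb ! i) \<and> length (nb ! i) = (if i < p then a else b) \<and>
      (\<forall>j\<in>set (nb ! i). j < n \<and> j \<noteq> i \<and> i \<in> set (nb ! j) \<and> (\<exists>k\<in>set (nb ! i). k \<in> set (nb ! j)))"
    if "i < n" for i
    using nb that unfolding neighbour_table_def list_all_iff list_ex_iff n_def
    by (elim bspec) simp
  note tab = row[THEN conjunct1] row[THEN conjunct2, THEN conjunct1]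
  have tab': "j < n \<and> j \<noteq> i \<and> i \<in> set (nb ! j)" "\<exists>k\<in>set (nb ! i). k \<in> set (nb ! j)"
    if "i < n" "j \<in> set (nb ! i)" for i j
    using row[OF that(1), THEN conjunct2, THEN conjunct2, THEN bspec, OF that(2)] by argo+
  define E where "E = {(vs ! i, vs ! j) | i j. i < n \<and> j \<in> set (nb ! i)}"
  have Ei: "E `` {vs ! i} = (\<lambda>j. vs ! j) ` set (nb ! i)" if "i < n" for i
    using that inj by (auto simp: E_def)
  have dE: "deg E (vs ! i) = (if i < p then a else b)" if "i < n" for i
  proof -
    have "inj_on (\<lambda>j. vs ! j) (set (nb ! i))"
      by (rule inj_onI) (use inj tab'(1)[OF that] in blast)
    then have "deg E (vs ! i) = card (set (nb ! i))"
      by (simp add: deg_def Ei[OF that] card_image)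
    then show ?thesis using tab[OF that] by (simp add: distinct_card)
  qed
  have g: "gr (A \<union> B) E"
  proof (rule grI)
    show "E \<subseteq> (A \<union> B) \<times> (A \<union> B)"
    proof clarify
      fix x y assume "(x, y) \<in> E"
      then obtain i j where ij: "x = vs ! i" "y = vs ! j" "i < n" "j \<in> set (nb ! i)" by (auto simp: E_def)
      then have "i < length vs" "j < length vs" using tab'(1)[OF ij(3,4)] lv by auto
      then show "x \<in> A \<union> B \<and> y \<in> A \<union> B" using nth_mem ij(1,2) sv by metis
    qed
    show "(y, x) \<in> E" if e: "(x, y) \<in> E" for x y
    proof -
      obtain i j where ij: "x = vs ! i" "y = vs ! j" "i < n" "j \<in> set (nb ! i)"
        using e by (auto simp: E_def)
      then show ?thesis using tab'(1)[OF ij(3,4)] unfolding E_def by blast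
    qed
    show "(x, x) \<notin> E" for x
    proof
      assume "(x, x) \<in> E"
      then obtain i j where ij: "x = vs ! i" "x = vs ! j" "i < n" "j \<in> set (nb ! i)"
        unfolding E_def by blast
      then show False using inj[of i j] tab'(1)[OF ij(3,4)] by simp
    qed
  qed (use fin in simp)
  have "tri E"
    unfolding tri_def
  proof clarify
    fix x y assume "(x, y) \<in> E"
    then obtain i j where ij: "x = vs ! i" "y = vs ! j" "i < n" "j \<in> set (nb ! i)" by (auto simp: E_def)
    then obtain k where "k \<in> set (nb ! i)" "k \<in> set (nb ! j)" using tab'(2)[OF ij(3,4)] by blast
    then show "\<exists>w. (x, w) \<in> E \<and> (y, w) \<in> E"
      using ij tab'(1)[OF ij(3,4)] unfolding E_def by blast
  qed
  moreover have "deg E v = a" if "v \<in> A" for v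
  proof -
    have "v \<in> set xs" using that xs by simp
    then obtain i where "i < p" "v = vs ! i" using lx by (auto simp: in_set_conv_nth vs_def nth_append)
    then show ?thesis using dE c(2) by (simp add: n_def)
  qed
  moreover have "deg E v = b" if "v \<in> B" for v
  proof -
    have "v \<in> set ys" using that ys by simp
    then obtain i where i: "i < length ys" "v = ys ! i" by (auto simp: in_set_conv_nth)
    then have "v = vs ! (p + i)" "p + i < n" using lx lv by (auto simp: vs_def nth_append)
    then show ?thesis using dE by simp
  qed
  ultimately show ?thesis unfolding tri_real_def using g by blast
qed

text \<open>The adjacency lists were found by a computer search.\<close>

lemma tri_real_sporadic:
  assumes fin: "finite A" "finite B" and dis: "A \<inter> B = {}"
    and c: "(a, b, card A, card B) \<in> {(6,4,4,5), (7,4,4,6), (8,4,4,7), (6,4,2,6), (7,4,2,7), (7,5,4,6)}"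
  shows "tri_real a b A B"
proof -
  note T = tri_real_table[OF fin dis refl]
  have t1: "neighbour_table 6 4 4 [[1,2,3,4,7,8],[0,2,3,4,5,8],[0,1,3,5,6,8],[0,1,2,6,7,8],[0,1,5,7],
    [1,2,4,6],[2,3,5,7],[0,3,4,6],[0,1,2,3]]" by code_simp
  have t2: "neighbour_table 7 4 4 [[1,2,3,4,7,8,9],[0,2,3,4,5,8,9],[0,1,3,5,6,8,9],[0,1,2,6,7,8,9],
    [0,1,5,7],[1,2,4,6],[2,3,5,7],[0,3,4,6],[0,1,2,3],[0,1,2,3]]" by code_simp
  have t3: "neighbour_table 8 4 4 [[1,2,3,4,7,8,9,10],[0,2,3,4,5,8,9,10],[0,1,3,5,6,8,9,10],
    [0,1,2,6,7,8,9,10],[0,1,5,7],[1,2,4,6],[2,3,5,7],[0,3,4,6],[0,1,2,3],[0,1,2,3],[0,1,2,3]]"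
    by code_simp
  have t4: "neighbour_table 6 4 2 [[1,3,4,5,6,7],[0,2,4,5,6,7],[1,4,5,6],[0,5,6,7],[0,1,2,7],[0,1,2,3],
    [0,1,2,3],[0,1,3,4]]" by code_simp
  have t5: "neighbour_table 7 4 2 [[1,3,4,5,6,7,8],[0,2,4,5,6,7,8],[1,4,5,6],[0,6,7,8],[0,1,2,7],
    [0,1,2,8],[0,1,2,3],[0,1,3,4],[0,1,3,5]]" by code_simp
  have t6: "neighbour_table 7 5 4 [[1,2,3,4,7,8,9],[0,2,3,4,5,8,9],[0,1,3,5,6,8,9],[0,1,2,6,7,8,9],
    [0,1,5,6,7],[1,2,4,6,7],[2,3,4,5,7],[0,3,4,5,6],[0,1,2,3,9],[0,1,2,3,8]]" by code_simp
  from c consider "a = 6" "b = 4" "card A = 4" "card B = 5" | "a = 7" "b = 4" "card A = 4" "card B = 6"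
    | "a = 8" "b = 4" "card A = 4" "card B = 7" | "a = 6" "b = 4" "card A = 2" "card B = 6"
    | "a = 7" "b = 4" "card A = 2" "card B = 7" | "a = 7" "b = 5" "card A = 4" "card B = 6"
    by auto
  then show ?thesis
  proof cases
    case 1 show ?thesis by (rule T) (use 1 t1 in auto)
  next
    case 2 show ?thesis by (rule T) (use 2 t2 in auto)
  next
    case 3 show ?thesis by (rule T) (use 3 t3 in auto)
  next
    case 4 show ?thesis by (rule T) (use 4 t4 in auto)
  next
    case 5 show ?thesis by (rule T) (use 5 t5 in auto)
  next
    case 6 show ?thesis by (rule T) (use 6 t6 in auto)
  qed
qed

section \<open>Splitting off cliques\<close>

text \<open>By the inequality of the means the product is at most a quarter of the square of
  \<open>d + 1\<close>, which is below \<open>d * (d - 2)\<close> from \<open>d = 4\<close> on. It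
  bounds the links of \<open>x\<close> vertices lacking \<open>y\<close> neighbours each.\<close>

lemma prod_bound:
  fixes x y d :: nat
  assumes "x + y = d + 1" "4 \<le> d"
  shows "x * y \<le> d * (d - 2)"
proof -
  have "int (4 * (x * y)) \<le> int ((x + y) * (x + y))"
    using zero_le_square[of "int x - int y"] by (simp add: algebra_simps)
  then have "4 * (x * y) \<le> (d + 1) * (d + 1)" using assms(1) by (metis of_nat_le_iff)
  also obtain k where k: "d = k + 4" using assms(2) le_Suc_ex by (metis add.commute)
  have "(d + 1) * (d + 1) \<le> 4 * (d * (d - 2))" by (simp add: k algebra_simps)
  finally show ?thesis by simp
qed

lemma tri_real_extends_left:
  assumes "extends (G \<union> H) D Q a" "\<And>z. z \<in> G \<Longrightarrow> D z = a" "\<And>z. z \<in> H \<Longrightarrow> D z = b"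
  shows "tri_real a b (G \<union> Q) H"
proof -
  have "G \<union> H \<union> Q = G \<union> Q \<union> H" by auto
  then show ?thesis using assms unfolding extends_def tri_real_def by (metis UnE UnI1 UnI2)
qed

lemma tri_real_extends_right:
  assumes "extends (G \<union> H) D Q b" "\<And>z. z \<in> G \<Longrightarrow> D z = a" "\<And>z. z \<in> H \<Longrightarrow> D z = b"
  shows "tri_real a b G (H \<union> Q)"
proof -
  have "G \<union> H \<union> Q = G \<union> (H \<union> Q)" by auto
  then show ?thesis using assms unfolding extends_def tri_real_def by (metis UnE UnI1 UnI2)
qed

lemma tri_real_swap: "tri_real a b A B \<longleftrightarrow> tri_real b a B A"
  unfolding tri_real_def by (auto simp: Un_commute)

lemma tri_real_complete:
  assumes "finite Q" "card Q = b + 1" "2 \<le> b"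
  shows "tri_real a b {} Q"
proof -
  have "tri (complete Q)"
    unfolding tri_def
  proof clarify
    fix x y assume "(x, y) \<in> complete Q"
    then have "x \<in> Q" "y \<in> Q" "x \<noteq> y" by (auto simp: complete_def)
    have "card {x, y} < card Q" using assms \<open>x \<noteq> y\<close> by simp
    then have "\<not> Q \<subseteq> {x, y}" using card_mono[of "{x, y}" Q] by auto
    then obtain w where "w \<in> Q" "w \<noteq> x" "w \<noteq> y" by blast
    then show "\<exists>w. (x, w) \<in> complete Q \<and> (y, w) \<in> complete Q"
      using \<open>x \<in> Q\<close> \<open>y \<in> Q\<close> by (auto simp: complete_def)
  qed
  then show ?thesis
    unfolding tri_real_def using gr_complete[OF assms(1)] deg_complete[OF assms(1)] assms(2)
    by (intro exI[of _ "complete Q"]) auto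
qed

text \<open>Cliques on \<open>d + 1\<close> vertices are removed. A remainder of at most
  \<open>d\<close> vertices is made complete; each of its vertices then lacks
  \<open>m = d + 1 - card H\<close>, and \<open>prod_bound\<close> limits the links.\<close>

lemma tri_real_regular:
  assumes "finite V" "d + 1 \<le> card V" "even (card V * d)" "4 \<le> d"
  shows "tri_real a d {} V"
  using assms
proof (induction "card V" arbitrary: V rule: less_induct)
  case less
  obtain Q where Q: "Q \<subseteq> V" "card Q = d + 1" "finite Q" using obtain_subset[OF less.prems(2)] by blast
  define H where "H = V - Q"
  have H: "finite H" "H \<inter> Q = {}" "H \<union> Q = V" using Q less.prems(1) by (auto simp: H_def)
  have cH: "card H + (d + 1) = card V" using Q less.prems(1,2) by (simp add: H_def card_Diff_subset)
  have ev: "even (card H * d)" using less.prems(3) unfolding cH[symmetric] by auto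
  show ?case
  proof (cases "d + 1 \<le> card H")
    case True
    have "tri_real a d {} H" by (rule less.hyps) (use True H cH ev less.prems(4) in auto)
    moreover have "tri_real a d {} Q" by (rule tri_real_complete) (use Q less.prems(4) in auto)
    ultimately have "tri_real a d ({} \<union> {}) (H \<union> Q)" by (rule tri_real_union) (use H in auto)
    then show ?thesis using H by simp
  next
    case False
    show ?thesis
    proof (cases "H = {}")
      case True
      then have "V = Q" using H by auto
      then show ?thesis using tri_real_complete Q less.prems(4) by force
    next
      case False': False
      then have h: "1 \<le> card H" "card H \<le> d" using False H by (auto simp: Suc_le_eq card_gt_0_iff)
      obtain m where m: "card H + m = d + 1" using h by (metis le_add_diff_inverse le_add1 order_trans)
      \<comment> \<open>\<open>G\<close> is empty, so \<open>0\<close> is a mere default for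
        \<open>e\<close>.\<close>
      have "extends ({} \<union> H) (\<lambda>z. if z \<in> {} then card H - 1 + 0 else d) Q d"
      proof (rule extends_complete)
        show "card H * m = card {} * 0 + card H * (d + 1 - card H)" using m by (metis add_diff_cancel_left' add.left_neutral mult_0_right)
        show "even (card H * m)" using m ev by (metis even_add even_mult_iff odd_one)
        show "card H * m \<le> d * (d - 2)" using prod_bound[OF m] less.prems(4) by simp
      qed (use H Q h less.prems in auto)
      then have "tri_real a d {} (H \<union> Q)" by (rule tri_real_extends_right) auto
      then show ?thesis using H by simp
    qed
  qed
qed

section \<open>Cliques whose removal leaves an infeasible remainder\<close>

text \<open>A clique of degree \<open>a\<close> always has room. With \<open>G\<close> a clique, its
  vertices lack \<open>k\<close> with \<open>g + k = a + 1\<close>; joined to all of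
  \<open>H\<close>, they lack \<open>e\<close> with \<open>g + h + e = a + 1\<close>. So
  \<open>prod_bound\<close> limits \<open>g * k\<close> or \<open>(g + h) * e\<close>, and these
  limit the links.\<close>

lemma tri_real_peel_left:
  assumes fin: "finite G" "finite H" "finite Q"
    and dis: "G \<inter> H = {}" "(G \<union> H) \<inter> Q = {}"
    and c: "card G = g" "card H = h" "card Q = a + 1"
    and ab: "4 \<le> b" "b < a" and h: "1 \<le> h" "h \<le> b" and ev: "even (g * a + h * b)"
    and infeasible: "g = 0 \<or> h * min g b < g * (a + 1 - g)"
  shows "tri_real a b (G \<union> Q) H"
proof (cases "g = 0")
  case True
  then have G: "G = {}" using c fin by simp
  obtain m where m: "h + m = b + 1" using h by (metis le_Suc_ex add.assoc)
  have m': "b + 1 - h = m" using m by linarith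
  have "extends (G \<union> H) (\<lambda>z. if z \<in> G then h - 1 + 0 else b) Q a"
  proof (rule extends_complete[where N = "h * m", OF fin dis])
    show "card G + card H = h" using c True by simp
    show "h * m = card G * 0 + card H * (b + 1 - h)" unfolding m' c by simp
    have "even m = (even h \<longleftrightarrow> odd b)" using m by (metis even_add odd_one)
    then show "even (h * m)" using ev True by auto
    have "h * m \<le> b * (b - 2)" using prod_bound[OF m] ab by simp
    also have "\<dots> \<le> a * (a - 2)" using ab by (intro mult_le_mono) auto
    finally show "h * m \<le> a * (a - 2)" .
  qed (use c True G ab h in auto)
  then show ?thesis by (rule tri_real_extends_left) (use G dis in auto)
next
  case False
  then have inf: "h * min g b < g * (a + 1 - g)" using infeasible by simp
  then have "a + 1 - g \<noteq> 0" by (metis mult_0_right not_less0)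
  then obtain k where k: "g + k = a + 1" "1 \<le> k"
    by (metis Suc_leI less_or_eq_imp_le neq0_conv ordered_cancel_comm_monoid_diff_class.add_diff_inverse zero_less_diff Suc_eq_plus1 add_0)
  have k': "a + 1 - g = k" using k by linarith
  have evk: "even k = (even g \<longleftrightarrow> odd a)" using k(1) by (metis even_add odd_one)
  have gk: "g * k \<le> a * (a - 2)" using prod_bound[OF k(1)] ab by simp
  have hGH: "z \<notin> G" if "z \<in> H" for z using dis(1) that by auto
  show ?thesis
  proof (cases "b + 1 \<le> g")
    case True
    have hb: "h * b < g * k" using inf True unfolding k' by (simp add: min_def)
    have N: "g * k - h * b + h * b = g * k" using hb by simp
    have "extends (G \<union> H) (\<lambda>z. if z \<in> G then card G - 1 + k else b) Q a"
    proof (rule extends_large_clique[where N = "g * k - h * b", OF fin dis])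
      show "g * k - h * b + card H * b = card G * k" using N c by simp
      show "even (g * k - h * b)" using ev evk hb by auto
      show "g * k - h * b \<le> a * (a - 2)" using gk by simp
      have "g * k \<le> g * a" using k False by (intro mult_le_mono) auto
      then show "g * k - h * b \<le> card G * a" unfolding c by linarith
    qed (use c True ab hb in auto)
    then show ?thesis by (rule tri_real_extends_left) (use hGH k c False in auto)
  next
    case g: False
    \<comment> \<open>For \<open>g \<le> b\<close> infeasibility reads \<open>h < k\<close>:
      adjacency to all of \<open>H\<close> still leaves \<open>e\<close> neighbours missing.\<close>
    then have "h * g < g * k" using inf unfolding k' by (simp add: min_def)
    then have "h < k" using False by (simp add: mult.commute)
    then obtain e where e: "k = h + e" "1 \<le> e" by (metis add_Suc_right less_natE Suc_eq_plus1 le_add2)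
    have ue: "(g + h) + e = a + 1" using k e by simp
    have ue': "(g + h) * e \<le> a * (a - 2)" using prod_bound[OF ue] ab by simp
    have eve: "even e = (even (g + h) \<longleftrightarrow> odd a)" using ue by (metis even_add odd_one)
    show ?thesis
    proof (cases "g + h \<le> b + 1")
      case True
      then obtain m where m: "g + h + m = b + 1" using le_Suc_ex by metis
      have m': "b + 1 - (g + h) = m" using m by linarith
      have me: "m \<le> e" using m ue ab by linarith
      have evm: "even m = (even (g + h) \<longleftrightarrow> odd b)" using m by (metis even_add odd_one)
      have "extends (G \<union> H) (\<lambda>z. if z \<in> G then (g + h) - 1 + e else b) Q a"
      proof (rule extends_complete[where N = "g * e + h * m", OF fin dis])
        show "g * e + h * m = card G * e + card H * (b + 1 - (g + h))" unfolding m' c by simp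
        show "even (g * e + h * m)" using ev eve evm by auto
        have "h * m \<le> h * e" using me by (rule mult_le_mono2)
        then show "g * e + h * m \<le> a * (a - 2)" using ue' unfolding distrib_right by linarith
      qed (use c True False ab h ue in auto)
      then show ?thesis by (rule tri_real_extends_left) (use hGH ue h in auto)
    next
      case u: False
      have evb: "even (b - g) = (even g \<longleftrightarrow> even b)" using g by (simp add: even_diff_nat) linarith
      have "extends (G \<union> H) (\<lambda>z. if z \<in> G then g + h - 1 + e else b) Q a"
      proof (rule extends_join[where N = "g * e + h * (b - g) mod 2", OF fin dis c(1) _ _ c(2)])
        have "even (g * e + h * (b - g))" using ev eve evb by auto
        then show "even (g * e + h * (b - g) mod 2)" by (simp add: even_add dvd_mod_iff)
        have "h * (b - g) mod 2 \<le> 1" by simp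
        also have "1 \<le> h * e" using h e by simp
        finally show "g * e + h * (b - g) mod 2 \<le> a * (a - 2)" using ue' unfolding distrib_right by linarith
      qed (use c u g False ab h e ue in auto)
      then show ?thesis by (rule tri_real_extends_left) (use hGH ue h in auto)
    qed
  qed
qed

text \<open>Here \<open>e\<close> is the number of links that each of the \<open>g\<close> vertices of large degree needs; only
  few parameters make the number \<open>N\<close> of links exceed what the clique can provide.\<close>

lemma excess_cases:
  fixes b g h e N :: nat
  assumes b: "4 \<le> b" and g: "1 \<le> g" "g \<le> b" and e: "1 \<le> e" "e \<le> b" and u: "b \<le> g + h + 1"
    and N: "N = (if g + h \<le> b + 1 then g * e + h * (b + 1 - (g + h)) else g * e + h * (b - g) mod 2)"
    and big: "b * (b - 2) < N"
  shows "e = b \<and> 3 \<le> g \<or> e + 1 = b \<and> b \<le> g + 1 \<or> b = 4 \<and> g = 2 \<and> e = 4 \<and> (h = 1 \<or> h = 2)"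
proof (rule ccontr)
  assume neg: "\<not> ?thesis"
  \<comment> \<open>The substitution removes the truncated subtraction in
    \<open>b * (b - 2)\<close>; \<open>neg\<close> then leaves three ranges for \<open>e\<close> and
    \<open>g\<close>.\<close>
  obtain k where k: "b = k + 4" using b le_Suc_ex by (metis add.commute)
  have big: "k * k + 6 * k + 8 < N" using big by (simp add: k algebra_simps)
  have m2: "h * (b - g) mod 2 \<le> 1" by simp
  consider "e \<le> k + 2" | "e = k + 3" "g \<le> k + 2" | "e = k + 4" "g \<le> 2"
    using neg e(2) unfolding k by linarith
  note ecase = this
  consider (1) "g + h + 1 = b" | (2) "g + h = b" | (3) "g + h = b + 1" | (4) "b + 2 \<le> g + h"
    using u by linarith
  then show False
  proof cases
    case 1
    then have "b + 1 - (g + h) = 2" "g + h \<le> b + 1" by linarith+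
    then have N: "N = g * e + h * 2" using N by simp
    obtain x where x: "g = x + 1" using g(1) by (metis add.commute le_Suc_ex)
    have h: "h + x = k + 2" using 1 x k by simp
    from ecase show False
    proof cases
      case 1
      have "g * e \<le> g * (k + 2)" using 1 by (rule mult_le_mono2)
      also have "\<dots> = x * k + 2 * x + k + 2" by (simp add: x algebra_simps)
      finally have "N \<le> x * k + k + 2 + 2 * (k + 2)" using N h by simp
      moreover have "x * k \<le> (k + 2) * k" using h by (intro mult_le_mono1) linarith
      ultimately show False using big by (simp add: algebra_simps)
    next
      case 2
      have "g * e = x * k + 3 * x + k + 3" by (simp add: x 2 algebra_simps)
      then have "N = x * k + x + k + 3 + 2 * (k + 2)" using N h by simp
      moreover have "x * k \<le> (k + 1) * k" using 2 x by (intro mult_le_mono1) linarith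
      ultimately show False using big 2 x by (simp add: algebra_simps)
    next
      case 3
      have "x = 0 \<or> x = 1" using 3 x by linarith
      then show False
      proof
        assume "x = 0" then show False using N big h 3 x by (simp add: algebra_simps)
      next
        assume x1: "x = 1"
        then have *: "N = 4 * k + 10" using N h 3 x by (simp add: algebra_simps)
        \<comment> \<open>The bound is exceeded only for \<open>b = 4\<close>, the listed exception
          with \<open>h = 1\<close>; the next position of \<open>g + h\<close> yields
          \<open>h = 2\<close> likewise.\<close>
        then have "k = 0" using big by (cases k) (auto simp: algebra_simps)
        then show False using neg 3 x x1 h k by simp
      qed
    qed
  next
    case 2
    then have "b + 1 - (g + h) = 1" "g + h \<le> b + 1" by linarith+
    then have N: "N = g * e + h" using N by simp
    obtain x where x: "g = x + 1" using g(1) by (metis add.commute le_Suc_ex)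
    have h: "h + x = k + 3" using 2 x k by simp
    from ecase show False
    proof cases
      case 1
      have "g * e \<le> g * (k + 2)" using 1 by (rule mult_le_mono2)
      also have "\<dots> = x * k + 2 * x + k + 2" by (simp add: x algebra_simps)
      finally have "N \<le> x * k + x + k + 2 + (k + 3)" using N h by simp
      moreover have "x * k \<le> (k + 3) * k" using h by (intro mult_le_mono1) linarith
      ultimately show False using big h by (simp add: algebra_simps)
    next
      case 2
      have "g * e = x * k + 3 * x + k + 3" by (simp add: x 2 algebra_simps)
      then have "N = x * k + 2 * x + k + 3 + (k + 3)" using N h by simp
      moreover have "x * k \<le> (k + 1) * k" using 2 x by (intro mult_le_mono1) linarith
      ultimately show False using big 2 x by (simp add: algebra_simps)
    next
      case 3
      have "x = 0 \<or> x = 1" using 3 x by linarith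
      then show False
      proof
        assume "x = 0" then show False using N big h 3 x by (simp add: algebra_simps)
      next
        assume x1: "x = 1"
        then have *: "N = 3 * k + 10" using N h 3 x by (simp add: algebra_simps)
        then have "k = 0" using big by (cases k) (auto simp: algebra_simps)
        then show False using neg 3 x x1 h k by simp
      qed
    qed
  next
    case 3
    then have N: "N = g * e" using N by simp
    from ecase show False
    proof cases
      case 1
      have "g * e \<le> (k + 4) * (k + 2)" using 1 g(2) unfolding k by (intro mult_le_mono)
      then show False using big N by (simp add: algebra_simps)
    next
      case 2
      have "g * e \<le> (k + 2) * (k + 3)" using 2 by (intro mult_le_mono) auto
      then show False using big N by (simp add: algebra_simps)
    next
      case 3
      have "g * e \<le> 2 * (k + 4)" using 3 by (intro mult_le_mono) auto
      then show False using big N by (simp add: algebra_simps)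
    qed
  next
    case 4
    then have N: "N = g * e + h * (b - g) mod 2" using N by simp
    from ecase show False
    proof cases
      case 1
      show False
      proof (cases "g = b")
        case True
        then have "N = g * e" using N by simp
        moreover have "g * e \<le> (k + 4) * (k + 2)" using 1 g(2) unfolding k by (intro mult_le_mono)
        ultimately show False using big by (simp add: algebra_simps)
      next
        case False
        have "g * e \<le> (k + 3) * (k + 2)" using 1 False g(2) unfolding k by (intro mult_le_mono) auto
        then show False using big N m2 by (simp add: algebra_simps)
      qed
    next
      case 2
      have "g * e \<le> (k + 2) * (k + 3)" using 2 by (intro mult_le_mono) auto
      then show False using big N m2 by (simp add: algebra_simps)
    next
      case 3
      have "g * e \<le> 2 * (k + 4)" using 3 by (intro mult_le_mono) auto
      then have "N \<le> 2 * k + 8 + h * (b - g) mod 2" using N by simp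
      moreover have "h * (b - g) mod 2 = 0" if "k = 0" "g = 2" using that k by simp
      moreover have "g * e = k + 4" if "g = 1" using that 3 by simp
      ultimately show False using big N m2 3 g(1) by (cases "g = 1"; cases k) (auto simp: algebra_simps)
    qed
  qed
qed

text \<open>The clique on \<open>b + 1\<close> vertices cannot be peeled off when it has too few edges to replace; these
  parameters admit a direct construction, except for six degree sequences.\<close>

lemma tri_real_excess:
  assumes fin: "finite A" "finite B" and dis: "A \<inter> B = {}"
    and c: "card A = g" "card B = h + (b + 1)"
    and b: "4 \<le> b" and g: "1 \<le> g" "g \<le> b" and e: "g + h + e = a + 1"
    and u: "b \<le> g + h + 1" and ev: "even (g * a + (h + (b + 1)) * b)"
    and ex: "e = b \<and> 3 \<le> g \<or> e + 1 = b \<and> b \<le> g + 1 \<or> b = 4 \<and> g = 2 \<and> e = 4 \<and> (h = 1 \<or> h = 2)"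
  shows "tri_real a b A B"
proof -
  note T = tri_real_shared[OF fin dis c(1) _ g(2) c(2)]
  note S = tri_real_sporadic[OF fin dis, unfolded c]
  from ex consider (1) "e = b" "3 \<le> g" | (2) "e + 1 = b" "b \<le> g + 1"
    | (3) "b = 4" "g = 2" "e = 4" "h = 1 \<or> h = 2" by blast
  then show ?thesis
  proof cases
    case 1
    show ?thesis
    proof (rule T[where w = "g - 1"])
      \<comment> \<open>A share of \<open>g - 1\<close> neighbours in \<open>A\<close> is available
        as soon as \<open>g - 1 \<le> h + e\<close>, and it is more than half of \<open>g\<close>
        from \<open>g = 3\<close> on.\<close>
      show "a + 1 = g + (h + e)" using e by simp
      obtain x where x: "g = x + 1" using g(1) by (metis add.commute le_Suc_ex)
      have "x \<le> h + e" using x g 1 by simp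
      then show "(h + (b + 1)) * (g - 1) \<le> g * (h + e)" by (simp add: x 1 algebra_simps)
    qed (use 1 ev in auto)
  next
    case 2
    have c': "a + 1 = g + (h + e)" using e by simp
    have he: "h + (b + 1) = h + e + 2" using 2 by simp
    have "5 \<le> g \<or> g = 4 \<or> g = 3" using 2 b by linarith
    moreover have "b = 4 \<or> b = 5" if "g = 4" using that 2 b by linarith
    moreover have "b = 4" if "g = 3" using that 2 b by linarith
    moreover have "8 \<le> h + (b + 1) \<or> h = 0 \<or> h = 1 \<or> b = 4 \<and> h = 2" if "b = 4 \<or> b = 5"
      using that by linarith
    moreover have "h = 0 \<or> 1 \<le> h" by linarith
    \<comment> \<open>The share \<open>g - 2\<close> is more than half from \<open>g = 5\<close> on.
      For \<open>g = 4\<close> and \<open>g = 3\<close> the shares must be 3 and 2, which requires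
      \<open>B\<close> to have at least 8 and 6 vertices. Below that, parity excludes
      \<open>s5\<close> and \<open>s6\<close>, and tables settle the rest.\<close>
    ultimately consider (big) "5 \<le> g" | (four) "g = 4" "8 \<le> h + (b + 1)"
      | (three) "g = 3" "b = 4" "1 \<le> h"
      | (s1) "g = 4" "b = 4" "h = 0" | (s2) "g = 4" "b = 4" "h = 1" | (s3) "g = 4" "b = 4" "h = 2"
      | (s4) "g = 4" "b = 5" "h = 0" | (s5) "g = 4" "b = 5" "h = 1" | (s6) "g = 3" "b = 4" "h = 0"
      by metis
    then show ?thesis
    proof cases
      case big
      show ?thesis
      proof (rule T[where w = "g - 2", OF _ _ c'])
        obtain x where x: "g = x + 2" using le_Suc_ex[of 2 g] big by auto
        have "x \<le> h + e" using x g 2 by simp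
        then show "(h + (b + 1)) * (g - 2) \<le> g * (h + e)" unfolding he by (simp add: x algebra_simps)
      qed (use big 2 ev in auto)
    next
      case four
      show ?thesis
      proof (rule T[where w = 3, OF _ _ c'])
        show "(h + (b + 1)) * 3 \<le> g * (h + e)" using four 2 by auto
      qed (use four 2 ev in auto)
    next
      case three
      show ?thesis
      proof (rule T[where w = 2, OF _ _ c'])
        show "(h + (b + 1)) * 2 \<le> g * (h + e)" using three 2 by auto
      qed (use three 2 ev in auto)
    next
      case s5
      then have "a = 8" using e 2 by simp
      then show ?thesis using ev s5 by simp
    next
      case s6
      then have "a = 5" using e 2 by simp
      then show ?thesis using ev s6 by simp
    qed (rule S; use e 2 in simp)+
  next
    case 3
    then show ?thesis using e by (intro S) auto
  qed
qed

text \<open>\<open>infeasible\<close> concerns \<open>H\<close> alone, \<open>feasible\<close> the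
  class \<open>H \<union> Q\<close>. The \<open>b + 1\<close> vertices of \<open>Q\<close> raise the
  capacity by \<open>(b + 1) * min g b\<close>. So at most \<open>(b + 1) * b\<close> links are
  needed if \<open>g > b\<close>, and at most \<open>b + 1\<close> per vertex of \<open>G\<close>
  otherwise, where \<open>b + 1\<close> itself is excluded by \<open>no_universal\<close>. The
  excess over \<open>b * (b - 2)\<close> is thus small enough for the direct constructions.\<close>

lemma tri_real_peel_right:
  assumes fin: "finite G" "finite H" "finite Q"
    and dis: "G \<inter> H = {}" "(G \<union> H) \<inter> Q = {}"
    and c: "card G = g" "card H = h" "card Q = b + 1"
    and ab: "4 \<le> b" "b < a" and g: "1 \<le> g" and ev: "even (g * a + h * b)"
    and feasible: "g * (a + 1 - g) \<le> (h + (b + 1)) * min g b"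
    and infeasible: "h * min g b < g * (a + 1 - g)"
    and many: "b \<le> g + h + 1" and no_universal: "g \<le> b \<Longrightarrow> a + 1 \<noteq> g + (h + (b + 1))"
  shows "tri_real a b G (H \<union> Q)"
proof -
  have "a + 1 - g \<noteq> 0" using infeasible by (metis mult_0_right not_less0)
  then obtain k where k: "g + k = a + 1" "1 \<le> k"
    by (metis Suc_leI less_or_eq_imp_le neq0_conv ordered_cancel_comm_monoid_diff_class.add_diff_inverse zero_less_diff Suc_eq_plus1 add_0)
  have k': "a + 1 - g = k" using k by linarith
  have evk: "even k = (even g \<longleftrightarrow> odd a)" using k(1) by (metis even_add odd_one)
  have hGH: "z \<notin> G" if "z \<in> H" for z using dis(1) that by auto
  have cB: "card (H \<union> Q) = h + (b + 1)" using fin dis c by (subst card_Un_disjoint) auto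
  have finB: "finite (H \<union> Q)" using fin by simp
  have disB: "G \<inter> (H \<union> Q) = {}" using dis by auto
  have evB: "even (g * a + (h + (b + 1)) * b)" using ev by auto
  show ?thesis
  proof (cases "b + 1 \<le> g")
    case True
    have hb: "h * b < g * k" using infeasible True unfolding k' by (simp add: min_def)
    define N where "N = g * k - h * b"
    have N: "N + h * b = g * k" "0 < N" using hb by (auto simp: N_def)
    have evN: "even N" using ev evk hb by (auto simp: N_def)
    have gkb: "g * k \<le> (h + (b + 1)) * b" using feasible True unfolding k' by (simp add: min_def)
    have Nb: "N \<le> (b + 1) * b" using gkb N(1) unfolding distrib_right by linarith
    show ?thesis
    proof (cases "N \<le> b * (b - 2)")
      case small: True
      have "extends (G \<union> H) (\<lambda>z. if z \<in> G then card G - 1 + k else b) Q b"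
      proof (rule extends_large_clique[where N = N, OF fin dis])
        show "N + card H * b = card G * k" using N c by simp
        have "b * (b - 2) \<le> b * g" using True by (intro mult_le_mono) auto
        then show "N \<le> card G * b" using small unfolding c mult.commute[of g] by (rule order_trans[rotated])
      qed (use c True ab N evN small in auto)
      then show ?thesis by (rule tri_real_extends_right) (use hGH k c g in auto)
    next
      case False
      have bb: "(b + 1) * b = b * (b - 2) + 3 * b"
      proof -
        obtain j where "b = j + 4" using ab le_Suc_ex by (metis add.commute)
        then show ?thesis by (simp add: algebra_simps)
      qed
      \<comment> \<open>The deficit is what \<open>N\<close> leaves of the capacity
        \<open>(b + 1) * b\<close>; it is below \<open>3 * b\<close> because \<open>N\<close>
        exceeds \<open>b * (b - 2)\<close>.\<close>
      show ?thesis
      proof (rule tri_real_nearly_complete[OF finite_subset[OF subset_refl fin(1)] finB disB c(1) _ cB])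
        show "(h + (b + 1)) * b = g * k + ((b + 1) * b - N)"
          using Nb N(1) unfolding distrib_right by linarith
        show "(b + 1) * b - N < 3 * b" using False bb ab(1) by linarith
        show "even ((b + 1) * b - N)" using evN Nb by auto
      qed (use True ab k evB in auto)
    qed
  next
    case False
    then have "g * h < g * k" "g * k \<le> g * (h + (b + 1))"
      using infeasible feasible unfolding k' by (simp_all add: mult.commute min_def)
    then have hk: "h < k" "k \<le> h + (b + 1)" using g by (simp_all only: mult_less_cancel1 mult_le_cancel1)
    then obtain e where e: "k = h + e" "1 \<le> e" by (metis add_Suc_right less_natE Suc_eq_plus1 le_add2)
    have "e \<noteq> b + 1" using no_universal False k(1) e by auto
    then have eb: "e \<le> b" using hk e by simp
    have ue: "(g + h) + e = a + 1" using k e by simp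
    have eve: "even e = (even (g + h) \<longleftrightarrow> odd a)" using ue by (metis even_add odd_one)
    define N where "N = (if g + h \<le> b + 1 then g * e + h * (b + 1 - (g + h)) else g * e + h * (b - g) mod 2)"
    show ?thesis
    proof (cases "N \<le> b * (b - 2)")
      case False': False
      have "e = b \<and> 3 \<le> g \<or> e + 1 = b \<and> b \<le> g + 1 \<or> b = 4 \<and> g = 2 \<and> e = 4 \<and> (h = 1 \<or> h = 2)"
        by (rule excess_cases[OF ab(1) g _ e(2) eb many N_def]) (use False False' in auto)
      then show ?thesis
        by (intro tri_real_excess[OF fin(1) finB disB c(1) cB ab(1) g _ ue many evB]) (use False in auto)
    next
      case small: True
      show ?thesis
      proof (cases "g + h \<le> b + 1")
        case True
        then obtain m where m: "g + h + m = b + 1" using le_Suc_ex by metis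
        have m': "b + 1 - (g + h) = m" using m by linarith
        have N: "N = g * e + h * m" using True m' by (simp add: N_def)
        have evm: "even m = (even (g + h) \<longleftrightarrow> odd b)" using m by (metis even_add odd_one)
        have "extends (G \<union> H) (\<lambda>z. if z \<in> G then (g + h) - 1 + e else b) Q b"
        proof (rule extends_complete[where N = N, OF fin dis])
          show "N = card G * e + card H * (b + 1 - (g + h))" unfolding m' c N by simp
          show "even N" unfolding N using ev eve evm by auto
        qed (use c True False ab g ue eb many small fin in auto)
        then show ?thesis by (rule tri_real_extends_right) (use hGH ue g in auto)
      next
        case u: False
        have N: "N = g * e + h * (b - g) mod 2" using u by (simp add: N_def)
        have evb: "even (b - g) = (even g \<longleftrightarrow> even b)" using False by (simp add: even_diff_nat) linarith
        have "extends (G \<union> H) (\<lambda>z. if z \<in> G then g + h - 1 + e else b) Q b"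
        proof (rule extends_join[where N = N, OF fin dis c(1) _ _ c(2)])
          have "even (g * e + h * (b - g))" using ev eve evb by auto
          then show "even N" unfolding N by (simp add: even_add dvd_mod_iff)
        qed (use c u False ab g e eb N small in auto)
        then show ?thesis by (rule tri_real_extends_right) (use hGH ue g in auto)
      qed
    qed
  qed
qed

text \<open>The last assumption counts the edges between \<open>A\<close> and \<open>B\<close>: every vertex of \<open>A\<close> sends at least
  \<open>a + 1 - card A\<close> edges to \<open>B\<close>, and every vertex of \<open>B\<close> sends at most \<open>min (card A) b\<close> to \<open>A\<close>.\<close>

theorem tri_real_exists:
  assumes "4 \<le> b" "b < a" "finite A" "finite B" "A \<inter> B = {}" "1 \<le> card B"
    and "even (card A * a + card B * b)" "card A = 0 \<Longrightarrow> b + 1 \<le> card B"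
    and "card A * (a + 1 - card A) \<le> card B * min (card A) b"
  shows "tri_real a b A B"
  using assms
proof (induction "card A + card B" arbitrary: A B rule: less_induct)
  case less
  note ab = less.prems(1,2) and fin = less.prems(3,4) and dis = less.prems(5) and B1 = less.prems(6)
    and ev = less.prems(7) and p0 = less.prems(8) and feas = less.prems(9)
  define p where "p = card A"
  define q where "q = card B"
  note pq = p_def[symmetric] q_def[symmetric]
  note ev' = ev[unfolded pq] and feas' = feas[unfolded pq] and B1' = B1[unfolded pq]
  \<comment> \<open>For \<open>q \<le> b\<close> there is no clique of degree \<open>b\<close> to
    split off. The bound \<open>2 * b \<le> p + q\<close> becomes \<open>many\<close> in
    \<open>tri_real_peel_right\<close>, and \<open>univ\<close> isolates the size for which
    \<open>e\<close> would be \<open>b + 1\<close>.\<close>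
  consider (0) "p = 0" | (few) "1 \<le> p" "p < b" "q \<le> b" | (both) "b \<le> p" "p \<le> a" "q \<le> b"
    | (left) "a + 1 \<le> p" "q \<le> b" | (few') "1 \<le> p" "b + 1 \<le> q" "p + q < 2 * b"
    | (univ) "1 \<le> p" "p \<le> b" "b + 1 \<le> q" "a + 1 = p + q"
    | (right) "1 \<le> p" "b + 1 \<le> q" "2 * b \<le> p + q" "p \<le> b \<Longrightarrow> a + 1 \<noteq> p + q"
    by linarith
  then show ?case
  proof cases
    case 0
    then have "A = {}" using fin by (simp add: p_def)
    then show ?thesis using tri_real_regular[of B b a] p0 ev ab fin 0 by (auto simp: p_def)
  next
    case few
    have "p * (a + 1 - p) \<le> p * q" using feas' few by (simp add: mult.commute min_def)
    then have "a + 1 - p \<le> q" using few by simp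
    then have "a < p + q" by linarith
    then show ?thesis
      by (intro tri_real_few_vertices[OF fin dis p_def[symmetric] _ _ q_def[symmetric]])
        (use few ab ev' B1' in auto)
  next
    case both
    have "p * (a + 1 - p) \<le> q * b" using feas' both by (simp add: min_def split: if_splits)
    then show ?thesis
      by (intro tri_real_small_both[OF fin dis p_def[symmetric] _ _ q_def[symmetric]])
        (use both ab ev' in auto)
  next
    case left
    obtain Q where Q: "Q \<subseteq> A" "card Q = a + 1" "finite Q" using obtain_subset left pq by metis
    define G where "G = A - Q"
    define g where "g = card G"
    have G: "finite G" "G \<union> Q = A" "G \<inter> Q = {}" using fin Q by (auto simp: G_def)
    have cG: "p = g + (a + 1)" using left Q fin by (simp add: g_def G_def card_Diff_subset p_def)
    have dis': "G \<inter> B = {}" "(G \<union> B) \<inter> Q = {}" using dis Q(1) by (auto simp: G_def)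
    have evg: "even (g * a + q * b)" using ev' by (auto simp: cG distrib_right)
    show ?thesis
    proof (cases "g = 0 \<or> q * min g b < g * (a + 1 - g)")
      case True
      then have "tri_real a b (G \<union> Q) B"
        by (intro tri_real_peel_left[OF G(1) fin(2) Q(3) dis' g_def[symmetric] q_def[symmetric] Q(2) ab
          B1' left(2) evg])
      then show ?thesis using G by simp
    next
      case False
      have "tri_real a b G B"
        by (rule less.hyps) (use False ab G fin dis' B1 evg cG in \<open>auto simp: pq g_def[symmetric]\<close>)
      moreover have "tri_real b a {} Q"
        by (rule tri_real_complete) (use Q ab in auto)
      then have "tri_real a b Q {}" using tri_real_swap by blast
      ultimately have "tri_real a b (G \<union> Q) (B \<union> {})"
        by (rule tri_real_union) (use dis' in auto)
      then show ?thesis using G by simp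
    qed
  next
    case few'
    have "a < p + q"
    proof (rule ccontr)
      assume "\<not> a < p + q"
      then have *: "q < a + 1 - p" by linarith
      have "p * (a + 1 - p) \<le> q * p" by (rule order_trans[OF feas' mult_le_mono2[OF min.cobounded1]])
      then have "a + 1 - p \<le> q" using few' by (simp add: mult.commute[of q])
      then show False using * by simp
    qed
    then show ?thesis
      by (intro tri_real_few_vertices[OF fin dis p_def[symmetric] _ _ q_def[symmetric]])
        (use few' ab ev' B1' in auto)
  next
    case univ
    then show ?thesis
      by (intro tri_real_universal[OF fin dis p_def[symmetric] _ _ _ _ q_def[symmetric]])
        (use ab ev' in auto)
  next
    case right
    obtain Q where Q: "Q \<subseteq> B" "card Q = b + 1" "finite Q" using obtain_subset right pq by metis
    define H where "H = B - Q"
    define h where "h = card H"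
    have H: "finite H" "H \<union> Q = B" "H \<inter> Q = {}" using fin Q by (auto simp: H_def)
    have cH: "q = h + (b + 1)" using right Q fin by (simp add: h_def H_def card_Diff_subset q_def)
    have dis': "A \<inter> H = {}" "(A \<union> H) \<inter> Q = {}" using dis Q(1) H(3) by (auto simp: H_def)
    have evh: "even (p * a + h * b)" using ev' by (auto simp: cH distrib_right)
    have Q': "tri_real a b {} Q"
      by (rule tri_real_complete) (use Q ab in auto)
    show ?thesis
    proof (cases "h * min p b < p * (a + 1 - p)")
      case True
      have "tri_real a b A (H \<union> Q)"
        by (rule tri_real_peel_right[OF fin(1) H(1) Q(3) dis' p_def[symmetric] h_def[symmetric] Q(2) ab
          right(1) evh feas'[unfolded cH] True]) (use right cH in auto)
      then show ?thesis using H by simp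
    next
      case False
      have "tri_real a b A H"
      proof (cases "h = 0")
        case True
        then have "H = {}" using H by (simp add: h_def)
        \<comment> \<open>With \<open>H\<close> empty the inequality forces
          \<open>a + 1 \<le> p\<close>, so \<open>A\<close> carries a regular graph by
          itself.\<close>
        have "\<not> 0 < p * (a + 1 - p)" using True False by simp
        then have "a + 1 \<le> card A" using right p_def by simp
        then have "tri_real b a {} A"
          by (intro tri_real_regular) (use fin ab evh True in \<open>auto simp: p_def\<close>)
        then show ?thesis using tri_real_swap \<open>H = {}\<close> by blast
      next
        case h: False
        show ?thesis
          by (rule less.hyps) (use h False ab H fin dis' right evh cH in \<open>auto simp: pq h_def[symmetric]\<close>)
      qed
      then have "tri_real a b (A \<union> {}) (H \<union> Q)"
        by (rule tri_real_union[OF _ Q']) (use dis' in auto)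
      then show ?thesis using H by simp
    qed
  qed
qed

section \<open>Realisations\<close>

lemma card_arcs_between:
  assumes "gr V E" "X \<subseteq> V"
  shows "card (E \<inter> X \<times> Y) = (\<Sum>v\<in>X. card (E `` {v} \<inter> Y))"
proof -
  have "E \<inter> X \<times> Y = (SIGMA v:X. E `` {v} \<inter> Y)" by auto
  moreover have "finite X" using assms finite_subset grD(1) by blast
  ultimately show ?thesis using gr_fin_Image[OF assms(1)] by (simp add: card_SigmaI)
qed

text \<open>The linear order picks one arc of each edge, so \<open>E\<close> splits into
  \<open>L\<close> and its converse, of equal size.\<close>

lemma even_sum_deg:
  fixes V :: "'v::linorder set"
  assumes "gr V E"
  shows "even (\<Sum>v\<in>V. deg E v)"
proof -
  note g = grD[OF assms]
  define L where "L = {(x, y) \<in> E. x < y}"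
  have fE: "finite E" using g(1,2) by (meson finite_SigmaI finite_subset)
  have E: "E = L \<union> L\<inverse>" "L \<inter> L\<inverse> = {}" using g(3,4) by (auto simp: L_def) (metis linorder_neqE)
  have "finite L" using fE by (simp add: E(1))
  then have "card E = card L + card (L\<inverse>)" by (subst E(1), subst card_Un_disjoint) (use E(2) in auto)
  then have "even (card E)" by simp
  moreover have "E \<inter> V \<times> V = E" "\<And>v. E `` {v} \<inter> V = E `` {v}" using g(2) by auto
  ultimately show ?thesis using card_arcs_between[OF assms subset_refl, of V] by (simp add: deg_def)
qed

text \<open>These necessary conditions are all that is kept of the given realisation;
  \<open>tri_real_exists\<close> turns them into a triangular one.\<close>

lemma two_degree_conditions:
  fixes A B :: "'v::linorder set"
  assumes g: "gr (A \<union> B) E" and dis: "A \<inter> B = {}" and a: "\<And>v. v \<in> A \<Longrightarrow> deg E v = a"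
    and b: "\<And>v. v \<in> B \<Longrightarrow> deg E v = b"
  shows "even (card A * a + card B * b)"
    and "B \<noteq> {} \<Longrightarrow> b + 1 \<le> card A + card B"
    and "card A * (a + 1 - card A) \<le> card B * min (card A) b"
proof -
  note gD = grD[OF g]
  have fin: "finite A" "finite B" using gD(1) by auto
  have "(\<Sum>v\<in>A \<union> B. deg E v) = card A * a + card B * b"
    using a b by (simp add: sum.union_disjoint[OF fin dis])
  then show "even (card A * a + card B * b)" using even_sum_deg[OF g] by simp
  show "b + 1 \<le> card A + card B" if ne: "B \<noteq> {}"
  proof -
    obtain v where v: "v \<in> B" using ne by blast
    have "E `` {v} \<subset> A \<union> B" using v gD by blast
    then have "deg E v < card (A \<union> B)" unfolding deg_def by (intro psubset_card_mono gD(1))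
    then show ?thesis using b[OF v] card_Un_disjoint[OF fin dis] by simp
  qed
  have "a + 1 - card A \<le> card (E `` {v} \<inter> B)" if "v \<in> A" for v
  proof -
    have "E `` {v} \<inter> A \<subset> A" using that gD(4) by auto
    then have "card (E `` {v} \<inter> A) < card A" by (intro psubset_card_mono fin)
    moreover have "E `` {v} = (E `` {v} \<inter> A) \<union> (E `` {v} \<inter> B)" using gD(6) by auto
    then have "card (E `` {v}) \<le> card (E `` {v} \<inter> A) + card (E `` {v} \<inter> B)" by (metis card_Un_le)
    ultimately show ?thesis using a[OF that] by (simp add: deg_def)
  qed
  then have "card A * (a + 1 - card A) \<le> (\<Sum>v\<in>A. card (E `` {v} \<inter> B))"
    using sum_bounded_below[of A "a + 1 - card A"] by simp
  also have "\<dots> = card (E \<inter> A \<times> B)" using card_arcs_between[OF g] by simp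
  also have "E \<inter> A \<times> B = (E \<inter> B \<times> A)\<inverse>" using gD(3) by auto
  also have "card \<dots> = (\<Sum>v\<in>B. card (E `` {v} \<inter> A))" using card_arcs_between[OF g] by simp
  also have "\<dots> \<le> card B * min (card A) b"
  proof -
    have "card (E `` {v} \<inter> A) \<le> min (card A) b" if "v \<in> B" for v
      using b[OF that] card_mono[OF fin(1), of "E `` {v} \<inter> A"]
        card_mono[OF gr_fin_Image[OF g], of "E `` {v} \<inter> A" v] by (auto simp: deg_def)
    then show ?thesis using sum_bounded_above[of B _ "min (card A) b"] by simp
  qed
  finally show "card A * (a + 1 - card A) \<le> card B * min (card A) b" .
qed

lemma realisation_gr:
  assumes "realisation G ds"
  shows "\<exists>vs. distinct vs \<and> set vs = pverts G \<and> gr (set vs) (parcs G) \<and> map (deg (parcs G)) vs = ds"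
proof -
  have G: "pair_graph G" using assms by (simp add: realisation_def)
  interpret pair_graph G by (rule G)
  obtain vs where vs: "distinct vs" "set vs = pverts G" "map (vert_degree G) vs = ds"
    using assms by (auto simp: realisation_def)
  have "gr (pverts G) (parcs G)"
  proof (rule grI)
    show "parcs G \<subseteq> pverts G \<times> pverts G"
      by (auto dest: arc_fst_in_verts arc_snd_in_verts)
  qed (auto dest: no_loops' intro: arcs_symmetric)
  moreover have "vert_degree G v = deg (parcs G) v" for v
    by (simp add: vert_degree_eq_card[OF G] deg_def Image_singleton)
  ultimately show ?thesis using vs by (intro exI[of _ vs]) (simp add: fun_eq_iff cong: map_cong)
qed

lemma gr_realisation:
  fixes vs :: "'v list"
  assumes "distinct vs" "gr (set vs) E"
  defines "G \<equiv> \<lparr>pverts = set vs, parcs = E\<rparr>"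
  shows "realisation G (map (deg E) vs)" and "tri E \<Longrightarrow> triangular G"
proof -
  note g = grD[OF assms(2)]
  have G: "pair_graph G"
  proof
    show "finite (pverts G)" using g(1) by (simp add: G_def)
    show "finite (parcs G)" using finite_subset[OF g(2)] g(1) by (simp add: G_def)
    show "fst e \<in> pverts G" "snd e \<in> pverts G" if "e \<in> parcs G" for e
      using that g(2) by (auto simp: G_def)
    show "fst e \<noteq> snd e" if "e \<in> parcs G" for e
      using that g(4) by (cases e) (auto simp: G_def)
    show "symmetric (with_proj G)"
      unfolding symmetric_conv using g(3) by (force simp: G_def)
  qed
  have "vert_degree G = deg E"
    unfolding vert_degree_eq_card[OF G, abs_def] by (simp add: deg_def [abs_def] Image_singleton G_def)
  then show "realisation G (map (deg E) vs)"
    using G assms(1) unfolding realisation_def by (intro conjI exI[of _ vs]) (simp_all add: G_def)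
  show "triangular G" if T: "tri E"
    unfolding triangular_def three_cycle_def
  proof clarify
    fix x y assume "(x, y) \<in> parcs G"
    then have "(x, y) \<in> E" by (simp add: G_def)
    moreover obtain w where "(x, w) \<in> E" "(y, w) \<in> E"
      using T \<open>(x, y) \<in> E\<close> unfolding tri_def by blast
    ultimately show "\<exists>w. distinct [x, y, w] \<and> (x, y) \<in> parcs G \<and> (y, w) \<in> parcs G \<and> (w, x) \<in> parcs G"
      using g(3,4) by (intro exI[of _ w]) (auto simp: G_def)
  qed
qed

theorem mainTheorem1:
  fixes a b p q :: nat
  assumes "a > b" and "b \<ge> 4" and "p \<ge> 0" and "q > 0"
    and "graphical (replicate p a @ replicate q b)"
  shows "\<exists>G :: nat pair_pre_digraph.
           realisation G (replicate p a @ replicate q b) \<and> triangular G"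
proof -
  obtain G :: "nat pair_pre_digraph" where "realisation G (replicate p a @ replicate q b)"
    using assms(5) unfolding graphical_def by blast
  then obtain vs where vs: "distinct vs" "gr (set vs) (parcs G)"
    "map (deg (parcs G)) vs = replicate p a @ replicate q b"
    using realisation_gr by blast
  define A where "A = set (take p vs)"
  define B where "B = set (drop p vs)"
  have len: "length vs = p + q" using arg_cong[OF vs(3), of length] by simp
  have V: "set vs = A \<union> B" by (metis A_def B_def append_take_drop_id set_append)
  have dis: "A \<inter> B = {}" using vs(1) by (simp add: A_def B_def set_take_disj_set_drop_if_distinct)
  have card: "card A = p" "card B = q"
    using vs(1) len by (simp_all add: A_def B_def distinct_card)
  have "map (deg (parcs G)) (take p vs) = replicate p a" "map (deg (parcs G)) (drop p vs) = replicate q b"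
    using vs(3) by (simp_all add: take_map[symmetric] drop_map[symmetric])
  then have deg: "\<And>v. v \<in> A \<Longrightarrow> deg (parcs G) v = a" "\<And>v. v \<in> B \<Longrightarrow> deg (parcs G) v = b"
    unfolding A_def B_def by (metis in_set_replicate list.set_map imageI)+
  note cond = two_degree_conditions[OF vs(2)[unfolded V] dis deg, unfolded card]
  have "B \<noteq> {}" using card assms(4) by auto
  have fin: "finite A" "finite B" by (simp_all add: A_def B_def)
  have "tri_real a b A B"
    by (rule tri_real_exists[of b a A B, unfolded card])
      (use cond \<open>B \<noteq> {}\<close> assms(1,2,4) dis fin in auto)
  then obtain E where E: "gr (set vs) E" "tri E" "\<forall>v\<in>A. deg E v = a" "\<forall>v\<in>B. deg E v = b"
    unfolding tri_real_def V by blast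
  have "map (deg E) (take p vs @ drop p vs) = replicate p a @ replicate q b"
    unfolding map_append using E(3,4) len
    by (intro arg_cong2[where f = "(@)"] replicate_eqI) (auto simp: A_def B_def)
  then have "map (deg E) vs = replicate p a @ replicate q b" by simp
  then show ?thesis using gr_realisation[OF vs(1) E(1)] E(2) by metis
qed

end
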